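(* Let $\tau$ be an Archimedean tessellation of the plane of one of the types $(4.8^2)$, $(3.6.3.6)$, $(3.12^2)$, $(4.6.12)$, $(3.4.6.4)$, $(3^2.4.3.4)$. Let $\sigma = i$ if $\tau$ is of type $(4.8^2)$ or $(3^2.4.3.4)$, and $\sigma=\omega:=(1+i\sqrt3)/2$ otherwise, and identify $T_\tau$ with $\mathbb Z[\sigma]$. Let $\alpha,\beta\in\mathbb Z[\sigma]\setminus\{0\}$ with $\alpha/\beta\notin\mathbb Q$, and let $\tau_{\alpha,\beta}=\tau/\langle\alpha,\beta\rangle$. Put $c=\gcd(\mathrm{Re}\,\alpha,\mathrm{Im}\,\alpha,\mathrm{Re}\,\beta,\mathrm{Im}\,\beta)$. Then the map $\tau_\eta$ with $$\eta=\begin{cases}\dfrac{\mathrm{Im}(\overline\alpha\beta)}{N(1+\sigma)\,c}\,(1+\sigma), & \text{if } N(1+\sigma)\text{ divides both } \dfrac{\mathrm{Re}\,\alpha}{c}-\dfrac{\mathrm{Im}\,\alpha}{c}\text{ and }\dfrac{\mathrm{Re}\,\beta}{c}-\dfrac{\mathrm{Im}\,\beta}{c},\\[2mm] \dfrac{\mathrm{Im}(\overline\alpha\beta)}{c}, & \text{otherwise,}\end{cases}$$ is the unique minimal almost regular cover of $\tau_{\alpha,\beta}$. Moreover, the number $K_{\min}$ of fundamental regions of $\tau_{\alpha,\beta}$ glued together in order to obtain a fundamental region of $\tau_\eta$ is $$K_{\min}=\begin{cases}\dfrac{|\mathrm{Im}(\overline\alpha\beta)|}{N(1+\sigma)\,c^2},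 & \text{if } N(1+\sigma)\text{ divides both } \dfrac{\mathrm{Re}\,\alpha}{c}-\dfrac{\mathrm{Im}\,\alpha}{c}\text{ and }\dfrac{\mathrm{Re}\,\beta}{c}-\dfrac{\mathrm{Im}\,\beta}{c},\\[2mm] \dfrac{|\mathrm{Im}(\overline\alpha\beta)|}{c^2}, & \text{otherwise.}\end{cases}$$
   Context: A tessellation $\tau$ of the Euclidean plane by regular polygons (edge-to-edge) is Archimedean if its symmetry group acts transitively on its vertices; its type $(p_1.p_2.\ldots.p_k)$ lists in cyclic order the polygons around a vertex (exponents denote repetition). $\mathrm{Aut}(\tau)$ is the group of isometries preserving $\tau$ and $T_\tau$ is its subgroup of all translations. A toroidal map of the same type is a quotient $\tau/G$, where $G\le T_\tau$ is generated by two linearly independent translations; its fundamental region is the parallelogram spanned by a pair of generators of $G$. A flag of $\tau$ is a triple of an incident vertex, edge and face; a flag of $\tau/G$ is a $G$-orbit of flags of $\tau$. $\mathrm{Aut}(\tau/G)\cong \mathrm{Norm}_{\mathrm{Aut}(\tau)}(G)/G$ is the group induced by the normalizer of $G$ in $\mathrm{Aut}(\tau)$. $\tau/G$ is almost regular if its number of flag orbits under $\mathrm{Aut}(\tau/G)$ equals the number of flag orbits of $\tau$ under $\mathrm{Aut}(\tau)$. $\tau/H$ is a cover of $\tau/G$ if $H\le G$; toroidal maps are ordered by $\mathcal M\le\mathcal N$ iff $\mathcal N$ covers $\mathcal M$. A minimal almost regular cover of $\mathcal M$ is a minimal element of the set of almost regular toroidal maps covering $\mathcal M$. When $\tau/H$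 covers $\tau/G$, the number of fundamental regions of $\tau/G$ glued together to obtain a fundamental region of $\tau/H$ equals the index $[G:H]$. Coordinates: the plane is given Cartesian coordinates (with suitable scaling, origin at a vertex of $\tau$) such that shortest translational symmetries generating $T_\tau$ are $\mathbf e_1=(1,0)$, $\mathbf e_2=(0,1)$ for types $(4.8^2)$, $(3^2.4.3.4)$, and $\mathbf e_1=(1,0)$, $\mathbf e_2=(1/2,\sqrt3/2)$ for the other types listed. The translation $u_1\mathbf e_1+u_2\mathbf e_2\in T_\tau$ is identified with $u_1+u_2\sigma\in\mathbb Z[\sigma]=\{a+b\sigma: a,b\in\mathbb Z\}$. For $\alpha=a+b\sigma\in\mathbb Z[\sigma]$: $\overline\alpha=a+b\overline\sigma$ is the complex conjugate, $N(\alpha)=\alpha\overline\alpha$, and (non-standard when $\sigma=\omega$) $\mathrm{Re}\,\alpha:=a$, $\mathrm{Im}\,\alpha:=b$. The map $\tau_\eta$ denotes $\tau_{\eta,\sigma\eta}=\tau/\langle\eta,\sigma\eta\rangle$. The gcd is the positive gcd of rational integers. *)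

theory Defs
  imports "HOL-Analysis.Analysis" "HOL-Algebra.Group_Action" "HOL-Algebra.Generated_Groups"
begin

text \<open>The Euclidean plane is the type \<^typ>\<open>complex\<close>. A tessellation is given by its set of
  faces; each face is a (filled, closed) regular polygon.\<close>

definition regular_polygon :: "nat \<Rightarrow> complex set \<Rightarrow> bool" where
  "regular_polygon n P \<longleftrightarrow>
     n \<ge> 3 \<and> (\<exists>c r. r \<noteq> 0 \<and> P = convex hull ((\<lambda>z. c + r * z) ` {z. z ^ n = 1}))"

text \<open>For distinct faces \<open>P\<close> and \<open>Q\<close>, the set \<open>P \<inter> Q\<close> being a face of both polygons in the sense
  of \<^const>\<open>face_of\<close> says that it is empty, a common vertex or a common edge; this is the
  edge-to-edge condition, and it also makes the interiors disjoint. The last conjunct is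
  local finiteness.\<close>

definition tessellation :: "complex set set \<Rightarrow> bool" where
  "tessellation \<tau> \<longleftrightarrow>
     (\<forall>P\<in>\<tau>. \<exists>n. regular_polygon n P) \<and>
     \<Union>\<tau> = UNIV \<and>
     (\<forall>P\<in>\<tau>. \<forall>Q\<in>\<tau>. P \<noteq> Q \<longrightarrow> (P \<inter> Q) face_of P \<and> (P \<inter> Q) face_of Q) \<and>
     (\<forall>K. compact K \<longrightarrow> finite {P\<in>\<tau>. P \<inter> K \<noteq> {}})"

definition vertices :: "complex set set \<Rightarrow> complex set" where
  "vertices \<tau> = {v. \<exists>P\<in>\<tau>. v extreme_point_of P}"

definition edges :: "complex set set \<Rightarrow> complex set set" where
  "edges \<tau> = {e. \<exists>P\<in>\<tau>. e edge_of P}"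

definition plane_isometry :: "(complex \<Rightarrow> complex) \<Rightarrow> bool" where
  "plane_isometry f \<longleftrightarrow> surj f \<and> (\<forall>x y. dist (f x) (f y) = dist x y)"

definition Aut :: "complex set set \<Rightarrow> (complex \<Rightarrow> complex) monoid" where
  "Aut \<tau> = \<lparr>carrier = {f. plane_isometry f \<and> (\<lambda>P. f ` P) ` \<tau> = \<tau>}, mult = (\<circ>), one = id\<rparr>"

text \<open>Translation by \<open>v\<close> is \<open>(+) v\<close>.\<close>

definition translation_group :: "complex set set \<Rightarrow> (complex \<Rightarrow> complex) set" where
  "translation_group \<tau> = {f \<in> carrier (Aut \<tau>). \<exists>v. f = (+) v}"

definition archimedean :: "complex set set \<Rightarrow> bool" where
  "archimedean \<tau> \<longleftrightarrow> tessellation \<tau> \<and>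
     (\<forall>v\<in>vertices \<tau>. \<forall>w\<in>vertices \<tau>. \<exists>f\<in>carrier (Aut \<tau>). f v = w)"

text \<open>The list \<open>Ps\<close> enumerates all faces around the vertex \<open>v\<close>; since cyclically consecutive
  faces share an edge at \<open>v\<close>, it does so in cyclic order. Starting face and direction are free.\<close>

definition vertex_type :: "complex set set \<Rightarrow> complex \<Rightarrow> nat list \<Rightarrow> bool" where
  "vertex_type \<tau> v ps \<longleftrightarrow>
     (\<exists>Ps. length Ps = length ps \<and> distinct Ps \<and> set Ps = {P\<in>\<tau>. v \<in> P} \<and>
        (\<forall>j<length ps. regular_polygon (ps ! j) (Ps ! j)) \<and>
        (\<forall>j<length ps. \<exists>e. v \<in> e \<and> e edge_of (Ps ! j) \<and>
                              e edge_of (Ps ! (Suc j mod length ps))))"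

definition has_type :: "complex set set \<Rightarrow> nat list \<Rightarrow> bool" where
  "has_type \<tau> ps \<longleftrightarrow> (\<forall>v\<in>vertices \<tau>. vertex_type \<tau> v ps)"


text \<open>A toroidal map \<open>\<tau>/G\<close> is represented by the group \<open>G\<close> of translations.\<close>

definition torus_group :: "complex set set \<Rightarrow> complex \<Rightarrow> complex \<Rightarrow> (complex \<Rightarrow> complex) set" where
  "torus_group \<tau> \<alpha> \<beta> = generate (Aut \<tau>) {(+) \<alpha>, (+) \<beta>}"

definition toroidal :: "complex set set \<Rightarrow> (complex \<Rightarrow> complex) set \<Rightarrow> bool" where
  "toroidal \<tau> G \<longleftrightarrow>
     (\<exists>\<alpha> \<beta>. (+) \<alpha> \<in> translation_group \<tau> \<and> (+) \<beta> \<in> translation_group \<tau> \<and>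
            \<alpha> \<noteq> \<beta> \<and> independent {\<alpha>, \<beta>} \<and> G = torus_group \<tau> \<alpha> \<beta>)"

type_synonym flag = "complex \<times> complex set \<times> complex set"

definition flags :: "complex set set \<Rightarrow> flag set" where
  "flags \<tau> = {(v, e, P). v \<in> vertices \<tau> \<and> e \<in> edges \<tau> \<and> P \<in> \<tau> \<and> v \<in> e \<and> e \<subseteq> P}"

definition flag_act :: "(complex \<Rightarrow> complex) \<Rightarrow> flag \<Rightarrow> flag" where
  "flag_act f = (\<lambda>(v, e, P). (f v, f ` e, f ` P))"

definition quotient_flags :: "complex set set \<Rightarrow> (complex \<Rightarrow> complex) set \<Rightarrow> flag set set" where
  "quotient_flags \<tau> G = orbits (Aut \<tau>\<lparr>carrier := G\<rparr>) (flags \<tau>) flag_act"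

definition quotient_Aut ::
    "complex set set \<Rightarrow> (complex \<Rightarrow> complex) set \<Rightarrow> (complex \<Rightarrow> complex) set monoid" where
  "quotient_Aut \<tau> G = (Aut \<tau>\<lparr>carrier := normalizer (Aut \<tau>) G\<rparr>) Mod G"

text \<open>The induced action of a coset \<open>X\<close> of \<open>G\<close> in its normalizer on a \<open>G\<close>-orbit of flags.\<close>

definition quotient_flag_act :: "(complex \<Rightarrow> complex) set \<Rightarrow> flag set \<Rightarrow> flag set" where
  "quotient_flag_act X F = (\<Union>f\<in>X. flag_act f ` F)"

definition almost_regular :: "complex set set \<Rightarrow> (complex \<Rightarrow> complex) set \<Rightarrow> bool" where
  "almost_regular \<tau> G \<longleftrightarrow>
     card (orbits (quotient_Aut \<tau> G) (quotient_flags \<tau> G) quotient_flag_act) =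
     card (orbits (Aut \<tau>) (flags \<tau>) flag_act)"

definition covers :: "(complex \<Rightarrow> complex) set \<Rightarrow> (complex \<Rightarrow> complex) set \<Rightarrow> bool" where
  "covers H G \<longleftrightarrow> H \<subseteq> G"

definition almost_regular_cover ::
    "complex set set \<Rightarrow> (complex \<Rightarrow> complex) set \<Rightarrow> (complex \<Rightarrow> complex) set \<Rightarrow> bool" where
  "almost_regular_cover \<tau> G H \<longleftrightarrow> toroidal \<tau> H \<and> almost_regular \<tau> H \<and> covers H G"

definition minimal_almost_regular_cover ::
    "complex set set \<Rightarrow> (complex \<Rightarrow> complex) set \<Rightarrow> (complex \<Rightarrow> complex) set \<Rightarrow> bool" where
  "minimal_almost_regular_cover \<tau> G H \<longleftrightarrow>
     almost_regular_cover \<tau> G H \<and>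
     (\<forall>K. almost_regular_cover \<tau> G K \<and> covers H K \<longrightarrow> K = H)"

definition glued_regions ::
    "complex set set \<Rightarrow> (complex \<Rightarrow> complex) set \<Rightarrow> (complex \<Rightarrow> complex) set \<Rightarrow> nat" where
  "glued_regions \<tau> G H = card (rcosets\<^bsub>Aut \<tau>\<lparr>carrier := G\<rparr>\<^esub> H)"


definition omega :: complex where
  "omega = Complex (1/2) (sqrt 3 / 2)"

definition int_lattice :: "complex \<Rightarrow> complex set" where
  "int_lattice \<sigma> = {of_int a + of_int b * \<sigma> | a b. True}"

text \<open>Coordinates with respect to the basis \<open>1, \<sigma>\<close>; for \<^term>\<open>\<sigma> = omega\<close> these are not the
  usual real and imaginary parts.\<close>

definition re_coord :: "complex \<Rightarrow> complex \<Rightarrow> int" where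
  "re_coord \<sigma> z = (THE a. \<exists>b::int. z = of_int a + of_int b * \<sigma>)"

definition im_coord :: "complex \<Rightarrow> complex \<Rightarrow> int" where
  "im_coord \<sigma> z = (THE b. \<exists>a::int. z = of_int a + of_int b * \<sigma>)"

definition int_norm :: "complex \<Rightarrow> int" where
  "int_norm z = (THE n. of_int n = z * cnj z)"

end

theory Submission
  imports Defs
begin

text \<open>The theorem combines a group-theoretic reading of almost regularity, a rigidity argument for the
tessellation, and arithmetic in \<open>\<int>[\<sigma>]\<close>.

\<^emph>\<open>Almost regular means normal.\<close> The symmetry group has finitely many orbits on flags, because it is
transitive on vertices and every vertex lies on finitely many faces, and some flag is fixed by the
identity only. The flag orbits of \<open>\<tau>/G\<close> correspond to the orbits of the normalizer of \<open>G\<close> on the flags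
of \<open>\<tau>\<close>. Equal orbit numbers therefore force every symmetry into the normalizer
(\<open>almost_regular_iff_normal\<close>). For a group of translations by a lattice \<open>L\<close> this says that the linear
parts of all symmetries map \<open>L\<close> onto itself.

\<^emph>\<open>The linear parts.\<close> They preserve the translation lattice \<open>\<int>[\<sigma>]\<close>, so they are multiplications by
units, possibly followed by conjugation. What has to be shown is that there are enough of them: a
rotation that generates \<open>\<int>[\<sigma>]\<close> over \<open>\<int>\<close> together with 1, and a reflection. All angles that occur at a vertex are multiples of
15 degrees, so the faces at a vertex form the image, under a similarity called a frame, of one fixed
star that is encoded by a finite set of pairs of a direction modulo 24 and a number of sides. A move is an
isometry that turns every frame into another frame when it is applied first. The two faces on an edge
mostly determine the star at the other end, which gives a move along every edge of the star. As the
vertices are connected by edges, an isometry that takes one frame to another is a symmetry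
(\<open>frame_extends_to_symmetry\<close>); hence each move yields a symmetry with a known linear part. Only for
the type \<open>(3\<^sup>2.4.3.4)\<close> is an edge with its two faces ambiguous, and a short look at a third vertex
settles it.

\<^emph>\<open>Arithmetic.\<close> Thus the almost regular covers of \<open>\<tau>/\<langle>\<alpha>,\<beta>\<rangle>\<close> are the full sublattices of \<open>\<langle>\<alpha>,\<beta>\<rangle>\<close> that are
closed under multiplication by \<open>\<sigma>\<close> and under conjugation, and a unique minimal cover is a largest such
sublattice. Divide by \<open>c\<close> and let \<open>D\<close> be the determinant of the coordinates of \<open>\<alpha>\<close> and \<open>\<beta>\<close>. An integer
whose multiples by 1 and \<open>\<sigma>\<close> both lie in the lattice is divisible by \<open>D\<close>. Applied to traces of elements
this nearly gives the claim, and the remaining factor \<open>N(1 + \<sigma>)\<close>, which is 2 or 3, is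
decided by the divisibility condition (\<open>invariant_sublattice_bound\<close>). The index is a quotient of
determinants (\<open>lattice_index\<close>).\<close>

section \<open>Regular polygons seen from a corner\<close>

text \<open>For a regular polygon with \<open>n\<close> corners that is traversed counterclockwise, \<open>zeta n\<close> turns each edge
vector into the next, and \<open>turn n\<close> turns the edge vector leaving a corner into the direction of the other
edge at that corner; its argument is the interior angle.\<close>

definition zeta :: "nat \<Rightarrow> complex" where "zeta n = cis (2 * pi / real n)"
definition turn :: "nat \<Rightarrow> complex" where "turn n = cis (pi - 2 * pi / real n)"

text \<open>The regular \<open>n\<close>-gon that lies to the left of its edge from \<open>v\<close> to \<open>v + d\<close>. Describing a face by one of its
corners makes the faces around a vertex comparable.\<close>

definition ngon :: "nat \<Rightarrow> complex \<Rightarrow> complex \<Rightarrow> complex set" where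
  "ngon n v d = convex hull ((\<lambda>z. v + d * ((z - 1) / (zeta n - 1))) ` {z. z ^ n = 1})"

lemma turn_zeta: "turn n * zeta n = -1"
  by (simp add: turn_def zeta_def cis_mult)

lemma zeta_nonzero [simp]: "zeta n \<noteq> 0" and turn_nonzero [simp]: "turn n \<noteq> 0"
  by (simp_all add: zeta_def turn_def)

lemma norm_turn [simp]: "norm (turn n) = 1"
  by (simp add: turn_def)

lemma corner_angle:
  assumes "n \<ge> 3" shows "0 < pi - 2 * pi / real n" "pi - 2 * pi / real n < pi"
  using assms by (simp_all add: field_simps)

lemma Im_turn_pos: "n \<ge> 3 \<Longrightarrow> Im (turn n) > 0"
  using corner_angle sin_gt_zero unfolding turn_def by simp

lemma zeta_ne_1: assumes "n \<ge> 3" shows "zeta n \<noteq> 1"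
proof
  assume "zeta n = 1"
  then have "turn n = -1" using turn_zeta[of n] by simp
  then show False using Im_turn_pos[OF assms] by simp
qed

lemma zeta_power: "n \<ge> 3 \<Longrightarrow> zeta n ^ n = 1"
  using Complex.DeMoivre[of "2 * pi / real n" n] by (simp add: zeta_def)

lemma cis_in_cone:
  assumes "0 \<le> \<phi>" "\<phi> \<le> \<theta>" "0 < \<theta>" "\<theta> < pi"
  shows "\<exists>p q. p \<ge> 0 \<and> q \<ge> 0 \<and> cis \<phi> = of_real p + of_real q * cis \<theta>"
proof (intro exI conjI)
  have s: "sin \<theta> > 0" using assms by (simp add: sin_gt_zero)
  show "sin (\<theta> - \<phi>) / sin \<theta> \<ge> 0" "sin \<phi> / sin \<theta> \<ge> 0"
    using assms s by (auto intro!: divide_nonneg_pos sin_ge_zero)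
  show "cis \<phi> = of_real (sin (\<theta> - \<phi>) / sin \<theta>) + of_real (sin \<phi> / sin \<theta>) * cis \<theta>"
    using s by (simp add: complex_eq_iff sin_diff field_simps)
qed

text \<open>Half angles turn the quotient into a positive multiple of \<open>cis ((k - 1) * a)\<close> with \<open>a = pi / n\<close>, and for
\<open>k < n\<close> this argument stays below the interior angle \<open>(n - 2) * a\<close>.\<close>

lemma root_in_cone:
  assumes n: "n \<ge> 3" and z: "z ^ n = 1"
  shows "\<exists>p q. p \<ge> 0 \<and> q \<ge> 0 \<and> (z - 1) / (zeta n - 1) = of_real p + of_real q * turn n"
proof -
  obtain k where k: "k < n" "z = cis (2 * pi * real k / real n)"
    using Complex.bij_betw_roots_unity[of n] n z unfolding bij_betw_def by auto
  define a where "a = pi / real n"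
  have c2: "cis (2 * x) - 1 = 2 * \<i> * of_real (sin x) * cis x" for x
    using sin_cos_squared_add[of x] by (simp add: complex_eq_iff cos_double sin_double power2_eq_square)
  have z1: "z - 1 = 2 * \<i> * of_real (sin (k * a)) * cis (k * a)"
    using c2[of "k * a"] k by (simp add: a_def mult_ac)
  have e1: "zeta n - 1 = 2 * \<i> * of_real (sin a) * cis a"
    using c2[of a] by (simp add: a_def zeta_def mult_ac)
  have sa: "sin a > 0" using n by (auto simp: a_def field_simps intro!: sin_gt_zero)
  show ?thesis
  proof (cases "k = 0")
    case True
    then show ?thesis using z1 by (intro exI[of _ 0]) simp
  next
    case False
    have th: "pi - 2 * pi / n = (n - 2) * a" using n by (simp add: a_def field_simps)
    have "cis (k * a) = cis ((k - 1) * a) * cis a"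
      using False by (simp add: cis_mult algebra_simps)
    then have r: "(z - 1) / (zeta n - 1) = of_real (sin (k * a) / sin a) * cis ((k - 1) * a)"
      using z1 e1 sa by simp
    have a0: "a > 0" using n by (simp add: a_def)
    have "real k * a \<le> pi" using k n by (simp add: a_def field_simps)
    then have s: "sin (k * a) / sin a \<ge> 0"
      using sa a0 by (intro divide_nonneg_pos sin_ge_zero) auto
    have "real (k - 1) * a \<le> real (n - 2) * a"
      using a0 k False by (intro mult_right_mono) linarith+
    then have "\<exists>p q. p \<ge> 0 \<and> q \<ge> 0 \<and> cis ((k - 1) * a) = of_real p + of_real q * turn n"
      unfolding turn_def using th a0 corner_angle[OF n] n
      by (intro cis_in_cone) (auto)
    then obtain p q where "p \<ge> 0" "q \<ge> 0" "cis ((k - 1) * a) = of_real p + of_real q * turn n"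
      by blast
    note pq = this
    define t where "t = sin (k * a) / sin a"
    have "(z - 1) / (zeta n - 1) = of_real (t * p) + of_real (t * q) * turn n"
      unfolding r pq(3) t_def[symmetric] by (simp add: algebra_simps)
    moreover have "t * p \<ge> 0" "t * q \<ge> 0" using pq s unfolding t_def[symmetric] by simp_all
    ultimately show ?thesis by blast
  qed
qed

lemma ngon_in_cone:
  assumes n: "n \<ge> 3" and x: "x \<in> ngon n v d"
  obtains p q where "p \<ge> 0" "q \<ge> 0" "x = v + d * (of_real p + of_real q * turn n)"
proof -
  define C where "C = {v + d * (of_real p + of_real q * turn n) | p q. p \<ge> 0 \<and> q \<ge> 0}"
  have "convex C"
  proof (rule convexI)
    fix x y and u w :: real assume "x \<in> C" "y \<in> C" and u: "0 \<le> u" "0 \<le> w" "u + w = 1"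
    then obtain p q p' q' where *: "p \<ge> 0" "q \<ge> 0" "p' \<ge> 0" "q' \<ge> 0"
        "x = v + d * (of_real p + of_real q * turn n)" "y = v + d * (of_real p' + of_real q' * turn n)"
      unfolding C_def by blast
    have w: "w = 1 - u" using u by simp
    then have "u *\<^sub>R x + w *\<^sub>R y = v + d * (of_real (u * p + w * p') + of_real (u * q + w * q') * turn n)"
      unfolding *(5,6) w by (simp add: scaleR_conv_of_real algebra_simps)
    moreover have "u * p + w * p' \<ge> 0" "u * q + w * q' \<ge> 0" using * u by simp_all
    ultimately show "u *\<^sub>R x + w *\<^sub>R y \<in> C" unfolding C_def by blast
  qed
  moreover have "(\<lambda>z. v + d * ((z - 1) / (zeta n - 1))) ` {z. z ^ n = 1} \<subseteq> C"
  proof (intro image_subsetI)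
    fix z :: complex assume "z \<in> {z. z ^ n = 1}"
    then obtain p q where "p \<ge> 0" "q \<ge> 0" "(z - 1) / (zeta n - 1) = of_real p + of_real q * turn n"
      using root_in_cone[OF n] by blast
    then show "v + d * ((z - 1) / (zeta n - 1)) \<in> C" unfolding C_def by auto
  qed
  ultimately have "ngon n v d \<subseteq> C"
    unfolding ngon_def by (rule hull_minimal[rotated])
  with x that show ?thesis unfolding C_def by blast
qed

text \<open>Reading the same polygon from the next corner permutes the roots of unity.\<close>

lemma ngon_rotate:
  assumes n: "n \<ge> 3" shows "ngon n (v + d) (d * zeta n) = ngon n v d"
proof -
  have "(\<lambda>z. v + d * ((z - 1) / (zeta n - 1))) ` {z. z ^ n = 1}
      = (\<lambda>z. v + d * ((z - 1) / (zeta n - 1))) ` ((*) (zeta n) ` {z. z ^ n = 1})"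
  proof (rule arg_cong[where f = "image _"], intro equalityI subsetI)
    fix z :: complex assume z: "z \<in> {z. z ^ n = 1}"
    then have "z = zeta n * (z / zeta n)" "(z / zeta n) ^ n = 1"
      using n by (simp_all add: power_divide zeta_power)
    then show "z \<in> (*) (zeta n) ` {z. z ^ n = 1}" by blast
  qed (use n in \<open>auto simp: power_mult_distrib zeta_power\<close>)
  also have "\<dots> = (\<lambda>z. (v + d) + (d * zeta n) * ((z - 1) / (zeta n - 1))) ` {z. z ^ n = 1}"
    unfolding image_image using zeta_ne_1[OF n]
    by (intro image_cong) (auto simp: field_simps)
  finally show ?thesis unfolding ngon_def by simp
qed

lemma ngon_rotate_back:
  assumes n: "n \<ge> 3"
  shows "ngon n (v + d * turn n) (- d * turn n) = ngon n v d"
proof -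
  have "(- d * turn n) * zeta n = d" using turn_zeta[of n] by (simp add: mult.assoc)
  then show ?thesis using ngon_rotate[OF n, of "v + d * turn n" "- d * turn n"] by simp
qed

lemma ngon_corners:
  assumes n: "n \<ge> 3"
  shows "v \<in> ngon n v d" "v + d \<in> ngon n v d"
    "v + d * turn n \<in> ngon n v d"
proof -
  show *: "v \<in> ngon n v d" for v d
    unfolding ngon_def by (rule hull_inc) (rule image_eqI[of _ _ 1], auto)
  show "v + d \<in> ngon n v d"
    using *[of "v + d" "d * zeta n"] ngon_rotate[OF n] by simp
  show "v + d * turn n \<in> ngon n v d"
    using *[of "v + d * turn n" "- d * turn n"] ngon_rotate_back[OF n] by simp
qed

lemma convex_ngon [simp]: "convex (ngon n v d)"
  by (simp add: ngon_def)

lemma cone_coords_unique: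
  assumes "n \<ge> 3" and "of_real p + of_real q * turn n = of_real p' + of_real q' * turn n"
  shows "p = p'" "q = q'"
proof -
  show q: "q = q'"
    using arg_cong[OF assms(2), of Im] Im_turn_pos[OF assms(1)] by simp
  show "p = p'"
    using arg_cong[OF assms(2), of Re] q by simp
qed

lemma corner_extreme:
  assumes n: "n \<ge> 3" and d: "d \<noteq> 0"
  shows "v extreme_point_of ngon n v d"
  unfolding extreme_point_of_def
proof (intro conjI ballI)
  show "v \<in> ngon n v d" using ngon_corners n by blast
  fix a b assume ab: "a \<in> ngon n v d" "b \<in> ngon n v d"
  show "v \<notin> open_segment a b"
  proof
    assume "v \<in> open_segment a b"
    then obtain u where u: "0 < u" "u < 1" "v = (1 - u) *\<^sub>R a + u *\<^sub>R b" and ne: "a \<noteq> b"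
      by (auto simp: in_segment)
    obtain p q where a: "p \<ge> 0" "q \<ge> 0" "a = v + d * (of_real p + of_real q * turn n)"
      using ngon_in_cone[OF n ab(1)] .
    obtain p' q' where b: "p' \<ge> 0" "q' \<ge> 0" "b = v + d * (of_real p' + of_real q' * turn n)"
      using ngon_in_cone[OF n ab(2)] .
    have "d * (of_real ((1 - u) * p + u * p') + of_real ((1 - u) * q + u * q') * turn n) = 0"
      using u(3) unfolding a b by (simp add: scaleR_conv_of_real algebra_simps)
    then have "of_real ((1 - u) * p + u * p') + of_real ((1 - u) * q + u * q') * turn n
        = of_real 0 + of_real 0 * turn n" using d by simp
    from cone_coords_unique[OF n this]
    have "(1 - u) * p + u * p' = 0" "(1 - u) * q + u * q' = 0" .
    moreover have "(1 - u) * p \<ge> 0" "u * p' \<ge> 0" "(1 - u) * q \<ge> 0" "u * q' \<ge> 0"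
      using a(1,2) b(1,2) u(1,2) by simp_all
    ultimately have "(1 - u) * p = 0" "u * p' = 0" "(1 - u) * q = 0" "u * q' = 0" by linarith+
    then have "p = 0" "p' = 0" "q = 0" "q' = 0" using u(1,2) by auto
    with a b ne show False by simp
  qed
qed

text \<open>The point is an interior point of the triangle spanned by the corner and its two neighbours.\<close>

lemma corner_interior:
  assumes n: "n \<ge> 3" and d: "d \<noteq> 0" and pq: "0 < p" "0 < q" "p + q < 1"
  shows "v + d * (of_real p + of_real q * turn n) \<in> interior (ngon n v d)"
proof -
  have nc: "\<not> collinear {v, v + d, v + d * turn n}"
  proof
    assume "collinear {v, v + d, v + d * turn n}"
    then have "collinear {v + d, v, v + d * turn n}" by (simp add: insert_commute)
    then have "collinear {0, d, d * turn n}" by (simp add: collinear_3)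
    then have "d * turn n / d \<in> \<real>" using collinear_iff_Reals by simp
    then have "turn n \<in> \<real>" using d by simp
    then show False using Im_turn_pos[OF n] complex_is_Real_iff by simp
  qed
  have "v + d * (of_real p + of_real q * turn n)
      = (1 - p - q) *\<^sub>R v + p *\<^sub>R (v + d) + q *\<^sub>R (v + d * turn n)"
    by (simp add: scaleR_conv_of_real algebra_simps)
  then have "v + d * (of_real p + of_real q * turn n) \<in> interior (convex hull {v, v + d, v + d * turn n})"
    unfolding interior_convex_hull_3_minimal[OF nc DIM_complex] mem_Collect_eq using pq
    by (intro exI[of _ "1 - p - q"] exI[of _ p] exI[of _ q]) simp
  moreover have "convex hull {v, v + d, v + d * turn n} \<subseteq> ngon n v d"
    using ngon_corners[OF n] by (intro hull_minimal) auto
  ultimately show ?thesis using interior_mono by blast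
qed

text \<open>A point with two positive coordinates would, pulled towards the corner, be an interior point of the
polygon, and a proper face contains none of those.\<close>

lemma proper_face_at_corner:
  assumes n: "n \<ge> 3" and d: "d \<noteq> 0"
    and F: "F face_of ngon n v d" "F \<noteq> ngon n v d" and v: "v \<in> F" and x: "x \<in> F" "x \<noteq> v"
  shows "\<exists>p>0. x = v + of_real p * d \<or> x = v + of_real p * (d * turn n)"
proof -
  have "x \<in> ngon n v d" using F(1) x(1) face_of_imp_subset by blast
  then obtain p q where pq: "p \<ge> 0" "q \<ge> 0" and xe: "x = v + d * (of_real p + of_real q * turn n)"
    using ngon_in_cone[OF n] by metis
  have "\<not> (p > 0 \<and> q > 0)"
  proof
    assume pos: "p > 0 \<and> q > 0"
    (* this factor brings the coordinates of x below the edge joining the two neighbours of v *)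
    define s where "s = 1 / (1 + p + q)"
    have s: "s > 0" "s \<le> 1" "s * p + s * q < 1" using pos by (simp_all add: s_def divide_simps)
    have "v + d * (of_real (s * p) + of_real (s * q) * turn n) \<in> interior (ngon n v d)"
      using pos s by (intro corner_interior[OF n d]) simp_all
    moreover have "v + d * (of_real (s * p) + of_real (s * q) * turn n) = (1 - s) *\<^sub>R v + s *\<^sub>R x"
      unfolding xe by (simp add: scaleR_conv_of_real algebra_simps)
    moreover have "(1 - s) *\<^sub>R v + s *\<^sub>R x \<in> F"
      using face_of_imp_convex[OF F(1)] v x(1) s by (simp add: convex_alt)
    ultimately show False using face_of_disjoint_interior[OF F] by auto
  qed
  then consider "q = 0" | "p = 0" using pq by linarith
  then show ?thesis
  proof cases
    case 1
    then have "p > 0" using x(2) xe pq by (cases "p = 0") auto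
    then show ?thesis using 1 xe by (intro exI[of _ p]) (simp add: mult.commute)
  next
    case 2
    then have "q > 0" using x(2) xe pq by (cases "q = 0") auto
    then show ?thesis using 2 xe by (intro exI[of _ q]) (simp add: mult_ac)
  qed
qed

lemma regular_polygon_at_corner:
  assumes P: "regular_polygon n P" and v: "v extreme_point_of P"
  shows "\<exists>d. d \<noteq> 0 \<and> P = ngon n v d"
proof -
  obtain c r where n: "n \<ge> 3" and r: "r \<noteq> 0" and Pe: "P = convex hull ((\<lambda>z. c + r * z) ` {z. z ^ n = 1})"
    using P unfolding regular_polygon_def by blast
  obtain w where w: "w ^ n = 1" and vw: "v = c + r * w"
    using v unfolding Pe by (auto dest: extreme_point_of_convex_hull)
  have w0: "w \<noteq> 0" using w n by (auto simp: power_0_left)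
  define d where "d = r * w * (zeta n - 1)"
  have d0: "d \<noteq> 0" using r w0 zeta_ne_1[OF n] by (simp add: d_def)
  have "{z. z ^ n = 1} = (*) w ` {z. z ^ n = 1}"
  proof (intro equalityI subsetI)
    fix z :: complex assume z: "z \<in> {z. z ^ n = 1}"
    then have "z = w * (z / w)" "(z / w) ^ n = 1"
      using w w0 by (simp_all add: power_divide)
    then show "z \<in> (*) w ` {z. z ^ n = 1}" by blast
  qed (use w in \<open>auto simp: power_mult_distrib\<close>)
  then have "(\<lambda>z. c + r * z) ` {z. z ^ n = 1} = (\<lambda>z. c + r * z) ` ((*) w ` {z. z ^ n = 1})"
    by (rule arg_cong)
  also have "\<dots> = (\<lambda>z. v + d * ((z - 1) / (zeta n - 1))) ` {z. z ^ n = 1}"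
    unfolding image_image vw d_def using zeta_ne_1[OF n]
    by (intro image_cong) (auto simp: field_simps)
  finally have "P = ngon n v d" unfolding Pe ngon_def by (rule arg_cong)
  with d0 show ?thesis by blast
qed

lemma turn_inj:
  assumes "n \<ge> 3" "m \<ge> 3" "turn n = turn m" shows "n = m"
proof -
  have "Re (turn n) = Re (turn m)" using assms(3) by (rule arg_cong)
  then have "cos (pi - 2 * pi / real n) = cos (pi - 2 * pi / real m)"
    unfolding turn_def cis.sel .
  then have "pi - 2 * pi / real n = pi - 2 * pi / real m"
    using corner_angle[OF assms(1)] corner_angle[OF assms(2)]
    by - (rule cos_inj_pi; linarith)
  then have "2 * pi / real n = 2 * pi / real m" by linarith
  then have "real n = real m" using assms(1,2) by (simp add: frac_eq_eq)
  then show ?thesis by simp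
qed

text \<open>Each of the two interior angles contains the other, so they agree, and the angle determines \<open>n\<close>.\<close>

lemma ngon_same_edge:
  assumes n: "n \<ge> 3" and m: "m \<ge> 3" and d: "d \<noteq> 0" and eq: "ngon n v d = ngon m v d"
  shows "n = m"
proof -
  have "v + d * turn m \<in> ngon n v d" using ngon_corners(3)[OF m] eq by simp
  then obtain p q where pq: "p \<ge> 0" "q \<ge> 0" "turn m = of_real p + of_real q * turn n"
    using ngon_in_cone[OF n] d by (metis add_left_cancel mult_left_cancel)
  have "v + d * turn n \<in> ngon m v d"
    using ngon_corners(3)[OF n, of v d] by (simp add: eq)
  then obtain p' q' where pq': "p' \<ge> 0" "q' \<ge> 0" "turn n = of_real p' + of_real q' * turn m"
    using ngon_in_cone[OF m] d by (metis add_left_cancel mult_left_cancel)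
  have "of_real 0 + of_real 1 * turn n = of_real (p' + q' * p) + of_real (q' * q) * turn n"
    using pq' pq by (simp add: algebra_simps)
  from cone_coords_unique[OF n this] have *: "0 = p' + q' * p" "1 = q' * q" .
  have "q' * p \<ge> 0" using pq pq' by simp
  then have "p' = 0" using * pq' by linarith
  then have tn: "turn n = of_real q' * turn m" using pq' by simp
  have "norm (turn n) = \<bar>q'\<bar> * norm (turn m)" unfolding tn by (simp only: norm_mult norm_of_real)
  then have "q' = 1" using pq'(2) by simp
  then show ?thesis using tn turn_inj[OF n m] by simp
qed

lemma next_corner_extreme:
  assumes "n \<ge> 3" "d \<noteq> 0"
  shows "v + d extreme_point_of ngon n v d"
    "v + d * turn n extreme_point_of ngon n v d"
  using corner_extreme[of n "d * zeta n" "v + d"] ngon_rotate[of n v d]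
    corner_extreme[of n "- d * turn n" "v + d * turn n"] ngon_rotate_back[of n v d] assms
  by auto

text \<open>Otherwise one of the two points would lie strictly between \<open>v\<close> and the other.\<close>

lemma extreme_points_on_ray:
  fixes v d :: complex
  assumes "v + of_real p * d extreme_point_of P" "v + d extreme_point_of P" "v \<in> P" "p > 0" "d \<noteq> 0"
  shows "p = 1"
proof (rule ccontr)
  assume "p \<noteq> 1"
  then consider "p < 1" | "p > 1" by linarith
  then show False
  proof cases
    case 1
    then have "v + of_real p * d \<in> open_segment v (v + d)"
      using assms by (auto simp: in_segment scaleR_conv_of_real algebra_simps intro!: exI[of _ p])
    then show False using assms unfolding extreme_point_of_def by blast
  next
    case 2
    then have "v + d = (1 - 1 / p) *\<^sub>R v + (1 / p) *\<^sub>R (v + of_real p * d)" "0 < 1 / p" "1 / p < 1"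
      by (simp_all add: scaleR_conv_of_real algebra_simps)
    moreover have "v \<noteq> v + of_real p * d" using 2 assms by simp
    ultimately have "v + d \<in> open_segment v (v + of_real p * d)"
      unfolding in_segment by blast
    then show False using assms unfolding extreme_point_of_def by blast
  qed
qed

text \<open>A polygon with a marked corner determines its description: the quotient of the two edge vectors and its
inverse both lie in the closed upper half plane, hence the vectors are parallel, and both end at extreme
points.\<close>

lemma ngon_unique:
  assumes n: "n \<ge> 3" and m: "m \<ge> 3" and d: "d \<noteq> 0" "d' \<noteq> 0"
    and eq: "ngon n v d = ngon m v d'"
  shows "n = m" "d = d'"
proof -
  have "v + d' \<in> ngon n v d" using ngon_corners(2)[OF m] eq by simp
  then obtain p q where pq: "p \<ge> 0" "q \<ge> 0" "d' = d * (of_real p + of_real q * turn n)"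
    using ngon_in_cone[OF n] by (metis add_left_cancel)
  have "v + d \<in> ngon m v d'" using ngon_corners(2)[OF n] eq by metis
  then obtain p' q' where pq': "p' \<ge> 0" "q' \<ge> 0" "d = d' * (of_real p' + of_real q' * turn m)"
    using ngon_in_cone[OF m] by (metis add_left_cancel)
  define w where "w = of_real p + of_real q * turn n"
  define w' where "w' = of_real p' + of_real q' * turn m"
  have "d' = d * w" "d = d' * w'" using pq(3) pq'(3) by (simp_all only: w_def w'_def)
  then have "d * 1 = d * (w * w')" by (metis mult.assoc mult_1_right)
  then have "w * w' = 1" using d by simp
  then have "w' = inverse w" by (metis inverse_unique)
  then have i: "Im w' = - Im w / (norm w)\<^sup>2" by (simp add: Im_divide inverse_eq_divide cmod_power2)
  have iw: "Im w = q * Im (turn n)" "Im w' = q' * Im (turn m)" by (simp_all add: w_def w'_def)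
  have "Im w \<ge> 0" "Im w' \<ge> 0"
    unfolding iw using pq pq' Im_turn_pos[OF n] Im_turn_pos[OF m] by simp_all
  moreover have "(norm w)\<^sup>2 > 0" using \<open>w * w' = 1\<close> by auto
  ultimately have "Im w = 0" using i by (simp add: field_simps)
  then have "q = 0" using iw Im_turn_pos[OF n] by simp
  then have dp: "d' = of_real p * d" using pq by simp
  then have p0: "p > 0" using d pq(1) by (cases "p = 0") auto
  have "p = 1"
  proof (rule extreme_points_on_ray)
    show "v + of_real p * d extreme_point_of ngon n v d"
      using next_corner_extreme(1)[OF m d(2), of v] dp eq by simp
    show "v + d extreme_point_of ngon n v d" using next_corner_extreme(1)[OF n d(1)] .
  qed (use p0 d ngon_corners[OF n] in auto)
  then show "d = d'" using dp by simp
  with ngon_same_edge[OF n m d(1)] eq show "n = m" by simp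
qed

text \<open>The smaller interior angle is contained in the larger one, and both triangles at the corner contain all
short vectors in the smaller angle.\<close>

lemma overlap_same_edge:
  assumes n: "n \<ge> 3" and m: "m \<ge> 3" and d: "d \<noteq> 0"
  shows "interior (ngon n v d) \<inter> interior (ngon m v d) \<noteq> {}"
proof -
  have *: "interior (ngon n v d) \<inter> interior (ngon m v d) \<noteq> {}"
    if nm: "n \<le> m" "n \<ge> 3" "m \<ge> 3" for n m
  proof -
    have "pi - 2 * pi / real n \<le> pi - 2 * pi / real m"
      using nm by (simp add: frac_le)
    then obtain p q where pq: "p \<ge> 0" "q \<ge> 0" "turn n = of_real p + of_real q * turn m"
      using cis_in_cone[of "pi - 2 * pi / real n" "pi - 2 * pi / real m"] corner_angle[OF nm(2)] corner_angle[OF nm(3)]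
      unfolding turn_def by auto
    have "q \<noteq> 0" using pq(3) Im_turn_pos[OF nm(2)] by (auto simp: complex_eq_iff)
    then have q: "q > 0" using pq by simp
    define s where "s = 1 / (3 + p + q)"
    have s: "s > 0" "2 * s < 1" "s + s * p + s * q < 1" using pq by (simp_all add: s_def divide_simps)
    have "v + d * (of_real s + of_real s * turn n) \<in> interior (ngon n v d)"
      using s by (intro corner_interior nm d) simp_all
    moreover have "v + d * (of_real (s + s * p) + of_real (s * q) * turn m) \<in> interior (ngon m v d)"
      using s pq q by (intro corner_interior nm d) (simp_all add: add_pos_nonneg)
    moreover have "v + d * (of_real s + of_real s * turn n) = v + d * (of_real (s + s * p) + of_real (s * q) * turn m)"
      unfolding pq(3) by (simp add: algebra_simps)
    ultimately show ?thesis by auto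
  qed
  show ?thesis using *[of n m] *[of m n] n m by (cases "n \<le> m") auto
qed

section \<open>Similarities of the plane\<close>

definition simil :: "complex \<Rightarrow> complex \<Rightarrow> bool \<Rightarrow> complex \<Rightarrow> complex" where
  "simil b l c z = b + l * (if c then cnj z else z)"

lemma simil_hull: "simil b l c ` (convex hull S) = convex hull (simil b l c ` S)"
proof -
  have lin: "linear (\<lambda>z. l * (if c then cnj z else z))"
    by (cases c) (auto intro!: linearI simp: algebra_simps scaleR_conv_of_real)
  have "simil b l c ` S = (+) b ` (\<lambda>z. l * (if c then cnj z else z)) ` S" for S
    by (simp add: image_image simil_def)
  then show ?thesis
    by (simp only: convex_hull_translation convex_hull_linear_image[OF lin, symmetric])
qed

text \<open>A reflected polygon lies to the left of the image of its other edge at the corner; this is why the second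
case involves \<open>turn n\<close>.\<close>

lemma simil_ngon:
  assumes n: "n \<ge> 3"
  shows "simil b l c ` ngon n v d =
    ngon n (simil b l c v) (l * (if c then cnj (d * turn n) else d))"
proof (cases c)
  case False
  then show ?thesis
    unfolding ngon_def simil_hull image_image
    by (intro arg_cong[where f = "(hull) convex"] image_cong) (auto simp: simil_def algebra_simps)
next
  case True
  have z1: "cnj (zeta n) = 1 / zeta n" by (simp add: zeta_def cis_cnj inverse_eq_divide[symmetric])
  have t: "turn n = - 1 / zeta n" using turn_zeta[of n] by (simp add: field_simps)
  have roots: "{z::complex. z ^ n = 1} = cnj ` {z. z ^ n = 1}"
  proof (intro equalityI subsetI)
    fix z :: complex assume "z \<in> {z. z ^ n = 1}"
    then have "cnj z ^ n = 1" by (simp flip: complex_cnj_power)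
    then show "z \<in> cnj ` {z. z ^ n = 1}" by (intro image_eqI[of _ _ "cnj z"]) auto
  next
    fix z :: complex assume "z \<in> cnj ` {z. z ^ n = 1}"
    then obtain y where "z = cnj y" "y ^ n = 1" by blast
    then show "z \<in> {z. z ^ n = 1}"
      unfolding mem_Collect_eq by (metis complex_cnj_one complex_cnj_power)
  qed
  have key: "cnj d * ((cnj z - 1) / (cnj (zeta n) - 1)) = cnj (d * turn n) * ((cnj z - 1) / (zeta n - 1))" for z
    unfolding t using zeta_ne_1[OF n] z1 by (simp add: field_simps)
  have "simil b l c ` ngon n v d = convex hull ((\<lambda>z. simil b l c v + l * cnj (d * turn n) * ((cnj z - 1) / (zeta n - 1))) ` {z. z ^ n = 1})"
    unfolding ngon_def simil_hull image_image using True key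
    by (intro arg_cong[where f = "(hull) convex"] image_cong) (auto simp: simil_def algebra_simps)
  also have "(\<lambda>z. simil b l c v + l * cnj (d * turn n) * ((cnj z - 1) / (zeta n - 1))) ` {z. z ^ n = 1}
     = (\<lambda>z. simil b l c v + l * cnj (d * turn n) * ((z - 1) / (zeta n - 1))) ` (cnj ` {z. z ^ n = 1})"
    by (simp only: image_image)
  finally show ?thesis unfolding ngon_def roots[symmetric] using True by simp
qed

section \<open>Faces around a vertex\<close>

lemma regular_polygon_compact_convex:
  assumes "regular_polygon n P" shows "compact P" "convex P" "P \<noteq> {}" "polytope P"
proof -
  obtain c r where n: "n \<ge> 3" and P: "P = convex hull ((\<lambda>z. c + r * z) ` {z. z ^ n = 1})"
    using assms unfolding regular_polygon_def by blast
  have fin: "finite {z::complex. z ^ n = 1}" using n by (intro finite_roots_unity) simp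
  show "compact P" unfolding P using fin by (intro compact_convex_hull finite_imp_compact finite_imageI)
  show "convex P" unfolding P by simp
  show "polytope P" unfolding P by (intro polytope_convex_hull finite_imageI fin)
  have "c + r * 1 \<in> P" unfolding P by (intro hull_inc imageI) simp
  then show "P \<noteq> {}" by blast
qed

lemma tessellationD:
  assumes "tessellation \<tau>"
  shows "P \<in> \<tau> \<Longrightarrow> \<exists>n. regular_polygon n P" and "\<Union>\<tau> = UNIV"
    and "P \<in> \<tau> \<Longrightarrow> Q \<in> \<tau> \<Longrightarrow> P \<noteq> Q \<Longrightarrow> (P \<inter> Q) face_of P \<and> (P \<inter> Q) face_of Q"
    and "compact K \<Longrightarrow> finite {P\<in>\<tau>. P \<inter> K \<noteq> {}}"
  using assms by (simp_all add: tessellation_def)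

lemma face_properties:
  assumes "tessellation \<tau>" "P \<in> \<tau>" shows "compact P" "convex P" "P \<noteq> {}" "polytope P"
proof -
  obtain n where "regular_polygon n P" using tessellationD(1)[OF assms] by blast
  from regular_polygon_compact_convex[OF this]
  show "compact P" "convex P" "P \<noteq> {}" "polytope P" .
qed

lemma faces_meet_in_face:
  assumes "tessellation \<tau>" "P \<in> \<tau>" "Q \<in> \<tau>"
  shows "(P \<inter> Q) face_of P" "(P \<inter> Q) face_of Q"
  using tessellationD(3)[OF assms] face_of_refl[OF face_properties(2)[OF assms(1,2)]]
  by (cases "P = Q"; simp)+

text \<open>The intersection is a face of each polygon, and a face that meets the interior is everything.\<close>

lemma faces_eq_if_interior_meets:
  assumes T: "tessellation \<tau>" and PQ: "P \<in> \<tau>" "Q \<in> \<tau>" and x: "x \<in> interior P" "x \<in> Q"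
  shows "P = Q"
proof -
  have "P \<inter> Q = P"
    using face_of_disjoint_interior[OF faces_meet_in_face(1)[OF T PQ]] x interior_subset[of P] by blast
  then have "x \<in> interior Q" using x(1) interior_mono[of P Q] by blast
  then have "P \<inter> Q = Q"
    using face_of_disjoint_interior[OF faces_meet_in_face(2)[OF T PQ]] x interior_subset[of P] by blast
  with \<open>P \<inter> Q = P\<close> show ?thesis by simp
qed

lemma vertex_extreme:
  assumes T: "tessellation \<tau>" and v: "v \<in> vertices \<tau>" and P: "P \<in> \<tau>" "v \<in> P"
  shows "v extreme_point_of P"
proof -
  obtain Q where Q: "Q \<in> \<tau>" "v extreme_point_of Q" using v unfolding vertices_def by blast
  have "v \<in> Q" using Q(2) by (simp add: extreme_point_of_def)
  then show ?thesis
    using extreme_point_of_face[OF faces_meet_in_face(1)[OF T P(1) Q(1)]]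
      extreme_point_of_face[OF faces_meet_in_face(2)[OF T P(1) Q(1)]] Q(2) P(2) by blast
qed

lemma face_at_vertex:
  assumes T: "tessellation \<tau>" and v: "v \<in> vertices \<tau>" and P: "P \<in> \<tau>" "v \<in> P"
  obtains n d where "n \<ge> 3" "d \<noteq> 0" "P = ngon n v d"
proof -
  obtain n where n: "regular_polygon n P" using tessellationD(1)[OF T P(1)] by blast
  then have "n \<ge> 3" by (simp add: regular_polygon_def)
  moreover obtain d where "d \<noteq> 0" "P = ngon n v d"
    using regular_polygon_at_corner[OF n vertex_extreme[OF T v P]] by blast
  ultimately show ?thesis by (rule that)
qed

lemma vertexI: "P \<in> \<tau> \<Longrightarrow> v extreme_point_of P \<Longrightarrow> v \<in> vertices \<tau>"
  unfolding vertices_def by auto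

lemma corners_are_vertices:
  assumes "n \<ge> 3" "d \<noteq> 0" "ngon n v d \<in> \<tau>"
  shows "v \<in> vertices \<tau>" "v + d \<in> vertices \<tau>" "v + d * turn n \<in> vertices \<tau>"
  using vertexI[OF assms(3)] corner_extreme[OF assms(1,2)] next_corner_extreme[OF assms(1,2)] by simp_all

lemma face_right_of_edge_unique:
  assumes T: "tessellation \<tau>" and n: "n \<ge> 3" and m: "m \<ge> 3" and d: "d \<noteq> 0"
    and "ngon n v d \<in> \<tau>" "ngon m v d \<in> \<tau>"
  shows "n = m"
proof -
  obtain x where "x \<in> interior (ngon n v d)" "x \<in> ngon m v d"
    using overlap_same_edge[OF n m d, of v] interior_subset[of "ngon m v d"] by blast
  then have "ngon n v d = ngon m v d"
    by (rule faces_eq_if_interior_meets[OF T assms(5,6)])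
  then show ?thesis using ngon_same_edge[OF n m d] by simp
qed

text \<open>This is uniqueness of the face on one side of an edge, read from the other end of the edge.\<close>

lemma face_left_of_edge_unique:
  assumes T: "tessellation \<tau>" and n: "n \<ge> 3" and m: "m \<ge> 3" and d: "d \<noteq> 0" "d' \<noteq> 0"
    and "ngon n v d \<in> \<tau>" "ngon m v d' \<in> \<tau>" and eq: "d * turn n = d' * turn m"
  shows "n = m" "d = d'"
proof -
  have "ngon n (v + d * turn n) (- d * turn n) \<in> \<tau>"
    using assms(6) by (simp only: ngon_rotate_back[OF n])
  moreover have "ngon m (v + d * turn n) (- d * turn n) \<in> \<tau>"
    using ngon_rotate_back[OF m, of v d'] assms(7) eq by simp
  ultimately show *: "n = m"
    using face_right_of_edge_unique[OF T n m, of "- d * turn n" "v + d * turn n"] d by simp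
  then show "d = d'" using eq by simp
qed

text \<open>If \<open>v + p * u\<close> lies inside the segment, the defining property of a face applies; if it lies beyond the end,
convexity does.\<close>

lemma proper_face_contains_edge_end:
  fixes v u :: complex
  assumes F: "F face_of P" and v: "v \<in> F" "v + u \<in> P" and p: "p > 0" "v + of_real p * u \<in> F" and u: "u \<noteq> 0"
  shows "v + u \<in> F"
proof (cases "p < 1")
  case True
  then have "v + of_real p * u \<in> open_segment v (v + u)"
    using p u by (auto simp: in_segment scaleR_conv_of_real algebra_simps intro!: exI[of _ p])
  moreover have "v \<in> P" using F v(1) face_of_imp_subset by blast
  ultimately show ?thesis using F v p unfolding face_of_def by blast
next
  case False
  then have "v + u = (1 - 1 / p) *\<^sub>R v + (1 / p) *\<^sub>R (v + of_real p * u)" "0 \<le> 1 / p" "1 / p \<le> 1"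
    by (simp_all add: scaleR_conv_of_real algebra_simps)
  then show ?thesis using face_of_imp_convex[OF F] v p unfolding convex_alt by metis
qed

text \<open>Neighbouring faces at a vertex continue each other in the cyclic order: the second begins where the first
ends. The intersection is a proper face of both polygons, so the common point lies on a bounding ray of
both angles; the edges on that ray have equal length because their ends are extreme points of the same
polygons. Two faces that both begin or both end at the same edge would overlap.\<close>

lemma faces_sharing_edge:
  assumes T: "tessellation \<tau>" and n: "n \<ge> 3" and m: "m \<ge> 3" and d: "d \<noteq> 0" "d' \<noteq> 0"
    and P: "ngon n v d \<in> \<tau>" and Q: "ngon m v d' \<in> \<tau>"
    and ne: "ngon n v d \<noteq> ngon m v d'"
    and x: "x \<in> ngon n v d" "x \<in> ngon m v d'" "x \<noteq> v"
  shows "d' = d * turn n \<or> d = d' * turn m"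
proof -
  let ?P = "ngon n v d" and ?Q = "ngon m v d'"
  define F where "F = ?P \<inter> ?Q"
  have FP: "F face_of ?P" and FQ: "F face_of ?Q"
    unfolding F_def using faces_meet_in_face[OF T P Q] .
  have "interior ?P \<noteq> {}" "interior ?Q \<noteq> {}"
    using overlap_same_edge[OF n n d(1), of v] overlap_same_edge[OF m m d(2), of v] by auto
  then have neq: "F \<noteq> ?P" "F \<noteq> ?Q"
    using faces_eq_if_interior_meets[OF T P Q] faces_eq_if_interior_meets[OF T Q P] ne
      interior_subset[of ?P] interior_subset[of ?Q]
    unfolding F_def by blast+
  have vF: "v \<in> F" and xF: "x \<in> F" using ngon_corners(1) n m x by (auto simp: F_def)
  obtain p u where p: "p > 0" "x = v + of_real p * u" "u = d \<or> u = d * turn n"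
    using proper_face_at_corner[OF n d(1) FP neq(1) vF xF x(3)] by blast
  obtain p' u' where p': "p' > 0" "x = v + of_real p' * u'" "u' = d' \<or> u' = d' * turn m"
    using proper_face_at_corner[OF m d(2) FQ neq(2) vF xF x(3)] by blast
  have u0: "u \<noteq> 0" "u' \<noteq> 0" using p p' d by auto
  have eP: "v + u extreme_point_of ?P" using next_corner_extreme[OF n d(1)] p(3) by auto
  have eQ': "v + u' extreme_point_of ?Q" using next_corner_extreme[OF m d(2)] p'(3) by auto
  have "v + u \<in> F"
    using proper_face_contains_edge_end[OF FP vF _ p(1) _ u0(1)] eP xF p(2)
    by (simp add: extreme_point_of_def)
  then have eQ: "v + u extreme_point_of ?Q"
    using eP extreme_point_of_face[OF FP] extreme_point_of_face[OF FQ] by blast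
  have eq: "of_real p * u = of_real p' * u'" using p(2) p'(2) by simp
  then have u': "u' = of_real (p / p') * u" using p'(1) by (simp add: field_simps)
  have "p / p' = 1"
  proof (rule extreme_points_on_ray[OF _ eQ])
    show "v + of_real (p / p') * u extreme_point_of ?Q" using eQ' u' by simp
  qed (use ngon_corners[OF m] p p' u0 in auto)
  then have uu: "u = u'" using u' by simp
  have "\<not> (u = d \<and> u' = d')"
  proof
    assume "u = d \<and> u' = d'"
    then have "d = d'" using uu by metis
    then show False using face_right_of_edge_unique[OF T n m d(1) P] Q ne by auto
  qed
  moreover have "\<not> (u = d * turn n \<and> u' = d' * turn m)"
  proof
    assume "u = d * turn n \<and> u' = d' * turn m"
    then have "d * turn n = d' * turn m" using uu by metis
    then show False using face_left_of_edge_unique[OF T n m d P Q] ne by auto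
  qed
  ultimately show ?thesis using p(3) p'(3) uu by metis
qed

section \<open>Connectedness of the vertex set\<close>

text \<open>Local finiteness makes the union of any family of faces closed.\<close>

lemma closed_Union_faces:
  assumes T: "tessellation \<tau>" and S: "S \<subseteq> \<tau>"
  shows "closed (\<Union>S)"
proof -
  have "open (- \<Union>S)"
    unfolding open_contains_ball
  proof
    fix x assume x: "x \<in> - \<Union>S"
    define F where "F = {P \<in> S. P \<inter> cball x 1 \<noteq> {}}"
    have "finite {P\<in>\<tau>. P \<inter> cball x 1 \<noteq> {}}" by (rule tessellationD(4)[OF T compact_cball])
    then have "finite F" by (rule rev_finite_subset) (use S F_def in auto)
    moreover have "\<forall>P\<in>F. closed P" using face_properties(1)[OF T] S compact_imp_closed by (auto simp: F_def)
    ultimately have "open (ball x 1 - \<Union>F)" by (intro open_Diff closed_Union) auto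
    moreover have "x \<in> ball x 1 - \<Union>F" using x by (auto simp: F_def)
    ultimately obtain e where "e > 0" and e: "ball x e \<subseteq> ball x 1 - \<Union>F"
      unfolding open_contains_ball by blast
    moreover have "(ball x 1 - \<Union>F) \<subseteq> - \<Union>S"
      using ball_subset_cball[of x 1] unfolding F_def by blast
    ultimately show "\<exists>e>0. ball x e \<subseteq> - \<Union>S" by blast
  qed
  then show ?thesis by (simp add: closed_def)
qed

lemma zeta_power_eq_cis: "zeta n ^ k = cis (2 * pi * real k / real n)"
  unfolding zeta_def Complex.DeMoivre by (simp add: mult_ac)

text \<open>Walking around a face visits all of its corners.\<close>

lemma step_closed_contains_polygon:
  assumes n: "n \<ge> 3" and d: "d \<noteq> 0" and P: "ngon n v d \<in> \<tau>" and v: "v \<in> C"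
    and step: "\<And>v n d. v \<in> C \<Longrightarrow> n \<ge> 3 \<Longrightarrow> d \<noteq> 0 \<Longrightarrow> ngon n v d \<in> \<tau> \<Longrightarrow> v + d \<in> C"
    and y: "y extreme_point_of ngon n v d"
  shows "y \<in> C"
proof -
  have "(v + d * ((zeta n ^ k - 1) / (zeta n - 1)) \<in> C) \<and>
     ngon n (v + d * ((zeta n ^ k - 1) / (zeta n - 1))) (d * zeta n ^ k) = ngon n v d" for k
  proof (induction k)
    case (Suc k)
    let ?w = "v + d * ((zeta n ^ k - 1) / (zeta n - 1))"
    have e: "v + d * ((zeta n ^ Suc k - 1) / (zeta n - 1)) = ?w + d * zeta n ^ k"
      using zeta_ne_1[OF n] by (simp add: field_simps)
    have "?w + d * zeta n ^ k \<in> C" using Suc step[of ?w n "d * zeta n ^ k"] P n d by simp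
    moreover have "ngon n (?w + d * zeta n ^ k) (d * zeta n ^ k * zeta n) = ngon n v d"
      using ngon_rotate[OF n] Suc by simp
    ultimately show ?case unfolding e by (simp add: mult_ac)
  qed (use v in simp)
  moreover obtain z where z: "z ^ n = 1" "y = v + d * ((z - 1) / (zeta n - 1))"
    using y unfolding ngon_def by (auto dest: extreme_point_of_convex_hull)
  moreover obtain k where "z = zeta n ^ k"
    using Complex.bij_betw_roots_unity[of n] n z(1) unfolding bij_betw_def zeta_power_eq_cis by auto
  ultimately show ?thesis by blast
qed

text \<open>The faces with a corner in \<open>C\<close> and the other faces cover the plane by two closed sets. These are
disjoint: two faces that meet have a common corner, namely an extreme point of their intersection.\<close>

lemma vertices_connected:
  assumes T: "tessellation \<tau>" and C: "C \<subseteq> vertices \<tau>" "C \<noteq> {}"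
    and step: "\<And>v n d. v \<in> C \<Longrightarrow> n \<ge> 3 \<Longrightarrow> d \<noteq> 0 \<Longrightarrow> ngon n v d \<in> \<tau> \<Longrightarrow> v + d \<in> C"
  shows "C = vertices \<tau>"
proof -
  have all: "y \<in> C" if "P \<in> \<tau>" "v \<in> C" "v extreme_point_of P" "y extreme_point_of P" for P v y
  proof -
    have "v \<in> P" using that by (simp add: extreme_point_of_def)
    from face_at_vertex[OF T subsetD[OF C(1) that(2)] that(1) this]
    obtain n d where nd: "n \<ge> 3" "d \<noteq> 0" and P: "P = ngon n v d" .
    show ?thesis
      by (rule step_closed_contains_polygon[OF nd that(1)[unfolded P] that(2) step that(4)[unfolded P]])
  qed
  define S where "S = {P \<in> \<tau>. \<exists>v\<in>C. v extreme_point_of P}"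
  define A B where "A = \<Union>S" and "B = \<Union>(\<tau> - S)"
  have sub: "S \<subseteq> \<tau>" by (auto simp: S_def)
  have cl: "closed A" "closed B" unfolding A_def B_def using sub by (intro closed_Union_faces[OF T]; blast)+
  have "S \<union> (\<tau> - S) = \<tau>" using sub by blast
  then have un: "A \<union> B = UNIV" unfolding A_def B_def by (metis Union_Un_distrib tessellationD(2)[OF T])
  have disj: "A \<inter> B = {}"
  proof (rule ccontr)
    assume "A \<inter> B \<noteq> {}"
    then obtain x P Q where P: "P \<in> S" and Q: "Q \<in> \<tau>" "Q \<notin> S" and x: "x \<in> P \<inter> Q"
      unfolding A_def B_def by blast
    have P\<tau>: "P \<in> \<tau>" using P sub by blast
    have "compact (P \<inter> Q)" "convex (P \<inter> Q)"
      using face_properties(1,2)[OF T P\<tau>] face_properties(1,2)[OF T Q(1)]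
      by (simp_all add: compact_Int convex_Int)
    then obtain y where y: "y extreme_point_of (P \<inter> Q)"
      using extreme_point_exists_convex x by (metis empty_iff)
    then have yP: "y extreme_point_of P" and yQ: "y extreme_point_of Q"
      using extreme_point_of_face[OF faces_meet_in_face(1)[OF T P\<tau> Q(1)]]
        extreme_point_of_face[OF faces_meet_in_face(2)[OF T P\<tau> Q(1)]] by blast+
    obtain v where "v \<in> C" "v extreme_point_of P" using P unfolding S_def by blast
    then have "y \<in> C" using all[OF P\<tau> _ _ yP] by blast
    then show False using yQ Q unfolding S_def by blast
  qed
  have "A \<noteq> {}"
  proof -
    obtain v where v: "v \<in> C" using C(2) by blast
    then obtain P where "P \<in> \<tau>" "v extreme_point_of P" using C(1) unfolding vertices_def by blast
    then have "P \<in> S" "v \<in> P" using v unfolding S_def by (auto simp: extreme_point_of_def)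
    then show ?thesis unfolding A_def by blast
  qed
  then have "B = {}"
    using connected_UNIV[where 'a = complex] cl un disj unfolding connected_closed by auto
  then have inS: "P \<in> S" if "P \<in> \<tau>" for P using face_properties(3)[OF T that] that unfolding B_def by blast
  have "v \<in> C" if v: "v \<in> vertices \<tau>" for v
  proof -
    obtain P where P: "P \<in> \<tau>" "v extreme_point_of P" using v unfolding vertices_def by blast
    then obtain w where "w \<in> C" "w extreme_point_of P" using inS[OF P(1)] unfolding S_def by blast
    then show ?thesis using all[OF P(1) _ _ P(2)] by blast
  qed
  then show ?thesis using C(1) by blast
qed

section \<open>Plane isometries\<close>

lemma plane_isometry_simil:
  assumes "norm l = 1" shows "plane_isometry (simil b l c)"
  unfolding plane_isometry_def
proof (intro conjI allI)
  have l0: "l \<noteq> 0" using assms by auto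
  show "surj (simil b l c)"
  proof (rule surjI)
    fix y show "simil b l c (if c then cnj ((y - b) / l) else (y - b) / l) = y"
      using l0 by (simp add: simil_def)
  qed
  fix x y
  have "simil b l c x - simil b l c y = l * (if c then cnj (x - y) else x - y)"
    by (simp add: simil_def algebra_simps)
  moreover have "norm (if c then cnj (x - y) else x - y) = norm (x - y)"
    by (cases c) (simp_all only: complex_mod_cnj if_True if_False)
  ultimately have "norm (simil b l c x - simil b l c y) = norm (x - y)"
    using assms by (simp only: norm_mult)
  then show "dist (simil b l c x) (simil b l c y) = dist x y" by (simp add: dist_norm)
qed

lemma plane_isometry_is_simil:
  assumes f: "plane_isometry f"
  shows "\<exists>b l c. norm l = 1 \<and> f = simil b l c"
proof -
  define g where "g = (\<lambda>z. f z - f 0)"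
  have "orthogonal_transformation g"
    unfolding orthogonal_transformation_isometry using f by (simp add: g_def plane_isometry_def dist_norm)
  then have lin: "linear g" and ip: "g x \<bullet> g y = x \<bullet> y" for x y
    unfolding orthogonal_transformation_def by auto
  define l where "l = g 1"
  define m where "m = g \<i>"
  have n1: "l \<bullet> l = 1" "m \<bullet> m = 1" "l \<bullet> m = 0" unfolding l_def m_def ip by (simp_all add: inner_complex_def)
  have nl: "norm l = 1" using n1 by (simp add: norm_eq_1)
  have gz: "g z = of_real (Re z) * l + of_real (Im z) * m" for z
  proof -
    have "z = Re z *\<^sub>R 1 + Im z *\<^sub>R \<i>" by (simp add: complex_eq_iff)
    then have "g z = g (Re z *\<^sub>R 1 + Im z *\<^sub>R \<i>)" by simp
    then show ?thesis
      unfolding linear_add[OF lin] linear_scale[OF lin] l_def m_def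
      by (simp only: scaleR_conv_of_real)
  qed
  define w where "w = m / l"
  have l0: "l \<noteq> 0" using nl by auto
  have mw: "m = w * l" using l0 by (simp add: w_def)
  have "Re w * (l \<bullet> l) = l \<bullet> m" unfolding mw inner_complex_def by (simp add: algebra_simps)
  then have "Re w = 0" using n1 by simp
  have "norm m = 1" using n1(2) by (simp only: norm_eq_1)
  then have "norm w = 1" using nl by (simp add: w_def norm_divide)
  then have "\<bar>Im w\<bar> = 1" using \<open>Re w = 0\<close> by (simp add: cmod_def)
  then have "Im w = 1 \<or> Im w = -1" by linarith
  then consider "w = \<i>" | "w = - \<i>" using \<open>Re w = 0\<close> by (auto simp: complex_eq_iff)
  then show ?thesis
  proof cases
    case 1
    have "f z = simil (f 0) l False z" for z
    proof -
      have "f z = f 0 + g z" by (simp add: g_def)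
      also have "g z = l * z" unfolding gz mw 1 by (simp add: complex_eq_iff algebra_simps)
      finally show ?thesis by (simp add: simil_def)
    qed
    then show ?thesis using nl by blast
  next
    case 2
    have "f z = simil (f 0) l True z" for z
    proof -
      have "f z = f 0 + g z" by (simp add: g_def)
      also have "g z = l * cnj z" unfolding gz mw 2 by (simp add: complex_eq_iff algebra_simps)
      finally show ?thesis by (simp add: simil_def)
    qed
    then show ?thesis using nl by blast
  qed
qed

section \<open>Frames and moves\<close>

text \<open>The interior angles of the polygons with 3, 4, 6, 8 and 12 sides are multiples of 15 degrees, so directions
around a vertex are integers modulo 24.\<close>

definition e24 :: "int \<Rightarrow> complex" where "e24 k = cis (of_int k * pi / 12)"

lemma e24_add: "e24 (j + k) = e24 j * e24 k"
  by (simp add: e24_def cis_mult ring_distribs add_divide_distrib)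

lemma e24_0 [simp]: "e24 0 = 1" and e24_12: "e24 12 = -1"
  by (simp_all add: e24_def)

lemma e24_shift: "x * e24 k = y \<Longrightarrow> x = y * e24 (- k)"
  by (auto simp: mult.assoc simp flip: e24_add)

lemma norm_e24 [simp]: "norm (e24 k) = 1" and e24_nonzero [simp]: "e24 k \<noteq> 0"
  by (simp_all add: e24_def)

lemma cnj_e24 [simp]: "cnj (e24 k) = e24 (- k)"
  by (simp add: e24_def cis_cnj)

lemma e24_eq_1_iff: "e24 k = 1 \<longleftrightarrow> 24 dvd k"
proof
  assume "e24 k = 1"
  then have "cos (of_int k * pi / 12) = 1" unfolding e24_def by (simp add: complex_eq_iff)
  then obtain n :: int where "of_int k * pi / 12 = of_int n * 2 * pi"
    unfolding cos_one_2pi_int by blast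
  then have "of_int k = (of_int (24 * n) :: real)" by (simp add: field_simps)
  then have "k = 24 * n" by (simp only: of_int_eq_iff)
  then show "24 dvd k" by simp
next
  assume "24 dvd k"
  then obtain n where "k = 24 * n" by blast
  then have "of_int k * pi / 12 = 2 * pi * of_int n" by simp
  then show "e24 k = 1" unfolding e24_def by (simp only: cis_multiple_2pi Ints_of_int)
qed

lemma e24_eq_iff: "e24 j = e24 k \<longleftrightarrow> 24 dvd (j - k)"
proof -
  have "e24 j = e24 (j - k) * e24 k" by (simp flip: e24_add)
  then show ?thesis using e24_eq_1_iff[of "j - k"] by auto
qed

abbreviation tiling_sizes :: "nat set" where "tiling_sizes \<equiv> {3, 4, 6, 8, 12}"

abbreviation sizes_ok :: "(int \<times> nat) set \<Rightarrow> bool" where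
  "sizes_ok A \<equiv> \<forall>(s, n)\<in>A. n \<in> tiling_sizes"

text \<open>The interior angle in units of 15 degrees.\<close>

definition ang :: "nat \<Rightarrow> int" where "ang n = 12 - 24 div int n"

lemma ang_simps [simp]: "ang 3 = 4" "ang 4 = 6" "ang 6 = 8" "ang 8 = 9" "ang 12 = 10"
  by (simp_all add: ang_def)

lemma turn_e24: "n \<in> tiling_sizes \<Longrightarrow> turn n = e24 (ang n)"
  unfolding turn_def e24_def by (elim insertE) (auto simp: field_simps)

lemma tiling_sizes_ge_3: "n \<in> tiling_sizes \<Longrightarrow> n \<ge> 3"
  by auto

text \<open>A pair \<open>(s, n)\<close> stands for an \<open>n\<close>-gon at the origin whose angle begins in direction \<open>s\<close> and ends in direction
\<open>s + ang n\<close>. A reflection exchanges beginning and end, so the reflected polygon begins in direction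
\<open>- (s + ang n)\<close>. The flag \<open>c\<close> records whether the orientation is reversed.\<close>

definition slot :: "bool \<Rightarrow> int \<Rightarrow> nat \<Rightarrow> int" where
  "slot c s n = (if c then - (s + ang n) else s)"

definition sgn_of :: "bool \<Rightarrow> int" where "sgn_of c = (if c then -1 else 1)"

text \<open>The faces at \<open>v\<close> are the images of the polygons in the pattern \<open>A\<close> under the similarity \<open>simil v d c\<close>.\<close>

definition frame :: "complex set set \<Rightarrow> (int \<times> nat) set \<Rightarrow> complex \<Rightarrow> complex \<Rightarrow> bool \<Rightarrow> bool" where
  "frame \<tau> A v d c \<longleftrightarrow> v \<in> vertices \<tau> \<and> d \<noteq> 0 \<and>
     {P \<in> \<tau>. v \<in> P} = (\<lambda>(s, n). ngon n v (d * e24 (slot c s n))) ` A"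

abbreviation framed :: "complex set set \<Rightarrow> (int \<times> nat) set \<Rightarrow> bool" where
  "framed \<tau> A \<equiv> \<forall>v\<in>vertices \<tau>. \<exists>d c. frame \<tau> A v d c"

lemma frame_corner_iff:
  assumes A: "sizes_ok A" and F: "frame \<tau> A v d c" and n: "n \<ge> 3" and u: "u \<noteq> 0"
  shows "ngon n v u \<in> \<tau> \<longleftrightarrow> (\<exists>s. (s, n) \<in> A \<and> u = d * e24 (slot c s n))"
proof
  assume "ngon n v u \<in> \<tau>"
  then have "ngon n v u \<in> {P \<in> \<tau>. v \<in> P}" using ngon_corners(1)[OF n] by simp
  then obtain s m where sm: "(s, m) \<in> A" "ngon n v u = ngon m v (d * e24 (slot c s m))"
    using F unfolding frame_def by auto
  have m: "m \<ge> 3" using A sm(1) tiling_sizes_ge_3 by fast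
  have d: "d * e24 (slot c s m) \<noteq> 0" using F by (simp add: frame_def)
  show "\<exists>s. (s, n) \<in> A \<and> u = d * e24 (slot c s n)"
    using ngon_unique[OF n m u d sm(2)] sm(1) by metis
next
  assume "\<exists>s. (s, n) \<in> A \<and> u = d * e24 (slot c s n)"
  then have "ngon n v u \<in> (\<lambda>(s, n). ngon n v (d * e24 (slot c s n))) ` A"
    by force
  then show "ngon n v u \<in> \<tau>" using F unfolding frame_def by blast
qed

text \<open>The pattern has an edge in direction \<open>k\<close>, with an \<open>l\<close>-gon on its left and an \<open>r\<close>-gon on its right.\<close>

definition star_edge :: "(int \<times> nat) set \<Rightarrow> int \<Rightarrow> nat \<Rightarrow> nat \<Rightarrow> bool" where
  "star_edge A k l r \<longleftrightarrow> (k, l) \<in> A \<and> (\<exists>k'. (k', r) \<in> A \<and> 24 dvd (k - (k' + ang r)))"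

lemma ngon_e24_next:
  assumes n: "n \<in> tiling_sizes"
  shows "ngon n (v + d * e24 k) (d * e24 (k + 12 - ang n)) = ngon n v (d * e24 k)"
proof -
  have "e24 (ang n) * zeta n = -1" using turn_zeta[of n] turn_e24[OF n] by simp
  then have "e24 (12 - ang n) = zeta n" 
    using e24_12 e24_add[of "12 - ang n" "ang n"] by (metis diff_add_cancel e24_nonzero mult.commute mult_cancel_right)
  then have "d * e24 (k + 12 - ang n) = d * e24 k * zeta n"
    using e24_add[of k "12 - ang n"] by (simp add: add_diff_eq)
  then show ?thesis using ngon_rotate[OF tiling_sizes_ge_3[OF n], of v "d * e24 k"] by (simp only:)
qed

lemma ngon_e24_prev:
  assumes n: "n \<in> tiling_sizes"
  shows "ngon n (v + d * e24 (k + ang n)) (d * e24 (k + ang n + 12)) = ngon n v (d * e24 k)"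
  using ngon_rotate_back[of n v "d * e24 k"] tiling_sizes_ge_3[OF n] turn_e24[OF n]
  by (simp add: e24_add e24_12 mult.assoc)

text \<open>The neighbour \<open>w\<close> of \<open>v\<close> along an edge has some frame, and the faces on both sides of the edge are
visible from \<open>w\<close>. In the pattern, the edge back to \<open>v\<close> must therefore be an edge \<open>k\<close> with the same two polygons:
exchanged, when the frame at \<open>w\<close> has the orientation of the frame at \<open>v\<close>, and in the same position, when it has the other one. In
both cases \<open>k\<close> determines the frame.\<close>

lemma frame_across_edge:
  assumes A: "sizes_ok A"
    and ex: "framed \<tau> A"
    and F: "frame \<tau> A v d c" and E: "star_edge A s l r"
  shows "\<exists>k. star_edge A k r l \<and> frame \<tau> A (v + d * e24 (sgn_of c * s)) (d * e24 (sgn_of c * (s + 12 - k))) c \<or>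
      star_edge A k l r \<and> frame \<tau> A (v + d * e24 (sgn_of c * s)) (d * e24 (sgn_of c * (s + 12 + k))) (\<not> c)"
proof -
  obtain s' where sl: "(s, l) \<in> A" and s'r: "(s', r) \<in> A" and dv: "24 dvd (s - (s' + ang r))"
    using E unfolding star_edge_def by blast
  have l: "l \<in> tiling_sizes" and r: "r \<in> tiling_sizes" using A sl s'r by auto
  have l3: "l \<ge> 3" and r3: "r \<ge> 3" using l r tiling_sizes_ge_3 by blast+
  have d: "d \<noteq> 0" using F by (simp add: frame_def)
  have fl: "ngon l v (d * e24 (slot c s l)) \<in> \<tau>"
    using frame_corner_iff[OF A F l3] sl d by auto
  have fr: "ngon r v (d * e24 (slot c s' r)) \<in> \<tau>"
    using frame_corner_iff[OF A F r3] s'r d by auto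
  define w where "w = v + d * e24 (sgn_of c * s)"
  (* b is the vector from w back to v; seen from w, the X-gon is to the left of this edge and the Y-gon to its right *)
  define b where "b = d * e24 (sgn_of c * s + 12)"
  define X Y where "X = (if c then l else r)" and "Y = (if c then r else l)"
  have b0: "b \<noteq> 0" using d by (simp add: b_def)
  have XY: "X \<in> tiling_sizes" "Y \<in> tiling_sizes" using l r by (auto simp: X_def Y_def)
  have XY3: "X \<ge> 3" "Y \<ge> 3" using l3 r3 by (auto simp: X_def Y_def)
  have es1: "e24 s = e24 (s' + ang r)" using dv by (simp add: e24_eq_iff)
  then have "e24 (- s) = e24 (- (s' + ang r))" by (metis cnj_e24)
  note es = es1 this
  have wX: "ngon X w b \<in> \<tau>" and wY: "ngon Y w (b * e24 (- ang Y)) \<in> \<tau>"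
    and wv: "w \<in> vertices \<tau>"
  proof -
    show "ngon X w b \<in> \<tau>"
    proof (cases c)
      case True
      have "ngon l (v + d * e24 (- s)) (d * e24 (- s + 12)) = ngon l v (d * e24 (- (s + ang l)))"
        using ngon_e24_prev[OF l, of v d "- (s + ang l)"] by simp
      then show ?thesis using fl True by (simp add: X_def w_def b_def slot_def sgn_of_def)
    next
      case False
      have "ngon r (v + d * e24 s) (d * e24 (s + 12)) = ngon r v (d * e24 s')"
        using ngon_e24_prev[OF r, of v d s'] es(1) by (simp add: e24_add)
      then show ?thesis using fr False by (simp add: X_def w_def b_def slot_def sgn_of_def)
    qed
    show "ngon Y w (b * e24 (- ang Y)) \<in> \<tau>"
    proof (cases c)
      case True
      have "ngon r (v + d * e24 (- s)) (d * e24 (- s + 12 - ang r)) = ngon r v (d * e24 (slot c s' r))"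
        using ngon_e24_next[OF r, of v d "- (s' + ang r)"] es(2) True
        unfolding slot_def diff_conv_add_uminus e24_add by simp
      then show ?thesis using fr True
        by (simp add: Y_def w_def b_def sgn_of_def mult.assoc flip: e24_add)
    next
      case False
      then show ?thesis using fl ngon_e24_next[OF l, of v d s]
        by (simp add: Y_def w_def b_def slot_def sgn_of_def mult.assoc flip: e24_add)
    qed
    show "w \<in> vertices \<tau>" using corners_are_vertices(1)[OF XY3(1) b0] \<open>ngon X w b \<in> \<tau>\<close> .
  qed
  obtain d' c' where F': "frame \<tau> A w d' c'" using ex wv by blast
  have d': "d' \<noteq> 0" using F' by (simp add: frame_def)
  obtain k where k: "(k, X) \<in> A" "b = d' * e24 (slot c' k X)"
    using frame_corner_iff[OF A F' XY3(1) b0] wX by blast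
  obtain k' where k': "(k', Y) \<in> A" "b * e24 (- ang Y) = d' * e24 (slot c' k' Y)"
    using frame_corner_iff[OF A F' XY3(2), of "b * e24 (- ang Y)"] b0 wY by auto
  have eqs: "e24 (slot c' k X) = e24 (slot c' k' Y + ang Y)"
  proof -
    have "d' * e24 (slot c' k X) = b * e24 (- ang Y) * e24 (ang Y)"
      using k(2) by (simp add: mult.assoc flip: e24_add)
    also have "\<dots> = d' * e24 (slot c' k' Y + ang Y)" unfolding k'(2) by (simp add: e24_add)
    finally show ?thesis using d' by simp
  qed
  have db: "d' = b * e24 (- slot c' k X)" using k(2) by (simp add: mult.assoc flip: e24_add)
  show ?thesis
  proof (cases c')
    case False
    have "star_edge A k X Y" unfolding star_edge_def
      using k(1) k'(1) eqs False by (auto simp: slot_def e24_eq_iff)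
    moreover have d'_eq: "d' = d * e24 (sgn_of c * (if c then s + 12 + k else s + 12 - k))"
    proof -
      have "d' = d * e24 (sgn_of c * s + 12 - k)"
        using db False by (simp add: slot_def b_def mult.assoc flip: e24_add)
      also have "e24 (sgn_of c * s + 12 - k) = e24 (sgn_of c * (if c then s + 12 + k else s + 12 - k))"
        by (auto simp: sgn_of_def e24_eq_iff)
      finally show ?thesis .
    qed
    moreover have "frame \<tau> A (v + d * e24 (sgn_of c * s)) (d * e24 (sgn_of c * (if c then s + 12 + k else s + 12 - k))) False"
      using F' False unfolding w_def d'_eq by simp
    ultimately show ?thesis unfolding X_def Y_def by (cases c) (auto intro!: exI[of _ k])
  next
    case True
    have "star_edge A k' Y X" unfolding star_edge_def
    proof (intro conjI exI)
      have "24 dvd (- (k + ang X) - (- (k' + ang Y) + ang Y))"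
        using eqs True by (simp add: slot_def e24_eq_iff)
      moreover have "- (k + ang X) - (- (k' + ang Y) + ang Y) = k' - (k + ang X)" by simp
      ultimately show "24 dvd (k' - (k + ang X))" by (simp only:)
    qed (use k k' in auto)
    moreover have d'_eq: "d' = d * e24 (sgn_of c * (if c then s + 12 - k' else s + 12 + k'))"
    proof -
      have "d' = b * e24 (- (slot c' k' Y + ang Y))"
        using db eqs by (metis cnj_e24)
      then have "d' = d * e24 (sgn_of c * s + 12 + k')"
        using True by (simp add: slot_def b_def mult.assoc flip: e24_add)
      also have "e24 (sgn_of c * s + 12 + k') = e24 (sgn_of c * (if c then s + 12 - k' else s + 12 + k'))"
        by (auto simp: sgn_of_def e24_eq_iff)
      finally show ?thesis .
    qed
    moreover have "frame \<tau> A (v + d * e24 (sgn_of c * s)) (d * e24 (sgn_of c * (if c then s + 12 - k' else s + 12 + k'))) True"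
      using F' True unfolding w_def d'_eq by simp
    ultimately show ?thesis unfolding X_def Y_def by (cases c) (auto intro!: exI[of _ k'])
  qed
qed

text \<open>The isometry \<open>simil a (e24 k) f\<close>, composed with any frame on the right, gives a frame. The sign
accounts for the conjugation in a reversed frame.\<close>

definition move :: "complex set set \<Rightarrow> (int \<times> nat) set \<Rightarrow> complex \<Rightarrow> int \<Rightarrow> bool \<Rightarrow> bool" where
  "move \<tau> A a k f \<longleftrightarrow>
     (\<forall>v d c. frame \<tau> A v d c \<longrightarrow> frame \<tau> A (simil v d c a) (d * e24 (sgn_of c * k)) (c \<noteq> f))"

lemma move_compose:
  assumes "move \<tau> A a k f" "move \<tau> A a' k' f'"
  shows "move \<tau> A (simil a (e24 k) f a') (k + sgn_of f * k') (f \<noteq> f')"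
  unfolding move_def
proof (intro allI impI)
  fix v d c assume "frame \<tau> A v d c"
  then have "frame \<tau> A (simil v d c a) (d * e24 (sgn_of c * k)) (c \<noteq> f)"
    using assms(1) unfolding move_def by blast
  then have "frame \<tau> A (simil (simil v d c a) (d * e24 (sgn_of c * k)) (c \<noteq> f) a')
      (d * e24 (sgn_of c * k) * e24 (sgn_of (c \<noteq> f) * k')) ((c \<noteq> f) \<noteq> f')"
    using assms(2) unfolding move_def by blast
  moreover have "simil (simil v d c a) (d * e24 (sgn_of c * k)) (c \<noteq> f) a' = simil v d c (simil a (e24 k) f a')"
    by (cases c; cases f) (simp_all add: simil_def sgn_of_def algebra_simps)
  moreover have "d * e24 (sgn_of c * k) * e24 (sgn_of (c \<noteq> f) * k') = d * e24 (sgn_of c * (k + sgn_of f * k'))"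
    by (cases c; cases f) (simp_all add: sgn_of_def mult.assoc flip: e24_add)
  moreover have "((c \<noteq> f) \<noteq> f') = (c \<noteq> (f \<noteq> f'))" by blast
  ultimately show "frame \<tau> A (simil v d c (simil a (e24 k) f a')) (d * e24 (sgn_of c * (k + sgn_of f * k'))) (c \<noteq> (f \<noteq> f'))"
    by (simp only:)
qed

text \<open>A symmetry \<open>simil 0 (e24 t) f\<close> of the pattern only reparametrizes the faces at the same vertex. Both
directions of the permutation of the pattern are required, as equality modulo 24 need not be equality.\<close>

lemma pattern_symmetry_move:
  assumes into: "\<forall>(s, n)\<in>A. \<exists>s'. (s', n) \<in> A \<and> 24 dvd (t + slot f s n - s')"
    and onto: "\<forall>(s, n)\<in>A. \<exists>s'. (s', n) \<in> A \<and> 24 dvd (t + slot f s' n - s)"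
  shows "move \<tau> A 0 t f"
  unfolding move_def
proof (intro allI impI)
  fix v d c assume F: "frame \<tau> A v d c"
  have slots: "e24 (sgn_of c * t) * e24 (slot (c \<noteq> f) s n) = e24 (slot c s' n)"
    if "24 dvd (t + slot f s n - s')" for s s' n
  proof -
    have "e24 (t + slot f s n) = e24 s'" using that by (simp add: e24_eq_iff)
    then have *: "e24 (t + slot f s n) = e24 s'" "e24 (- (t + slot f s n)) = e24 (- s')"
      by (simp, metis cnj_e24)
    have "sgn_of c * t + slot (c \<noteq> f) s n = (if c then - (t + slot f s n) - ang n else t + slot f s n)"
      by (simp add: sgn_of_def slot_def)
    then have "e24 (sgn_of c * t) * e24 (slot (c \<noteq> f) s n)
        = (if c then e24 (- (t + slot f s n)) * e24 (- ang n) else e24 (t + slot f s n))"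
      by (auto simp flip: e24_add)
    also have "\<dots> = e24 (slot c s' n)" unfolding * by (simp add: slot_def flip: e24_add)
    finally show ?thesis .
  qed
  have "(\<lambda>(s, n). ngon n v (d * e24 (sgn_of c * t) * e24 (slot (c \<noteq> f) s n))) ` A
      = (\<lambda>(s, n). ngon n v (d * e24 (slot c s n))) ` A" (is "?L ` A = ?R ` A")
  proof (intro equalityI subsetI)
    fix P assume "P \<in> ?L ` A"
    then obtain s n where sn: "(s, n) \<in> A" "P = ?L (s, n)" by auto
    then obtain s' where s': "(s', n) \<in> A" "24 dvd (t + slot f s n - s')" using into by fast
    then have "P = ?R (s', n)" using sn slots[OF s'(2)] by (simp add: mult.assoc)
    then show "P \<in> ?R ` A" using s'(1) by (rule image_eqI)
  next
    fix P assume "P \<in> ?R ` A"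
    then obtain s n where sn: "(s, n) \<in> A" "P = ?R (s, n)" by auto
    then obtain s' where s': "(s', n) \<in> A" "24 dvd (t + slot f s' n - s)" using onto by fast
    then have "P = ?L (s', n)" using sn slots[OF s'(2)] by (simp add: mult.assoc)
    then show "P \<in> ?L ` A" using s'(1) by (rule image_eqI)
  qed
  moreover have "simil v d c 0 = v" by (cases c) (simp_all add: simil_def)
  moreover have "d * e24 (sgn_of c * t) \<noteq> 0" using F by (simp add: frame_def)
  ultimately show "frame \<tau> A (simil v d c 0) (d * e24 (sgn_of c * t)) (c \<noteq> f)"
    using F unfolding frame_def by metis
qed

lemma face_interior_nonempty:
  assumes T: "tessellation \<tau>" and Q: "Q \<in> \<tau>" shows "interior Q \<noteq> {}"
proof -
  obtain y where y: "y extreme_point_of Q"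
    using extreme_point_exists_convex face_properties[OF T Q] by metis
  then have "y \<in> Q" by (simp add: extreme_point_of_def)
  from face_at_vertex[OF T vertexI[OF Q y] Q this]
  obtain n d where "n \<ge> 3" "d \<noteq> 0" "Q = ngon n y d" .
  then show ?thesis using overlap_same_edge[of n n d y] by auto
qed

lemma simil_slot:
  assumes n: "n \<in> tiling_sizes"
  shows "simil b l f ` ngon n v (d * e24 (slot c s n))
    = ngon n (simil b l f v) (l * (if f then cnj d else d) * e24 (slot (c \<noteq> f) s n))"
  using simil_ngon[OF tiling_sizes_ge_3[OF n], of b l f v "d * e24 (slot c s n)"] turn_e24[OF n]
  by (cases f; cases c) (simp_all add: slot_def mult.assoc add.commute flip: e24_add)

text \<open>An isometry that takes a frame to a frame also does so at every neighbouring vertex, since moves act on the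
right and the isometry acts on the left. By connectedness it maps the faces at every vertex to faces; it is
onto the set of faces because the images already cover the plane.\<close>

lemma frame_extends_to_symmetry:
  assumes T: "tessellation \<tau>" and A: "sizes_ok A"
    and next_edge: "\<forall>(s, n)\<in>A. \<exists>s' n'. (s', n') \<in> A \<and> 24 dvd (s + ang n - s')"
    and moves: "\<forall>(s, n)\<in>A. \<exists>k f. move \<tau> A (e24 s) k f"
    and l: "norm l = 1"
    and F: "frame \<tau> A v d c" and F': "frame \<tau> A (simil b l f v) (l * (if f then cnj d else d)) (c \<noteq> f)"
  shows "simil b l f \<in> carrier (Aut \<tau>)"
proof -
  define good where "good = (\<lambda>v d c. frame \<tau> A v d c \<and> frame \<tau> A (simil b l f v) (l * (if f then cnj d else d)) (c \<noteq> f))"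
  define C where "C = {v. \<exists>d c. good v d c}"
  have move_good: "good (simil v d c a) (d * e24 (sgn_of c * k)) (c \<noteq> g)"
    if "good v d c" "move \<tau> A a k g" for v d c a k g
  proof -
    have "frame \<tau> A (simil v d c a) (d * e24 (sgn_of c * k)) (c \<noteq> g)"
      using that unfolding good_def move_def by blast
    moreover have "frame \<tau> A (simil (simil b l f v) (l * (if f then cnj d else d)) (c \<noteq> f) a)
       (l * (if f then cnj d else d) * e24 (sgn_of (c \<noteq> f) * k)) ((c \<noteq> f) \<noteq> g)"
      using that unfolding good_def move_def by blast
    moreover have "simil (simil b l f v) (l * (if f then cnj d else d)) (c \<noteq> f) a = simil b l f (simil v d c a)"
      by (cases c; cases f) (simp_all add: simil_def algebra_simps)
    moreover have "l * (if f then cnj d else d) * e24 (sgn_of (c \<noteq> f) * k)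
       = l * (if f then cnj (d * e24 (sgn_of c * k)) else d * e24 (sgn_of c * k))"
      by (cases c; cases f) (simp_all add: sgn_of_def)
    moreover have "((c \<noteq> f) \<noteq> g) = ((c \<noteq> g) \<noteq> f)" by blast
    ultimately show ?thesis unfolding good_def by (simp only:)
  qed
  have CV: "C = vertices \<tau>"
  proof (rule vertices_connected[OF T])
    show "C \<subseteq> vertices \<tau>"
    proof
      fix v assume "v \<in> C"
      then obtain d c where "good v d c" unfolding C_def by blast
      then have "frame \<tau> A v d c" unfolding good_def by blast
      then show "v \<in> vertices \<tau>" by (simp only: frame_def)
    qed
    have "good v d c" unfolding good_def using F F' by blast
    then show "C \<noteq> {}" unfolding C_def by blast
    fix v n u assume v: "v \<in> C" and n: "n \<ge> (3::nat)" and u: "u \<noteq> 0" and P: "ngon n v u \<in> \<tau>"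
    obtain d c where g: "good v d c" using v C_def by blast
    then have Fv: "frame \<tau> A v d c" by (simp add: good_def)
    obtain s where s: "(s, n) \<in> A" "u = d * e24 (slot c s n)"
      using frame_corner_iff[OF A Fv n u] P by blast
    obtain s' n' where s': "(s', n') \<in> A" "24 dvd (s + ang n - s')" using next_edge s(1) by blast
    have "e24 (s + ang n) = e24 s'" using s' by (simp add: e24_eq_iff)
    then have es: "e24 (- (s + ang n)) = e24 (- s')" by (metis cnj_e24)
    obtain q m where q: "(q, m) \<in> A" "v + u = simil v d c (e24 q)"
    proof (cases c)
      case True
      then show ?thesis using that[OF s'(1)] s(2) es by (simp add: slot_def simil_def)
    next
      case False
      then show ?thesis using that[OF s(1)] s(2) by (simp add: slot_def simil_def)
    qed
    obtain k g' where "move \<tau> A (e24 q) k g'" using moves q(1) by blast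
    from move_good[OF g this] q(2) show "v + u \<in> C" unfolding C_def by auto
  qed
  have image_face: "simil b l f ` P \<in> \<tau>" if P: "P \<in> \<tau>" for P
  proof -
    obtain y where y: "y extreme_point_of P"
      using extreme_point_exists_convex face_properties[OF T P] by metis
    have yP: "y \<in> P" using y by (simp add: extreme_point_of_def)
    have "y \<in> C" unfolding CV using vertexI[OF P y] .
    then obtain d c where g: "good y d c" unfolding C_def by blast
    then have "P \<in> (\<lambda>(s, n). ngon n y (d * e24 (slot c s n))) ` A"
      using P yP unfolding good_def frame_def by blast
    then obtain s n where sn: "(s, n) \<in> A" "P = ngon n y (d * e24 (slot c s n))" by auto
    have n: "n \<in> tiling_sizes" using A sn(1) by auto
    have "simil b l f ` P \<in> (\<lambda>(s, n). ngon n (simil b l f y) (l * (if f then cnj d else d) * e24 (slot (c \<noteq> f) s n))) ` A"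
      unfolding sn(2) simil_slot[OF n] by (rule image_eqI[OF _ sn(1)]) simp
    then show ?thesis using g unfolding good_def frame_def by blast
  qed
  have iso: "plane_isometry (simil b l f)" by (rule plane_isometry_simil[OF l])
  have "(\<lambda>P. simil b l f ` P) ` \<tau> = \<tau>"
  proof (intro equalityI subsetI)
    fix Q assume Q: "Q \<in> \<tau>"
    obtain y where y: "y \<in> interior Q" using face_interior_nonempty[OF T Q] by blast
    have "surj (simil b l f)" using iso by (simp add: plane_isometry_def)
    then obtain x where x: "y = simil b l f x" by (meson surjD)
    have "x \<in> \<Union>\<tau>" using tessellationD(2)[OF T] by simp
    then obtain P where P: "P \<in> \<tau>" "x \<in> P" by blast
    then have "y \<in> simil b l f ` P" using x by blast
    from faces_eq_if_interior_meets[OF T Q image_face[OF P(1)] y this]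
    show "Q \<in> (\<lambda>P. simil b l f ` P) ` \<tau>" using P(1) by blast
  qed (use image_face in blast)
  then show ?thesis using iso by (simp add: Aut_def)
qed

text \<open>Conjugating the move by the frame gives the symmetry. The conjugation turns a rotation by \<open>e24 k\<close> into itself or, for
a reversed frame, into its inverse.\<close>

lemma move_gives_symmetry:
  assumes T: "tessellation \<tau>" and A: "sizes_ok A"
    and next_edge: "\<forall>(s, n)\<in>A. \<exists>s' n'. (s', n') \<in> A \<and> 24 dvd (s + ang n - s')"
    and moves: "\<forall>(s, n)\<in>A. \<exists>k f. move \<tau> A (e24 s) k f"
    and F: "frame \<tau> A v d c" and m: "move \<tau> A a k f"
  shows "\<exists>b l. norm l = 1 \<and> (\<not> f \<longrightarrow> l = e24 k \<or> l = e24 (- k)) \<and> simil b l f \<in> carrier (Aut \<tau>)"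
proof -
  have d: "d \<noteq> 0" using F by (simp add: frame_def)
  define l where "l = d * e24 (sgn_of c * k) / (if f then cnj d else d)"
  define b where "b = simil v d c a - l * (if f then cnj v else v)"
  have l1: "norm l = 1" using d by (simp add: l_def norm_mult norm_divide)
  have v': "simil b l f v = simil v d c a" by (simp add: simil_def b_def)
  have ld: "l * (if f then cnj d else d) = d * e24 (sgn_of c * k)" using d by (simp add: l_def)
  have "frame \<tau> A (simil b l f v) (l * (if f then cnj d else d)) (c \<noteq> f)"
    unfolding v' ld using m F unfolding move_def by blast
  from frame_extends_to_symmetry[OF T A next_edge moves l1 F this]
  have "simil b l f \<in> carrier (Aut \<tau>)" .
  moreover have "\<not> f \<longrightarrow> l = e24 k \<or> l = e24 (- k)" using d by (auto simp: l_def sgn_of_def)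
  ultimately show ?thesis using l1 by blast
qed


section \<open>A frame at every vertex\<close>

definition offset :: "nat list \<Rightarrow> nat \<Rightarrow> int" where
  "offset ps j = sum_list (map ang (take j ps))"

definition star_pattern :: "nat list \<Rightarrow> (int \<times> nat) set" where
  "star_pattern ps = (\<lambda>j. (offset ps j, ps ! j)) ` {..<length ps}"

lemma offset_0 [simp]: "offset ps 0 = 0"
  by (simp add: offset_def)

lemma offset_Suc: "j < length ps \<Longrightarrow> offset ps (Suc j) = offset ps j + ang (ps ! j)"
  by (simp add: offset_def take_Suc_conv_app_nth)

lemma edge_of_contains_other_point:
  assumes "e edge_of P" "v \<in> e" shows "\<exists>x\<in>e. x \<noteq> v"
proof (rule ccontr)
  assume "\<not> ?thesis"
  then have "e = {v}" using assms(2) by blast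
  then show False using assms(1) by (simp add: edge_of_def aff_dim_sing)
qed

text \<open>Consecutive faces of the list follow each other either counterclockwise (\<open>U\<close>) or clockwise (\<open>W\<close>). A change
of direction would make the next but one face coincide with the current one, so the direction is constant,
and it decides the orientation of the frame.\<close>

lemma frame_exists:
  assumes T: "tessellation \<tau>" and v: "v \<in> vertices \<tau>" and vt: "vertex_type \<tau> v ps"
    and ps: "set ps \<subseteq> tiling_sizes" "length ps \<ge> 3"
  shows "\<exists>d c. frame \<tau> (star_pattern ps) v d c"
proof -
  let ?L = "length ps"
  from vt obtain Ps where Ps: "length Ps = ?L \<and> distinct Ps \<and> set Ps = {P \<in> \<tau>. v \<in> P} \<and>
       (\<forall>j<?L. regular_polygon (ps ! j) (Ps ! j)) \<and>
       (\<forall>j<?L. \<exists>e. v \<in> e \<and> e edge_of (Ps ! j) \<and> e edge_of (Ps ! (Suc j mod ?L)))"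
    unfolding vertex_type_def by (rule exE)
  have len: "length Ps = ?L" and dist: "distinct Ps" and set: "set Ps = {P \<in> \<tau>. v \<in> P}"
    and reg: "\<And>j. j < ?L \<Longrightarrow> regular_polygon (ps ! j) (Ps ! j)"
    and shared: "\<And>j. j < ?L \<Longrightarrow> \<exists>e. v \<in> e \<and> e edge_of (Ps ! j) \<and> e edge_of (Ps ! (Suc j mod ?L))"
    using Ps by simp_all
  have face: "Ps ! j \<in> \<tau>" "v \<in> Ps ! j" if "j < ?L" for j
    using set that len nth_mem[of j Ps] by auto
  have size: "ps ! j \<in> tiling_sizes" if "j < ?L" for j using ps(1) that nth_mem by blast
  have size3: "ps ! j \<ge> 3" if "j < ?L" for j using size[OF that] tiling_sizes_ge_3 by blast
  have "\<exists>d. j < ?L \<longrightarrow> d \<noteq> 0 \<and> Ps ! j = ngon (ps ! j) v d" for j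
    using regular_polygon_at_corner[OF reg vertex_extreme[OF T v face]] by blast
  then obtain D where D: "\<And>j. j < ?L \<Longrightarrow> D j \<noteq> 0" "\<And>j. j < ?L \<Longrightarrow> Ps ! j = ngon (ps ! j) v (D j)"
    by metis
  have in\<tau>: "ngon (ps ! j) v (D j) \<in> \<tau>" if "j < ?L" for j using face(1) D(2) that by metis
  define U where "U = (\<lambda>j. D (Suc j) = D j * turn (ps ! j))"
  define W where "W = (\<lambda>j. D j = D (Suc j) * turn (ps ! Suc j))"
  have ne: "Ps ! i \<noteq> Ps ! j" if "i < ?L" "j < ?L" "i \<noteq> j" for i j
    using dist that len nth_eq_iff_index_eq by metis
  have UW: "U j \<or> W j" if j: "Suc j < ?L" for j
  proof -
    have j': "j < ?L" using j by simp
    obtain e where e: "v \<in> e" "e edge_of (Ps ! j)" "e edge_of (Ps ! Suc j)"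
      using shared[OF j'] j by auto
    obtain x where x: "x \<in> e" "x \<noteq> v" using edge_of_contains_other_point[OF e(2,1)] by blast
    have "x \<in> Ps ! j" "x \<in> Ps ! Suc j" using e x edge_of_imp_subset by blast+
    then show ?thesis
      unfolding U_def W_def
      using faces_sharing_edge[OF T size3[OF j'] size3[OF j] D(1)[OF j'] D(1)[OF j] in\<tau>[OF j'] in\<tau>[OF j] _ _ _ x(2)]
        ne[OF j' j] D(2)[OF j'] D(2)[OF j] by simp
  qed
  have noUW: "\<not> (U j \<and> W (Suc j))" if j: "Suc (Suc j) < ?L" for j
  proof
    assume "U j \<and> W (Suc j)"
    then have eq: "D j * turn (ps ! j) = D (Suc (Suc j)) * turn (ps ! Suc (Suc j))"
      unfolding U_def W_def by metis
    have j': "j < ?L" using j by simp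
    have "ps ! j = ps ! Suc (Suc j)" "D j = D (Suc (Suc j))"
      using face_left_of_edge_unique[OF T size3[OF j'] size3[OF j] D(1)[OF j'] D(1)[OF j] in\<tau>[OF j'] in\<tau>[OF j] eq] .
    then show False using ne[OF j' j] D(2)[OF j'] D(2)[OF j] by simp
  qed
  have noWU: "\<not> (W j \<and> U (Suc j))" if j: "Suc (Suc j) < ?L" for j
  proof
    assume "W j \<and> U (Suc j)"
    then have eq: "D (Suc (Suc j)) = D j" unfolding U_def W_def by simp
    have j': "j < ?L" using j by simp
    have "ps ! j = ps ! Suc (Suc j)"
      using face_right_of_edge_unique[OF T size3[OF j'] size3[OF j] D(1)[OF j'] in\<tau>[OF j']] in\<tau>[OF j] eq by simp
    then show False using ne[OF j' j] D(2)[OF j'] D(2)[OF j] eq by simp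
  qed
  have L: "Suc 0 < ?L" "0 < ?L" using ps(2) by linarith+
  have star: "{P \<in> \<tau>. v \<in> P} = (\<lambda>(s, n). ngon n v (d * e24 (slot c s n))) ` star_pattern ps"
    if DD: "\<And>j. j < ?L \<Longrightarrow> D j = d * e24 (slot c (offset ps j) (ps ! j))" for d c
  proof -
    have "{P \<in> \<tau>. v \<in> P} = (\<lambda>j. Ps ! j) ` {..<?L}"
      unfolding set[symmetric] len[symmetric] by (auto simp: set_conv_nth)
    also have "\<dots> = (\<lambda>j. ngon (ps ! j) v (d * e24 (slot c (offset ps j) (ps ! j)))) ` {..<?L}"
      using D(2) DD by (intro image_cong) auto
    finally show ?thesis unfolding star_pattern_def by (simp add: image_image)
  qed
  show ?thesis
  proof (cases "U 0")
    case True
    have U: "U j" if "Suc j < ?L" for j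
      using that
    proof (induction j)
      case (Suc j)
      then show ?case using UW[of "Suc j"] noUW[of j] by auto
    qed (use True in simp)
    have "D j = D 0 * e24 (slot False (offset ps j) (ps ! j))" if "j < ?L" for j
      using that
    proof (induction j)
      case (Suc j)
      then have "D (Suc j) = D j * turn (ps ! j)" using U unfolding U_def by blast
      then show ?case using Suc offset_Suc[of j ps] turn_e24[OF size, of j] by (simp add: slot_def e24_add)
    qed (simp add: slot_def)
    from star[OF this] have "frame \<tau> (star_pattern ps) v (D 0) False"
      using v D(1)[OF L(2)] unfolding frame_def by simp
    then show ?thesis by blast
  next
    case False
    then have W0: "W 0" using UW[OF L(1)] by blast
    have W: "W j" if "Suc j < ?L" for j
      using that
    proof (induction j)
      case (Suc j)
      then show ?case using UW[of "Suc j"] noWU[of j] by auto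
    qed (use W0 in simp)
    define d where "d = D 0 * e24 (ang (ps ! 0))"
    have "D j = d * e24 (slot True (offset ps j) (ps ! j))" if "j < ?L" for j
      using that
    proof (induction j)
      case 0
      then show ?case by (simp add: d_def slot_def mult.assoc flip: e24_add)
    next
      case (Suc j)
      have "D (Suc j) * e24 (ang (ps ! Suc j)) = D j"
        using W[OF Suc.prems] turn_e24[OF size[OF Suc.prems]] unfolding W_def by simp
      then have "D (Suc j) = D j * e24 (- ang (ps ! Suc j))" by (rule e24_shift)
      also have "\<dots> = d * e24 (- (offset ps j + ang (ps ! j)) + - ang (ps ! Suc j))"
        unfolding e24_add[of _ "- ang (ps ! Suc j)"] using Suc by (simp add: slot_def mult.assoc)
      also have "- (offset ps j + ang (ps ! j)) + - ang (ps ! Suc j) = slot True (offset ps (Suc j)) (ps ! Suc j)"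
        using offset_Suc[of j ps] Suc.prems by (simp add: slot_def)
      finally show ?case .
    qed
    moreover have "d \<noteq> 0" using D(1)[OF L(2)] by (simp add: d_def)
    ultimately have "frame \<tau> (star_pattern ps) v d True"
      using v star[of d True] unfolding frame_def by simp
    then show ?thesis by blast
  qed
qed

section \<open>Moves for each vertex type\<close>

lemma e24_sgn_cong: "24 dvd (j - k) \<Longrightarrow> e24 (sgn_of c * j) = e24 (sgn_of c * k)"
  unfolding e24_eq_iff by (cases c) (simp_all add: sgn_of_def dvd_diff_commute)

lemma e24_24: "e24 24 = 1"
  by (simp add: e24_eq_1_iff)

lemma identity_move: "move \<tau> A 0 0 False"
  by (simp add: move_def simil_def)

lemma move_at_vertex:
  assumes "move \<tau> A 0 t f" "frame \<tau> A v d c"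
  shows "frame \<tau> A v (d * e24 (sgn_of c * t)) (c \<noteq> f)"
proof -
  have "frame \<tau> A (simil v d c 0) (d * e24 (sgn_of c * t)) (c \<noteq> f)"
    using assms unfolding move_def by blast
  moreover have "simil v d c 0 = v" by (cases c) (simp_all add: simil_def)
  ultimately show ?thesis by (simp only:)
qed

text \<open>Every frame that the two faces on the edge permit at the other end must agree with the intended one up to
a symmetry of the pattern.\<close>

lemma edge_move:
  assumes A: "sizes_ok A"
    and ex: "framed \<tau> A"
    and E: "star_edge A s l r"
    and same: "\<And>v d c k. frame \<tau> A v d c \<Longrightarrow> star_edge A k r l \<Longrightarrow>
       frame \<tau> A (v + d * e24 (sgn_of c * s)) (d * e24 (sgn_of c * (s + 12 - k))) c \<Longrightarrow> \<exists>t. move \<tau> A 0 t f \<and> 24 dvd (s + 12 - k + t - K)"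
    and opposite: "\<And>v d c k. frame \<tau> A v d c \<Longrightarrow> star_edge A k l r \<Longrightarrow>
       frame \<tau> A (v + d * e24 (sgn_of c * s)) (d * e24 (sgn_of c * (s + 12 + k))) (\<not> c) \<Longrightarrow> \<exists>t. move \<tau> A 0 t (\<not> f) \<and> 24 dvd (s + 12 + k - t - K)"
  shows "move \<tau> A (e24 s) K f"
  unfolding move_def
proof (intro allI impI)
  fix v d c assume F: "frame \<tau> A v d c"
  define w where "w = v + d * e24 (sgn_of c * s)"
  have w: "simil v d c (e24 s) = w" by (simp add: simil_def w_def sgn_of_def)
  obtain k where "star_edge A k r l \<and> frame \<tau> A w (d * e24 (sgn_of c * (s + 12 - k))) c \<or>
      star_edge A k l r \<and> frame \<tau> A w (d * e24 (sgn_of c * (s + 12 + k))) (\<not> c)"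
    using frame_across_edge[OF A ex F E] unfolding w_def by blast
  then show "frame \<tau> A (simil v d c (e24 s)) (d * e24 (sgn_of c * K)) (c \<noteq> f)"
    unfolding w
  proof (elim disjE conjE)
    assume k: "star_edge A k r l" and F': "frame \<tau> A w (d * e24 (sgn_of c * (s + 12 - k))) c"
    obtain t where t: "move \<tau> A 0 t f" "24 dvd (s + 12 - k + t - K)" using same[OF F k] F' unfolding w_def by blast
    have "frame \<tau> A w (d * e24 (sgn_of c * (s + 12 - k)) * e24 (sgn_of c * t)) (c \<noteq> f)"
      by (rule move_at_vertex[OF t(1) F'])
    moreover have "d * e24 (sgn_of c * (s + 12 - k)) * e24 (sgn_of c * t) = d * e24 (sgn_of c * (s + 12 - k + t))"
      by (simp add: mult.assoc distrib_left flip: e24_add)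
    ultimately show "frame \<tau> A w (d * e24 (sgn_of c * K)) (c \<noteq> f)"
      using e24_sgn_cong[OF t(2)] by (simp only:)
  next
    assume k: "star_edge A k l r" and F': "frame \<tau> A w (d * e24 (sgn_of c * (s + 12 + k))) (\<not> c)"
    obtain t where t: "move \<tau> A 0 t (\<not> f)" "24 dvd (s + 12 + k - t - K)" using opposite[OF F k] F' unfolding w_def by blast
    have "frame \<tau> A w (d * e24 (sgn_of c * (s + 12 + k)) * e24 (sgn_of (\<not> c) * t)) ((\<not> c) \<noteq> (\<not> f))"
      by (rule move_at_vertex[OF t(1) F'])
    moreover have "d * e24 (sgn_of c * (s + 12 + k)) * e24 (sgn_of (\<not> c) * t) = d * e24 (sgn_of c * (s + 12 + k - t))"
    proof -
      have "sgn_of c * (s + 12 + k) + sgn_of (\<not> c) * t = sgn_of c * (s + 12 + k - t)"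
        by (cases c) (simp_all add: sgn_of_def)
      then show ?thesis unfolding mult.assoc e24_add[symmetric] by (simp only:)
    qed
    moreover have "((\<not> c) \<noteq> (\<not> f)) = (c \<noteq> f)" by blast
    ultimately show "frame \<tau> A w (d * e24 (sgn_of c * K)) (c \<noteq> f)"
      using e24_sgn_cong[OF t(2)] by (simp only:)
  qed
qed

text \<open>The moves that are needed: one along every edge of the star, the rotation \<open>e24 r\<close>, and some reflection.\<close>

definition enough_moves :: "complex set set \<Rightarrow> (int \<times> nat) set \<Rightarrow> int \<Rightarrow> bool" where
  "enough_moves \<tau> A r \<longleftrightarrow> (\<forall>(s, n)\<in>A. \<exists>k f. move \<tau> A (e24 s) k f) \<and>
     (\<exists>a. move \<tau> A a r False) \<and> (\<exists>a k. move \<tau> A a k True)"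

lemma star_patterns:
  "star_pattern [4,8,8] = {(0,4),(6,8),(15,8)}"
  "star_pattern [3,6,3,6] = {(0,3),(4,6),(12,3),(16,6)}"
  "star_pattern [3,12,12] = {(0,3),(4,12),(14,12)}"
  "star_pattern [4,6,12] = {(0,4),(6,6),(14,12)}"
  "star_pattern [3,4,6,4] = {(0,3),(4,4),(10,6),(18,4)}"
  "star_pattern [3,3,4,3,4] = {(0,3),(4,3),(8,4),(14,3),(18,4)}"
  by (simp_all add: star_pattern_def offset_def lessThan_Suc insert_commute)


text \<open>The case in which the pattern has a reflection and each arrangement of the two polygons occurs at just one
edge. The congruences say that the two possible frames at the other end differ by that reflection.\<close>

lemma edge_rotation_move:
  assumes A: "sizes_ok A" and ex: "framed \<tau> A"
    and sym: "move \<tau> A 0 t True" and E: "star_edge A s l r"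
    and same: "\<And>k. star_edge A k r l \<Longrightarrow> k = k\<^sub>1" and opposite: "\<And>k. star_edge A k l r \<Longrightarrow> k = k\<^sub>2"
    and K: "24 dvd (s + 12 - k\<^sub>1 - K)" "24 dvd (s + 12 + k\<^sub>2 - t - K)"
  shows "move \<tau> A (e24 s) K False"
proof (rule edge_move[OF A ex E])
  show "\<exists>t. move \<tau> A 0 t False \<and> 24 dvd (s + 12 - k + t - K)" if "star_edge A k r l" for k
    using same[OF that] K(1) identity_move by (intro exI[of _ 0]) simp
  show "\<exists>t. move \<tau> A 0 t (\<not> False) \<and> 24 dvd (s + 12 + k - t - K)" if "star_edge A k l r" for k
    using opposite[OF that] K(2) sym by (intro exI[of _ t]) simp
qed

text \<open>The case of three different polygons: the star at the other end can only be the mirror image in the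
perpendicular bisector of the edge.\<close>

lemma edge_reflection_move:
  assumes A: "sizes_ok A" and ex: "framed \<tau> A"
    and E: "star_edge A s l r" and same: "\<And>k. \<not> star_edge A k r l"
    and opposite: "\<And>k. star_edge A k l r \<Longrightarrow> k = s" and K: "24 dvd (2 * s + 12 - K)"
  shows "move \<tau> A (e24 s) K True"
proof (rule edge_move[OF A ex E])
  show "\<exists>t. move \<tau> A 0 t True \<and> 24 dvd (s + 12 - k + t - K)" if "star_edge A k r l" for k
    using same that by blast
  show "\<exists>t. move \<tau> A 0 t (\<not> True) \<and> 24 dvd (s + 12 + k - t - K)" if "star_edge A k l r" for k
    using opposite[OF that] K identity_move by (intro exI[of _ 0]) (simp add: algebra_simps)
qed

lemma symmetric_edge_move:
  assumes "move \<tau> A 0 t f" "move \<tau> A (e24 b) k g" and s: "24 dvd (t + sgn_of f * b - s)"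
  shows "\<exists>k f. move \<tau> A (e24 s) k f"
proof -
  have "simil 0 (e24 t) f (e24 b) = e24 (t + sgn_of f * b)"
    by (cases f) (simp_all add: simil_def sgn_of_def flip: e24_add)
  also have "\<dots> = e24 s" using s by (simp add: e24_eq_iff)
  finally show ?thesis using move_compose[OF assms(1,2)] by auto
qed

text \<open>In this pattern and the next two, the reflection \<open>sym\<close> fixes the bisector of the first polygon, and the move \<open>m0\<close> along direction 0 is
a rotation about the centre of that polygon; it supplies the required rotation.\<close>

lemma enough_moves_4_8_8:
  fixes \<tau> defines "A \<equiv> {(0,4),(6,8),(15,8)}"
  assumes ex: "framed \<tau> A"
  shows "enough_moves \<tau> A 6"
proof -
  have A: "sizes_ok A" by (simp add: A_def)
  have sym: "move \<tau> A 0 6 True"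
    by (rule pattern_symmetry_move) (simp_all add: A_def slot_def conj_disj_distribR ex_disj_distrib sgn_of_def)
  have m0: "move \<tau> A (e24 0) 6 False"
    by (rule edge_rotation_move[OF A ex sym, where l = 4 and r = 8 and k\<^sub>1 = 6 and k\<^sub>2 = 0])
      (auto simp: star_edge_def A_def conj_disj_distribR ex_disj_distrib)
  have m15: "move \<tau> A (e24 15) 12 False"
    by (rule edge_rotation_move[OF A ex sym, where l = 8 and r = 8 and k\<^sub>1 = 15 and k\<^sub>2 = 15])
      (auto simp: star_edge_def A_def conj_disj_distribR ex_disj_distrib)
  have m6: "\<exists>k f. move \<tau> A (e24 6) k f"
    by (rule symmetric_edge_move[OF sym m0]) (simp add: sgn_of_def)
  show ?thesis unfolding enough_moves_def A_def[symmetric]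
    using sym m0 m6 m15 by (auto simp: A_def)
qed

lemma enough_moves_3_12_12:
  fixes \<tau> defines "A \<equiv> {(0,3),(4,12),(14,12)}"
  assumes ex: "framed \<tau> A"
  shows "enough_moves \<tau> A 8"
proof -
  have A: "sizes_ok A" by (simp add: A_def)
  have sym: "move \<tau> A 0 4 True"
    by (rule pattern_symmetry_move) (simp_all add: A_def slot_def conj_disj_distribR ex_disj_distrib sgn_of_def)
  have m0: "move \<tau> A (e24 0) 8 False"
    by (rule edge_rotation_move[OF A ex sym, where l = 3 and r = 12 and k\<^sub>1 = 4 and k\<^sub>2 = 0])
      (auto simp: star_edge_def A_def conj_disj_distribR ex_disj_distrib)
  have m14: "move \<tau> A (e24 14) 12 False"
    by (rule edge_rotation_move[OF A ex sym, where l = 12 and r = 12 and k\<^sub>1 = 14 and k\<^sub>2 = 14])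
      (auto simp: star_edge_def A_def conj_disj_distribR ex_disj_distrib)
  have m4: "\<exists>k f. move \<tau> A (e24 4) k f"
    by (rule symmetric_edge_move[OF sym m0]) (simp add: sgn_of_def)
  show ?thesis unfolding enough_moves_def A_def[symmetric]
    using sym m0 m4 m14 by (auto simp: A_def)
qed

lemma enough_moves_3_4_6_4:
  fixes \<tau> defines "A \<equiv> {(0,3),(4,4),(10,6),(18,4)}"
  assumes ex: "framed \<tau> A"
  shows "enough_moves \<tau> A 8"
proof -
  have A: "sizes_ok A" by (simp add: A_def)
  have sym: "move \<tau> A 0 4 True"
    by (rule pattern_symmetry_move) (simp_all add: A_def slot_def conj_disj_distribR ex_disj_distrib sgn_of_def)
  have m0: "move \<tau> A (e24 0) 8 False"
    by (rule edge_rotation_move[OF A ex sym, where l = 3 and r = 4 and k\<^sub>1 = 4 and k\<^sub>2 = 0])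
      (auto simp: star_edge_def A_def conj_disj_distribR ex_disj_distrib)
  have m10: "move \<tau> A (e24 10) 4 False"
    by (rule edge_rotation_move[OF A ex sym, where l = 6 and r = 4 and k\<^sub>1 = 18 and k\<^sub>2 = 10])
      (auto simp: star_edge_def A_def conj_disj_distribR ex_disj_distrib)
  have m4: "\<exists>k f. move \<tau> A (e24 4) k f"
    by (rule symmetric_edge_move[OF sym m0]) (simp add: sgn_of_def)
  have m18: "\<exists>k f. move \<tau> A (e24 18) k f"
    by (rule symmetric_edge_move[OF sym m10]) (simp add: sgn_of_def)
  show ?thesis unfolding enough_moves_def A_def[symmetric]
    using sym m0 m4 m10 m18 by (auto simp: A_def)
qed

text \<open>Here the pattern is also symmetric under the half turn \<open>rot\<close>, so that two edges carry each arrangement of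
polygons, and four reparametrizations have to be compared.\<close>

lemma enough_moves_3_6_3_6:
  fixes \<tau> defines "A \<equiv> {(0,3),(4,6),(12,3),(16,6)}"
  assumes ex: "framed \<tau> A"
  shows "enough_moves \<tau> A 8"
proof -
  have A: "sizes_ok A" by (simp add: A_def)
  have sym: "move \<tau> A 0 4 True"
    by (rule pattern_symmetry_move) (simp_all add: A_def slot_def conj_disj_distribR ex_disj_distrib sgn_of_def)
  have rot: "move \<tau> A 0 12 False"
    by (rule pattern_symmetry_move) (simp_all add: A_def slot_def conj_disj_distribR ex_disj_distrib sgn_of_def)
  have sym2: "move \<tau> A 0 16 True"
    by (rule pattern_symmetry_move) (simp_all add: A_def slot_def conj_disj_distribR ex_disj_distrib sgn_of_def)
  have m0: "move \<tau> A (e24 0) 8 False"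
  proof (rule edge_move[OF A ex, where l = 3 and r = 6])
    show "star_edge A 0 3 6" by (auto simp: star_edge_def A_def conj_disj_distribR ex_disj_distrib)
    show "\<exists>t. move \<tau> A 0 t False \<and> 24 dvd (0 + 12 - k + t - 8)" if "star_edge A k 6 3" for k
      proof -
      have "k = 4 \<or> k = 16" using that by (auto simp: star_edge_def A_def conj_disj_distribR ex_disj_distrib)
      then show ?thesis
        using identity_move rot by (elim disjE) (rule exI[of _ 0], simp, rule exI[of _ 12], simp)
    qed
    show "\<exists>t. move \<tau> A 0 t (\<not> False) \<and> 24 dvd (0 + 12 + k - t - 8)" if "star_edge A k 3 6" for k
      proof -
      have "k = 0 \<or> k = 12" using that by (auto simp: star_edge_def A_def conj_disj_distribR ex_disj_distrib)
      then show ?thesis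
        using sym sym2 by (elim disjE) (rule exI[of _ 4], simp, rule exI[of _ 16], simp)
    qed
  qed
  have m4: "\<exists>k f. move \<tau> A (e24 4) k f"
    by (rule symmetric_edge_move[OF sym m0]) (simp add: sgn_of_def)
  have m12: "\<exists>k f. move \<tau> A (e24 12) k f"
    by (rule symmetric_edge_move[OF rot m0]) (simp add: sgn_of_def)
  have m16: "\<exists>k f. move \<tau> A (e24 16) k f"
    by (rule symmetric_edge_move[OF sym2 m0]) (simp add: sgn_of_def)
  show ?thesis unfolding enough_moves_def A_def[symmetric]
    using sym m0 m4 m12 m16 by (auto simp: A_def)
qed

text \<open>The pattern has no symmetry. The mirror images across the edges are the moves, and the product of two of them is a
rotation by 120 degrees.\<close>

lemma enough_moves_4_6_12:
  fixes \<tau> defines "A \<equiv> {(0,4),(6,6),(14,12)}"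
  assumes ex: "framed \<tau> A"
  shows "enough_moves \<tau> A 8"
proof -
  have A: "sizes_ok A" by (simp add: A_def)
  have m0: "move \<tau> A (e24 0) 12 True"
    by (rule edge_reflection_move[OF A ex, where l = 4 and r = 12])
      (auto simp: star_edge_def A_def conj_disj_distribR ex_disj_distrib)
  have m6: "move \<tau> A (e24 6) 0 True"
    by (rule edge_reflection_move[OF A ex, where l = 6 and r = 4])
      (auto simp: star_edge_def A_def conj_disj_distribR ex_disj_distrib)
  have m14: "move \<tau> A (e24 14) (-8) True"
    by (rule edge_reflection_move[OF A ex, where l = 12 and r = 6])
      (auto simp: star_edge_def A_def conj_disj_distribR ex_disj_distrib)
  have rot: "\<exists>a. move \<tau> A a 8 False"
    using move_compose[OF m6 m14] by (auto simp: sgn_of_def)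
  show ?thesis unfolding enough_moves_def A_def[symmetric]
    using m0 m6 m14 rot by (auto simp: A_def)
qed

text \<open>At a vertex of type \<open>(3\<^sup>2.4.3.4)\<close> two triangles are adjacent and the third is isolated between squares. Let \<open>v\<close>,
\<open>x\<close>, \<open>w\<close> be the corners of one of the adjacent triangles at \<open>v\<close>, with \<open>vx\<close> the edge between the two triangles. From
the star at \<open>x\<close>, the face across the edge \<open>xw\<close> is a square. If the triangle belonged to the adjacent pair at \<open>w\<close>
as well, the frame \<open>B\<close> would put a triangle there.\<close>

lemma snub_square_no_adjacent_isolated_triangles:
  fixes \<tau> defines "A \<equiv> {(0,3),(4,3),(8,4),(14,3),(18,4)}"
  assumes T: "tessellation \<tau>" and m4: "move \<tau> A (e24 4) 12 False"
    and F: "frame \<tau> A v d c" and B: "frame \<tau> A (v + d * e24 (sgn_of c * 8)) (d * e24 (sgn_of c * 20)) c"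
  shows False
proof -
  have A: "sizes_ok A" by (simp add: A_def)
  have d: "d \<noteq> 0" using F by (simp add: frame_def)
  define w where "w = v + d * e24 (sgn_of c * 8)"
  define x where "x = v + d * e24 (sgn_of c * 4)"
  have X: "frame \<tau> A x (d * e24 (sgn_of c * 12)) c"
  proof -
    have "frame \<tau> A (simil v d c (e24 4)) (d * e24 (sgn_of c * 12)) (c \<noteq> False)"
      using m4 F unfolding move_def by blast
    moreover have "simil v d c (e24 4) = x" by (cases c) (simp_all add: simil_def x_def sgn_of_def)
    ultimately show ?thesis by simp
  qed
  have e24_8: "e24 8 = e24 4 - 1"
  proof -
    have "e24 4 = Complex (1/2) (sqrt 3 / 2)"
      by (simp add: e24_def complex_eq_iff cos_60 sin_60)
    moreover have "e24 8 = e24 4 * e24 4" by (simp flip: e24_add)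
    ultimately show ?thesis by (simp only:) (simp add: complex_eq_iff)
  qed
  then have "cnj (e24 8) = cnj (e24 4 - 1)" by (rule arg_cong)
  then have "e24 (- 8) = e24 (- 4) - 1" by simp
  with e24_8 have e8: "e24 (sgn_of c * 8) = e24 (sgn_of c * 4) - 1"
    by (simp add: sgn_of_def)
  have xw: "x - d = w" by (simp add: x_def w_def e8 algebra_simps)
  show False
  proof (cases c)
    case False
    have "ngon 3 w d \<in> \<tau>"
      using frame_corner_iff[OF A B, of 3 d] d False
      by (auto simp: w_def slot_def sgn_of_def A_def e24_eq_1_iff mult.assoc simp flip: e24_add)
    moreover have "ngon 4 x (d * e24 6) \<in> \<tau>"
      using frame_corner_iff[OF A X, of 4 "d * e24 6"] d False
      by (auto simp: slot_def sgn_of_def A_def e24_eq_iff mult.assoc simp flip: e24_add)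
    then have "ngon 4 w d \<in> \<tau>"
      using ngon_e24_prev[of 4 x d 6] xw by (simp add: e24_12 e24_24)
    ultimately show False using face_right_of_edge_unique[OF T, of 3 4 d w] d by simp
  next
    case True
    have t: "ngon 3 w (d * e24 (- 4)) \<in> \<tau>"
      using frame_corner_iff[OF A B, of 3 "d * e24 (-4)"] d True
      by (auto simp: w_def slot_def sgn_of_def A_def e24_eq_iff mult.assoc simp flip: e24_add)
    have "ngon 4 x (d * e24 12) \<in> \<tau>"
      using frame_corner_iff[OF A X, of 4 "d * e24 12"] d True
      by (auto simp: slot_def sgn_of_def A_def e24_eq_iff mult.assoc simp flip: e24_add)
    then have q: "ngon 4 w (d * e24 18) \<in> \<tau>"
      using ngon_e24_next[of 4 x d 12] xw by (simp add: e24_12)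
    have "d * e24 (- 4) * turn 3 = d * e24 18 * turn 4"
      by (simp add: turn_e24 mult.assoc e24_24 e24_eq_iff flip: e24_add)
    then show False using face_left_of_edge_unique(1)[OF T _ _ _ _ t q] d by simp
  qed
qed

text \<open>By the preceding lemma a triangle that is paired at one end of its edge to a square is isolated at the
other end. The move \<open>m8\<close> along that edge is the quarter turn about the centre of the adjacent square.
Repeating it three times passes around the square and arrives at the neighbour on its other side, which
gives the move \<open>m14\<close>.\<close>

lemma enough_moves_3_3_4_3_4:
  fixes \<tau> defines "A \<equiv> {(0,3),(4,3),(8,4),(14,3),(18,4)}"
  assumes T: "tessellation \<tau>" and ex: "framed \<tau> A"
  shows "enough_moves \<tau> A 6"
proof -
  have A: "sizes_ok A" by (simp add: A_def)
  have sym: "move \<tau> A 0 8 True"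
    by (rule pattern_symmetry_move) (simp_all add: A_def slot_def conj_disj_distribR ex_disj_distrib sgn_of_def)
  have m4: "move \<tau> A (e24 4) 12 False"
    by (rule edge_rotation_move[OF A ex sym, where l = 3 and r = 3 and k\<^sub>1 = 4 and k\<^sub>2 = 4])
      (auto simp: star_edge_def A_def conj_disj_distribR ex_disj_distrib)
  note excluded = snub_square_no_adjacent_isolated_triangles[OF T m4[unfolded A_def], folded A_def]
  have m8: "move \<tau> A (e24 8) 6 False"
  proof (rule edge_move[OF A ex, where l = 4 and r = 3])
    show "star_edge A 8 4 3" by (auto simp: star_edge_def A_def conj_disj_distribR ex_disj_distrib)
  next
    fix v d c k
    assume F: "frame \<tau> A v d c" and k: "star_edge A k 3 4"
      and B: "frame \<tau> A (v + d * e24 (sgn_of c * 8)) (d * e24 (sgn_of c * (8 + 12 - k))) c"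
    have "k = 0 \<or> k = 14" using k by (auto simp: star_edge_def A_def conj_disj_distribR ex_disj_distrib)
    moreover have "k \<noteq> 0" using excluded[OF F] B by auto
    ultimately show "\<exists>t. move \<tau> A 0 t False \<and> 24 dvd (8 + 12 - k + t - 6)"
      using identity_move by (intro exI[of _ 0]) auto
  next
    fix v d c k
    assume F: "frame \<tau> A v d c" and k: "star_edge A k 4 3"
      and B: "frame \<tau> A (v + d * e24 (sgn_of c * 8)) (d * e24 (sgn_of c * (8 + 12 + k))) (\<not> c)"
    have "k = 8 \<or> k = 18" using k by (auto simp: star_edge_def A_def conj_disj_distribR ex_disj_distrib)
    moreover have "k \<noteq> 8"
    proof
      assume "k = 8"
      then have "frame \<tau> A (v + d * e24 (sgn_of c * 8)) (d * e24 (sgn_of c * 28) * e24 (sgn_of (\<not> c) * 8)) ((\<not> c) \<noteq> True)"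
        using move_at_vertex[OF sym B] by simp
      moreover have "d * e24 (sgn_of c * 28) * e24 (sgn_of (\<not> c) * 8) = d * e24 (sgn_of c * 20)"
        by (simp add: sgn_of_def mult.assoc flip: e24_add)
      ultimately show False using excluded[OF F] by simp
    qed
    ultimately show "\<exists>t. move \<tau> A 0 t (\<not> False) \<and> 24 dvd (8 + 12 + k - t - 6)"
      using sym by (intro exI[of _ 8]) auto
  qed
  have m0: "\<exists>k f. move \<tau> A (e24 0) k f"
    by (rule symmetric_edge_move[OF sym m8]) (simp add: sgn_of_def)
  have m14: "move \<tau> A (e24 14) 18 False"
  proof -
    have "simil (e24 8) (e24 6) False (simil (e24 8) (e24 6) False (e24 8)) = e24 14"
      using e24_add[of 8 12] e24_12 by (simp add: simil_def distrib_left flip: e24_add)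
    then show ?thesis using move_compose[OF m8 move_compose[OF m8 m8]] by (simp add: sgn_of_def)
  qed
  have m18: "\<exists>k f. move \<tau> A (e24 18) k f"
    by (rule symmetric_edge_move[OF sym m14]) (simp add: sgn_of_def)
  show ?thesis unfolding enough_moves_def A_def[symmetric]
    using sym m0 m4 m8 m14 m18 by (auto simp: A_def)
qed

section \<open>Point symmetries of the tessellation\<close>

lemma symmetries_of_type:
  assumes T: "tessellation \<tau>" and V: "vertices \<tau> \<noteq> {}" and ty: "has_type \<tau> ps"
    and ps: "ps \<in> {[4,8,8], [3,6,3,6], [3,12,12], [4,6,12], [3,4,6,4], [3,3,4,3,4]}"
    and r: "r = (if ps = [4,8,8] \<or> ps = [3,3,4,3,4] then 6 else 8)"
  shows "\<exists>b l. (l = e24 r \<or> l = e24 (- r)) \<and> simil b l False \<in> carrier (Aut \<tau>)"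
    "\<exists>b l. norm l = 1 \<and> simil b l True \<in> carrier (Aut \<tau>)"
proof -
  let ?A = "star_pattern ps"
  have ex: "\<forall>v\<in>vertices \<tau>. \<exists>d c. frame \<tau> ?A v d c"
  proof
    fix v assume v: "v \<in> vertices \<tau>"
    then have "vertex_type \<tau> v ps" using ty by (simp add: has_type_def)
    then show "\<exists>d c. frame \<tau> ?A v d c" using ps by (intro frame_exists[OF T v]) auto
  qed
  have A: "\<forall>(s, n)\<in>?A. n \<in> tiling_sizes" using ps by (elim insertE) (simp_all add: star_patterns)
  have next_edge: "\<forall>(s, n)\<in>?A. \<exists>s' n'. (s', n') \<in> ?A \<and> 24 dvd (s + ang n - s')"
    using ps by (elim insertE) (simp_all add: star_patterns conj_disj_distribR ex_disj_distrib)
  have enough_moves: "enough_moves \<tau> ?A r"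
    using ps r ex enough_moves_4_8_8[of \<tau>] enough_moves_3_12_12[of \<tau>] enough_moves_3_4_6_4[of \<tau>] enough_moves_3_6_3_6[of \<tau>] enough_moves_4_6_12[of \<tau>]
      enough_moves_3_3_4_3_4[OF T]
    by (elim insertE) (simp_all add: star_patterns)
  then have moves: "\<forall>(s, n)\<in>?A. \<exists>k f. move \<tau> ?A (e24 s) k f" by (simp add: enough_moves_def)
  obtain v where "v \<in> vertices \<tau>" using V by blast
  then obtain d c where F: "frame \<tau> ?A v d c" using ex by blast
  note sym = move_gives_symmetry[OF T A next_edge moves F]
  obtain a where "move \<tau> ?A a r False" using enough_moves unfolding enough_moves_def by blast
  from sym[OF this] show "\<exists>b l. (l = e24 r \<or> l = e24 (- r)) \<and> simil b l False \<in> carrier (Aut \<tau>)" by blast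
  obtain a k where "move \<tau> ?A a k True" using enough_moves unfolding enough_moves_def by blast
  from sym[OF this] show "\<exists>b l. norm l = 1 \<and> simil b l True \<in> carrier (Aut \<tau>)" by blast
qed

section \<open>Sublattices of the integer plane\<close>

text \<open>Cramer's rule.\<close>

lemma in_lattice_iff:
  fixes a1 a2 b1 b2 x1 x2 :: int
  assumes D: "a1 * b2 - a2 * b1 \<noteq> 0"
  shows "(\<exists>p q. x1 = p * a1 + q * b1 \<and> x2 = p * a2 + q * b2) \<longleftrightarrow>
    (a1 * b2 - a2 * b1) dvd (x1 * b2 - x2 * b1) \<and> (a1 * b2 - a2 * b1) dvd (a1 * x2 - a2 * x1)"
proof (intro iffI conjI)
  assume "\<exists>p q. x1 = p * a1 + q * b1 \<and> x2 = p * a2 + q * b2"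
  then obtain p q where x: "x1 = p * a1 + q * b1" "x2 = p * a2 + q * b2" by blast
  have "x1 * b2 - x2 * b1 = (a1 * b2 - a2 * b1) * p" "a1 * x2 - a2 * x1 = (a1 * b2 - a2 * b1) * q"
    unfolding x by algebra+
  then show "(a1 * b2 - a2 * b1) dvd (x1 * b2 - x2 * b1)" "(a1 * b2 - a2 * b1) dvd (a1 * x2 - a2 * x1)"
    by simp_all
next
  assume "(a1 * b2 - a2 * b1) dvd (x1 * b2 - x2 * b1) \<and> (a1 * b2 - a2 * b1) dvd (a1 * x2 - a2 * x1)"
  then obtain p q where pq: "x1 * b2 - x2 * b1 = (a1 * b2 - a2 * b1) * p" "a1 * x2 - a2 * x1 = (a1 * b2 - a2 * b1) * q"
    by (auto elim!: dvdE)
  have "(a1 * b2 - a2 * b1) * x1 = (a1 * b2 - a2 * b1) * (p * a1 + q * b1)"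
    "(a1 * b2 - a2 * b1) * x2 = (a1 * b2 - a2 * b1) * (p * a2 + q * b2)"
    using pq by algebra+
  then show "\<exists>p q. x1 = p * a1 + q * b1 \<and> x2 = p * a2 + q * b2" using D by (metis mult_left_cancel)
qed

lemma dvd_if_coprime_multiples:
  fixes D N g x :: int
  assumes "D dvd N * x" "D dvd g * x" "coprime N g" shows "D dvd x"
proof -
  obtain u v where "u * N + v * g = 1" using assms(3) bezout_int[of N g] by auto
  then have "x = u * (N * x) + v * (g * x)" by algebra
  then show ?thesis using assms(1,2) by (metis dvd_add dvd_mult)
qed

lemma dvd_if_primitive_multiples:
  fixes D m a1 a2 b1 b2 :: int
  assumes "Gcd {a1, a2, b1, b2} = 1" "D dvd m * a1" "D dvd m * a2" "D dvd m * b1" "D dvd m * b2"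
  shows "D dvd m"
proof -
  have g: "D dvd gcd x y * z" if "D dvd x * z" "D dvd y * z" for x y z :: int
  proof -
    obtain u v where uv: "u * x + v * y = gcd x y" using bezout_int by blast
    have "gcd x y * z = u * (x * z) + v * (y * z)" unfolding uv[symmetric] by algebra
    then show ?thesis using that by (metis dvd_add dvd_mult)
  qed
  have "gcd a1 (gcd a2 (gcd b1 b2)) = 1" using assms(1) by simp
  moreover have "D dvd gcd a1 (gcd a2 (gcd b1 b2)) * m"
    using assms by (intro g) (simp_all add: mult.commute)
  ultimately show ?thesis by simp
qed

text \<open>Pairs are coordinates with respect to 1 and \<open>\<sigma>\<close>, where \<open>\<sigma>\<^sup>2 = t * \<sigma> - 1\<close>; the closure conditions on \<open>K\<close> are
closure under subtraction, multiplication by \<open>\<sigma>\<close> and conjugation. The key is that an integer \<open>m\<close> in \<open>K\<close> is divisible by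
\<open>D\<close>, since both \<open>m\<close> and \<open>m * \<sigma>\<close> lie in the lattice and the coordinates of its generators are coprime. The traces
of \<open>x\<close> and \<open>\<sigma> * x\<close> are such integers. They show that \<open>D\<close> divides \<open>N * x1\<close> and \<open>N * x2\<close>, where \<open>N = 2 + t\<close> is
the norm of \<open>1 + \<sigma>\<close> and a prime. In the second case some generator is not divisible by \<open>1 + \<sigma>\<close>, and
comparing determinants removes the factor \<open>N\<close>.\<close>

lemma invariant_sublattice_bound:
  fixes a1 a2 b1 b2 t :: int and K :: "(int \<times> int) set"
  defines "D \<equiv> a1 * b2 - a2 * b1" and "N \<equiv> 2 + t"
  assumes t: "t = 0 \<or> t = 1" and prim: "Gcd {a1, a2, b1, b2} = 1"
    and diff: "\<And>x1 x2 y1 y2. (x1, x2) \<in> K \<Longrightarrow> (y1, y2) \<in> K \<Longrightarrow> (x1 - y1, x2 - y2) \<in> K"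
    and rot: "\<And>x1 x2. (x1, x2) \<in> K \<Longrightarrow> (- x2, x1 + t * x2) \<in> K"
    and con: "\<And>x1 x2. (x1, x2) \<in> K \<Longrightarrow> (x1 + t * x2, - x2) \<in> K"
    and sub: "\<And>x1 x2. (x1, x2) \<in> K \<Longrightarrow> D dvd (x1 * b2 - x2 * b1) \<and> D dvd (a1 * x2 - a2 * x1)"
    and x: "(x1, x2) \<in> K"
  shows "N dvd (a1 - a2) \<and> N dvd (b1 - b2) \<Longrightarrow> D dvd N * x1 \<and> D dvd N * x2 \<and> D dvd (x1 - x2)"
    and "\<not> (N dvd (a1 - a2) \<and> N dvd (b1 - b2)) \<Longrightarrow> D dvd x1 \<and> D dvd x2"
proof -
  have add: "(x1 + y1, x2 + y2) \<in> K" if "(x1, x2) \<in> K" "(y1, y2) \<in> K" for x1 x2 y1 y2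
  proof -
    have "(0, 0) \<in> K" using diff[OF that(2) that(2)] by simp
    from diff[OF this that(2)] have "(- y1, - y2) \<in> K" by simp
    from diff[OF that(1) this] show ?thesis by simp
  qed
  have scalar: "D dvd m" if m: "(m, 0) \<in> K" for m
  proof -
    have "(0, m) \<in> K" using rot[OF m] by simp
    with m have "D dvd m * b2" "D dvd - (a2 * m)" "D dvd - (m * b1)" "D dvd a1 * m" using sub by fastforce+
    then show ?thesis using dvd_if_primitive_multiples[OF prim, of D m] by (simp add: mult.commute)
  qed
  have trace: "D dvd (2 * y1 + t * y2)" if y: "(y1, y2) \<in> K" for y1 y2
  proof (rule scalar)
    have "(y1 + (y1 + t * y2), y2 + - y2) \<in> K" using add[OF y con[OF y]] .
    moreover have "y1 + (y1 + t * y2) = 2 * y1 + t * y2" by simp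
    ultimately show "(2 * y1 + t * y2, 0) \<in> K" by simp
  qed
  have tr: "D dvd (2 * x1 + t * x2)" "D dvd (- 2 * x2 + t * (x1 + t * x2))"
    using trace[OF x] trace[OF rot[OF x]] by simp_all
  have dN: "D dvd N * x1 \<and> D dvd N * x2 \<and> (t = 1 \<longrightarrow> D dvd (x1 - x2))"
  proof (cases "t = 0")
    case True
    then show ?thesis using tr by (simp add: N_def)
  next
    case False
    then have t1: "t = 1" using t by blast
    have *: "D dvd (2 * x1 + x2)" "D dvd (x1 - x2)" using tr t1 by simp_all
    have "3 * x1 = (2 * x1 + x2) + (x1 - x2)" "3 * x2 = (2 * x1 + x2) - 2 * (x1 - x2)" by simp_all
    then have "D dvd 3 * x1" "D dvd 3 * x2" using * by (metis dvd_add, metis dvd_diff dvd_mult)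
    then show ?thesis using * t1 by (simp add: N_def)
  qed
  then have dNm: "D dvd N * (x1 - x2)" by (simp add: right_diff_distrib)
  have sx: "D dvd (x1 * b2 - x2 * b1)" "D dvd (a1 * x2 - a2 * x1)" using sub[OF x] by blast+
  show "D dvd N * x1 \<and> D dvd N * x2 \<and> D dvd (x1 - x2)" if div: "N dvd (a1 - a2) \<and> N dvd (b1 - b2)"
  proof -
    obtain k l where k: "a1 - a2 = N * k" and l: "b1 - b2 = N * l" using div by (auto elim!: dvdE)
    have "(x1 - x2) * b1 = (x1 * b2 - x2 * b1) + l * (N * x1)"
      "(x1 - x2) * b2 = (x1 * b2 - x2 * b1) + l * (N * x2)"
      "(x1 - x2) * a1 = k * (N * x1) - (a1 * x2 - a2 * x1)"
      "(x1 - x2) * a2 = k * (N * x2) - (a1 * x2 - a2 * x1)"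
      using k l by algebra+
    then have "D dvd (x1 - x2) * b1" "D dvd (x1 - x2) * b2" "D dvd (x1 - x2) * a1" "D dvd (x1 - x2) * a2"
      using sx dN by (metis dvd_add dvd_mult, metis dvd_add dvd_mult, metis dvd_diff dvd_mult, metis dvd_diff dvd_mult)
    then show ?thesis using dN dvd_if_primitive_multiples[OF prim, of D "x1 - x2"] by blast
  qed
  show "D dvd x1 \<and> D dvd x2" if ndiv: "\<not> (N dvd (a1 - a2) \<and> N dvd (b1 - b2))"
  proof -
    have "prime N" using t by (auto simp: N_def)
    obtain g where cop: "coprime N g" and g: "g = b1 - b2 \<or> g = a1 - a2"
      using ndiv prime_imp_coprime[OF \<open>prime N\<close>] by blast
    have key: "D dvd g * y1" if "D dvd (y1 - y2)" "(y1, y2) \<in> K" for y1 y2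
    proof -
      have e: "(b1 - b2) * y1 = b1 * (y1 - y2) - (y1 * b2 - y2 * b1)"
        "(a1 - a2) * y1 = a1 * (y1 - y2) + (a1 * y2 - a2 * y1)" by algebra+
      then show ?thesis using g that sub[OF that(2)]
        by (metis dvd_add dvd_diff dvd_mult)
    qed
    have m: "D dvd (x1 - x2)"
    proof (cases "t = 0")
      case True
      (* for t = 0 the swap of coordinates is sigma after conjugation *)
      have "(x1 - x2, x2 - x1) \<in> K"
      proof -
        have "(x2, x1) \<in> K" using rot[OF con[OF x]] True by simp
        from diff[OF x this] show ?thesis .
      qed
      from con[OF this] have "(x1 - x2, x1 - x2) \<in> K" using True by simp
      from key[OF _ this] have "D dvd g * (x1 - x2)" by simp
      then show ?thesis using dvd_if_coprime_multiples[OF dNm _ cop] by blast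
    qed (use dN t in blast)
    have "D dvd x1" using dvd_if_coprime_multiples[OF _ key[OF m x] cop] dN by blast
    moreover from this m have "D dvd x1 - (x1 - x2)" by (rule dvd_diff)
    ultimately show ?thesis by simp
  qed
qed

text \<open>A unimodular change of the generators produces \<open>(E, 0)\<close> and \<open>(f, g)\<close> with \<open>g\<close> the gcd of the second
coordinates. Modulo these, each pair has a unique representative in a box of size \<open>\<bar>E\<bar>\<close> times \<open>g\<close>, and
\<open>F\<close> computes it.\<close>

lemma lattice_index:
  fixes a1 a2 b1 b2 :: int
  assumes D: "a1 * b2 - a2 * b1 \<noteq> 0"
  shows "\<exists>F :: int \<times> int \<Rightarrow> int \<times> int.
     (\<forall>x1 x2 y1 y2. F (x1, x2) = F (y1, y2) \<longleftrightarrow>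
        (\<exists>p q. x1 - y1 = p * a1 + q * b1 \<and> x2 - y2 = p * a2 + q * b2)) \<and>
     card (range F) = nat \<bar>a1 * b2 - a2 * b1\<bar>"
proof -
  define g where "g = gcd a2 b2"
  have g0: "g > 0" using D by (auto simp: g_def)
  obtain a b where ab: "a2 = g * a" "b2 = g * b" unfolding g_def by (metis dvdE gcd_dvd1 gcd_dvd2)
  obtain u v where "u * a2 + v * b2 = g" using bezout_int g_def by blast
  then have "g * (u * a + v * b) = g * 1" unfolding ab by (simp add: algebra_simps)
  then have uv: "u * a + v * b = 1" using g0 by simp
  define f where "f = u * a1 + v * b1"
  define E where "E = a1 * b - a * b1"
  have DE: "a1 * b2 - a2 * b1 = g * E" unfolding E_def ab by algebra
  have E0: "E \<noteq> 0" using D DE by auto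
  have mem: "(\<exists>p q. x1 = p * a1 + q * b1 \<and> x2 = p * a2 + q * b2) \<longleftrightarrow> g dvd x2 \<and> E dvd (x1 - f * (x2 div g))" for x1 x2
  proof
    assume "\<exists>p q. x1 = p * a1 + q * b1 \<and> x2 = p * a2 + q * b2"
    then obtain p q where x: "x1 = p * a1 + q * b1" "x2 = p * a2 + q * b2" by blast
    have x2: "x2 = g * (p * a + q * b)" unfolding x ab by algebra
    then have "x2 div g = p * a + q * b" using g0 by simp
    moreover have "x1 - f * (p * a + q * b) = E * (p * v - q * u)"
      unfolding x f_def E_def using uv by algebra
    ultimately show "g dvd x2 \<and> E dvd (x1 - f * (x2 div g))" using x2 by simp
  next
    assume "g dvd x2 \<and> E dvd (x1 - f * (x2 div g))"
    then obtain s k where s: "x2 = g * s" and k: "x1 - f * (x2 div g) = E * k" unfolding dvd_def by blast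
    have "x1 = f * s + E * k" using k s g0 by simp
    then have "x1 = (u * s + k * b) * a1 + (v * s - k * a) * b1" "x2 = (u * s + k * b) * a2 + (v * s - k * a) * b2"
      unfolding s f_def E_def ab using uv by algebra+
    then show "\<exists>p q. x1 = p * a1 + q * b1 \<and> x2 = p * a2 + q * b2" by blast
  qed
  define F where "F = (\<lambda>(x1, x2). (x2 mod g, (x1 - f * (x2 div g)) mod \<bar>E\<bar>))"
  have "F (x1, x2) = F (y1, y2) \<longleftrightarrow> (\<exists>p q. x1 - y1 = p * a1 + q * b1 \<and> x2 - y2 = p * a2 + q * b2)" for x1 x2 y1 y2
  proof -
    have "F (x1, x2) = F (y1, y2) \<longleftrightarrow> g dvd (x2 - y2) \<and> E dvd (x1 - f * (x2 div g) - (y1 - f * (y2 div g)))"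
      by (simp add: F_def mod_eq_dvd_iff)
    also have "\<dots> \<longleftrightarrow> g dvd (x2 - y2) \<and> E dvd ((x1 - y1) - f * ((x2 - y2) div g))"
    proof (rule conj_cong[OF refl])
      assume "g dvd (x2 - y2)"
      then obtain k where "x2 = y2 + g * k" by (metis dvdE diff_add_cancel add.commute)
      then have "x2 div g = y2 div g + k" "(x2 - y2) div g = k" using g0 by simp_all
      then have "x1 - f * (x2 div g) - (y1 - f * (y2 div g)) = (x1 - y1) - f * ((x2 - y2) div g)"
        by (simp add: distrib_left)
      then show "E dvd (x1 - f * (x2 div g) - (y1 - f * (y2 div g))) \<longleftrightarrow> E dvd ((x1 - y1) - f * ((x2 - y2) div g))"
        by (simp only:)
    qed
    also have "\<dots> \<longleftrightarrow> (\<exists>p q. x1 - y1 = p * a1 + q * b1 \<and> x2 - y2 = p * a2 + q * b2)"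
      by (simp only: mem)
    finally show ?thesis .
  qed
  moreover have "range F = {0..<g} \<times> {0..<\<bar>E\<bar>}"
  proof (intro equalityI subsetI)
    fix y assume "y \<in> {0..<g} \<times> {0..<\<bar>E\<bar>}"
    then have "F (snd y, fst y) = y" by (auto simp: F_def)
    then show "y \<in> range F" by (metis rangeI)
  qed (use g0 E0 in \<open>auto simp: F_def\<close>)
  then have "card (range F) = nat \<bar>a1 * b2 - a2 * b1\<bar>"
    unfolding DE using g0 by (simp add: card_cartesian_product abs_mult nat_mult_distrib)
  ultimately show ?thesis by blast
qed

section \<open>The symmetry group\<close>

lemma Aut_simps [simp]:
  "mult (Aut \<tau>) = (\<circ>)" "one (Aut \<tau>) = id"
  by (simp_all add: Aut_def)

lemma Aut_carrier_iff: "f \<in> carrier (Aut \<tau>) \<longleftrightarrow> plane_isometry f \<and> (\<lambda>P. f ` P) ` \<tau> = \<tau>"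
  by (simp add: Aut_def)

lemma plane_isometry_bij: assumes "plane_isometry f" shows "bij f"
proof -
  have "inj f"
  proof (rule injI)
    fix x y assume "f x = f y"
    then have "dist (f x) (f y) = 0" by simp
    moreover have "dist (f x) (f y) = dist x y" using assms by (simp add: plane_isometry_def)
    ultimately show "x = y" by simp
  qed
  then show ?thesis using assms by (simp add: plane_isometry_def bij_def)
qed

lemma Aut_bij: "f \<in> carrier (Aut \<tau>) \<Longrightarrow> bij f"
  by (simp add: Aut_carrier_iff plane_isometry_bij)

lemma plane_isometry_inverse: assumes "plane_isometry f" shows "plane_isometry (inv_into UNIV f)"
proof -
  have b: "bij f" by (rule plane_isometry_bij[OF assms])
  have "dist (inv_into UNIV f x) (inv_into UNIV f y) = dist x y" for x y
  proof -
    have "dist (f (inv_into UNIV f x)) (f (inv_into UNIV f y)) = dist (inv_into UNIV f x) (inv_into UNIV f y)"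
      using assms by (simp add: plane_isometry_def)
    then show ?thesis using b by (simp add: bij_is_surj surj_f_inv_f)
  qed
  then show ?thesis using b by (simp add: plane_isometry_def bij_imp_bij_inv bij_is_surj)
qed

lemma group_Aut: "group (Aut \<tau>)"
proof (rule groupI)
  fix f g assume "f \<in> carrier (Aut \<tau>)" "g \<in> carrier (Aut \<tau>)"
  then have f: "plane_isometry f" "(\<lambda>P. f ` P) ` \<tau> = \<tau>" and g: "plane_isometry g" "(\<lambda>P. g ` P) ` \<tau> = \<tau>"
    by (simp_all add: Aut_carrier_iff)
  have "surj (f \<circ> g)" using f(1) g(1) by (intro comp_surj) (simp_all add: plane_isometry_def)
  then have "plane_isometry (f \<circ> g)"
    using f(1) g(1) by (simp add: plane_isometry_def)
  moreover have "(\<lambda>P. (f \<circ> g) ` P) ` \<tau> = (\<lambda>P. f ` P) ` (\<lambda>P. g ` P) ` \<tau>"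
    by (simp add: image_comp)
  then have "(\<lambda>P. (f \<circ> g) ` P) ` \<tau> = \<tau>" using f(2) g(2) by simp
  ultimately show "f \<otimes>\<^bsub>Aut \<tau>\<^esub> g \<in> carrier (Aut \<tau>)" by (simp add: Aut_carrier_iff)
next
  show "\<one>\<^bsub>Aut \<tau>\<^esub> \<in> carrier (Aut \<tau>)" by (simp add: Aut_carrier_iff plane_isometry_def)
next
  fix f assume f: "f \<in> carrier (Aut \<tau>)"
  then have b: "bij f" by (rule Aut_bij)
  then have i: "inv_into UNIV f \<circ> f = id" by (simp add: bij_is_inj)
  have "(\<lambda>P. inv_into UNIV f ` P) ` \<tau> = (\<lambda>P. inv_into UNIV f ` P) ` (\<lambda>P. f ` P) ` \<tau>"
    using f by (simp add: Aut_carrier_iff)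
  also have "\<dots> = ((\<lambda>P. inv_into UNIV f ` P) \<circ> (\<lambda>P. f ` P)) ` \<tau>" by (rule image_comp)
  also have "(\<lambda>P. inv_into UNIV f ` P) \<circ> (\<lambda>P. f ` P) = id"
  proof
    fix P show "((\<lambda>P. inv_into UNIV f ` P) \<circ> (\<lambda>P. f ` P)) P = id P"
      using i image_comp[of "inv_into UNIV f" f P] by simp
  qed
  finally have "(\<lambda>P. inv_into UNIV f ` P) ` \<tau> = \<tau>" by simp
  then have "inv_into UNIV f \<in> carrier (Aut \<tau>)"
    using f plane_isometry_inverse by (simp add: Aut_carrier_iff)
  then show "\<exists>g\<in>carrier (Aut \<tau>). g \<otimes>\<^bsub>Aut \<tau>\<^esub> f = \<one>\<^bsub>Aut \<tau>\<^esub>" using i by (intro bexI[of _ "inv_into UNIV f"]) simp_all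
qed (simp_all add: comp_assoc)

lemma inv_Aut:
  assumes f: "f \<in> carrier (Aut \<tau>)" shows "inv\<^bsub>Aut \<tau>\<^esub> f = inv_into UNIV f"
proof -
  interpret group "Aut \<tau>" by (rule group_Aut)
  have l: "inv\<^bsub>Aut \<tau>\<^esub> f \<circ> f = id" using l_inv[OF f] by simp
  have r: "f \<circ> inv_into UNIV f = id" using Aut_bij[OF f] bij_is_surj surj_iff by blast
  have "inv\<^bsub>Aut \<tau>\<^esub> f = inv\<^bsub>Aut \<tau>\<^esub> f \<circ> (f \<circ> inv_into UNIV f)" unfolding r by simp
  also have "\<dots> = inv_into UNIV f" unfolding comp_assoc[symmetric] l by simp
  finally show ?thesis .
qed

section \<open>Flags\<close>

lemma simil_face_of:
  assumes l: "l \<noteq> 0" shows "(simil b l c ` F) face_of (simil b l c ` S) \<longleftrightarrow> F face_of S"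
    and "aff_dim (simil b l c ` F) = aff_dim F"
proof -
  let ?g = "\<lambda>z. l * (if c then cnj z else z)"
  have lin: "linear ?g"
    by (cases c) (auto intro!: linearI simp: algebra_simps scaleR_conv_of_real)
  have inj: "inj ?g" using l by (cases c) (auto simp: inj_def)
  have im: "simil b l c ` S = (+) b ` ?g ` S" for S
    by (simp add: image_image simil_def)
  show "(simil b l c ` F) face_of (simil b l c ` S) \<longleftrightarrow> F face_of S"
    unfolding im face_of_translation_eq using face_of_linear_image[OF lin inj] by blast
  show "aff_dim (simil b l c ` F) = aff_dim F"
    unfolding im aff_dim_translation_eq using aff_dim_injective_linear_image[OF lin inj] by blast
qed

lemma Aut_simil:
  assumes "f \<in> carrier (Aut \<tau>)"
  obtains b l c where "norm l = 1" "f = simil b l c"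
proof -
  have "plane_isometry f" using assms by (simp add: Aut_carrier_iff)
  from plane_isometry_is_simil[OF this] show ?thesis using that by blast
qed

lemma Aut_image_face: "f \<in> carrier (Aut \<tau>) \<Longrightarrow> P \<in> \<tau> \<Longrightarrow> f ` P \<in> \<tau>"
  unfolding Aut_carrier_iff by blast

lemma Aut_image_vertex:
  assumes f: "f \<in> carrier (Aut \<tau>)" and v: "v \<in> vertices \<tau>" shows "f v \<in> vertices \<tau>"
proof -
  obtain b l c where l: "norm l = 1" and fs: "f = simil b l c" using Aut_simil[OF f] .
  obtain P where P: "P \<in> \<tau>" "v extreme_point_of P" using v unfolding vertices_def by blast
  have "l \<noteq> 0" using l by auto
  then have "(f ` {v}) face_of (f ` P)" unfolding fs using simil_face_of(1) P(2) face_of_singleton by blast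
  then have "f v extreme_point_of (f ` P)" by (simp add: face_of_singleton)
  then show ?thesis using vertexI[OF Aut_image_face[OF f P(1)]] by blast
qed

lemma Aut_image_edge:
  assumes f: "f \<in> carrier (Aut \<tau>)" and e: "e \<in> edges \<tau>" shows "f ` e \<in> edges \<tau>"
proof -
  obtain b l c where l: "norm l = 1" and fs: "f = simil b l c" using Aut_simil[OF f] .
  obtain P where P: "P \<in> \<tau>" "e edge_of P" using e unfolding edges_def by blast
  have l0: "l \<noteq> 0" using l by auto
  have "f ` e edge_of f ` P" using P(2) unfolding edge_of_def fs simil_face_of[OF l0] .
  then show ?thesis using Aut_image_face[OF f P(1)] unfolding edges_def by blast
qed

lemma flag_act_in_flags:
  assumes f: "f \<in> carrier (Aut \<tau>)" and x: "x \<in> flags \<tau>" shows "flag_act f x \<in> flags \<tau>"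
  using x Aut_image_face[OF f] Aut_image_vertex[OF f] Aut_image_edge[OF f]
  unfolding flags_def flag_act_def by auto

lemma flag_act_comp: "flag_act (f \<circ> g) x = flag_act f (flag_act g x)"
  by (cases x) (simp add: flag_act_def image_comp)

lemma flag_act_id: "flag_act id x = x"
  by (cases x) (simp add: flag_act_def)

lemma flag_in_orbit: "id \<in> G \<Longrightarrow> x \<in> (\<lambda>g. flag_act g x) ` G"
  by (rule image_eqI[of _ _ id]) (simp_all add: flag_act_id)

text \<open>A symmetry that fixes \<open>v\<close> and the edge fixes the edge pointwise, so it is the identity or the reflection
in the line of the edge. The reflection would move the polygon to the other side of that line.\<close>

lemma flag_with_trivial_stabilizer:
  assumes T: "tessellation \<tau>" and v: "v \<in> vertices \<tau>" and P: "P \<in> \<tau>" and e: "e edge_of P" "v \<in> e"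
    and f: "f \<in> carrier (Aut \<tau>)" and stab: "flag_act f (v, e, P) = (v, e, P)"
  shows "f = id"
proof -
  have fv: "f v = v" and fe: "f ` e = e" and fP: "f ` P = P" using stab by (simp_all add: flag_act_def)
  have eP: "e face_of P" using e(1) by (simp add: edge_of_def)
  have vP: "v \<in> P" using e eP face_of_imp_subset by blast
  obtain n d where n: "n \<ge> 3" and d: "d \<noteq> 0" and Pn: "P = ngon n v d"
    using face_at_vertex[OF T v P vP] .
  have "interior P \<noteq> {}" by (rule face_interior_nonempty[OF T P])
  then have "aff_dim P = 2" using aff_dim_nonempty_interior[of P] by simp
  then have neq: "e \<noteq> P" using e(1) by (auto simp: edge_of_def)
  have edge_pt: "\<exists>p>0. x = v + of_real p * d \<or> x = v + of_real p * (d * turn n)" if "x \<in> e" "x \<noteq> v" for x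
    using proper_face_at_corner[OF n d eP[unfolded Pn] neq[unfolded Pn] e(2) that] .
  obtain b l c where l: "norm l = 1" and fs: "f = simil b l c" using Aut_simil[OF f] .
  obtain x where x: "x \<in> e" "x \<noteq> v" using edge_of_contains_other_point[OF e] by blast
  have fx: "f x \<in> e" using fe x(1) by blast
  have dfx: "dist (f x) v = dist x v" using f fv unfolding Aut_carrier_iff plane_isometry_def by metis
  then have fxv: "f x \<noteq> v" using x(2) by auto
  obtain p u where p: "p > 0" "x = v + of_real p * u" "u = d \<or> u = d * turn n"
    using edge_pt[OF x] by blast
  obtain p' u' where p': "p' > 0" "f x = v + of_real p' * u'" "u' = d \<or> u' = d * turn n"
    using edge_pt[OF fx fxv] by blast
  have nu: "norm u = norm d" "norm u' = norm d" using p(3) p'(3) by (auto simp: norm_mult)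
  have "dist x v = p * norm d" using p(1) nu(1) unfolding p(2) by (simp add: dist_norm norm_mult)
  moreover have "dist (f x) v = p' * norm d" using p'(1) nu(2) unfolding p'(2) by (simp add: dist_norm norm_mult)
  ultimately have "p' * norm d = p * norm d" using dfx by metis
  then have pp: "p' = p" using d by auto
  have "u' = u"
  proof (rule ccontr)
    assume "u' \<noteq> u"
    then have uu: "u + u' = d * (1 + turn n)" using p(3) p'(3) by (auto simp: algebra_simps)
    (* otherwise the edge would contain points of both bounding rays, and their midpoint lies on neither *)
    define y where "y = midpoint x (f x)"
    have "y \<in> e" unfolding y_def
      using closed_segment_subset[OF x(1) fx face_of_imp_convex[OF eP]] midpoint_in_closed_segment by blast
    have ye: "y = v + of_real (p / 2) * (d * (1 + turn n))"
    proof -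
      have "y = midpoint (v + of_real p * u) (v + of_real p * u')" unfolding y_def p'(2) pp unfolding p(2) ..
      also have "\<dots> = v + of_real (p / 2) * (u + u')"
        by (simp add: midpoint_def scaleR_conv_of_real algebra_simps)
      finally show ?thesis unfolding uu .
    qed
    have "1 + turn n \<noteq> 0" using Im_turn_pos[OF n] by (auto simp: complex_eq_iff)
    then have "y \<noteq> v" using ye p(1) d by simp
    obtain q where q: "q > 0" "y = v + of_real q * d \<or> y = v + of_real q * (d * turn n)"
      using edge_pt[OF \<open>y \<in> e\<close> \<open>y \<noteq> v\<close>] by blast
    obtain a b where ab: "a = 0 \<or> b = 0" "y = v + d * (of_real a + of_real b * turn n)"
    proof (cases "y = v + of_real q * d")
      case True
      then show ?thesis by (intro that[of q 0]) (simp_all add: mult.commute)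
    next
      case False
      then show ?thesis using q(2) by (intro that[of 0 q]) (simp_all add: mult_ac)
    qed
    have "y = v + d * (of_real (p/2) + of_real (p/2) * turn n)" unfolding ye by (simp add: algebra_simps)
    then have "v + d * (of_real (p/2) + of_real (p/2) * turn n) = v + d * (of_real a + of_real b * turn n)"
      using ab(2) by (rule trans[OF sym])
    then have "of_real (p/2) + of_real (p/2) * turn n = of_real a + of_real b * turn n"
      by (rule mult_left_cancel[OF d, THEN iffD1, OF add_left_imp_eq])
    from cone_coords_unique[OF n this] have "p / 2 = 0" using ab(1) by auto
    then show False using p(1) by simp
  qed
  then have fxx: "f x = x" using p p' pp by simp
  have lu: "l * (if c then cnj u else u) = u"
  proof -
    have "f x - f v = l * (if c then cnj (x - v) else x - v)" unfolding fs by (simp add: simil_def algebra_simps)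
    moreover have "x - v = of_real p * u" using p(2) by simp
    ultimately have "of_real p * u = l * (if c then cnj (of_real p * u) else of_real p * u)"
      using fxx fv by (simp only:)
    also have "\<dots> = of_real p * (l * (if c then cnj u else u))" by (simp add: mult_ac)
    finally show ?thesis using p(1) by simp
  qed
  have u0: "u \<noteq> 0" using p(3) d by auto
  have "turn n \<noteq> 1" using Im_turn_pos[OF n] by auto
  have "\<not> c"
  proof
    assume c: c
    have "l \<noteq> 0" using l by auto
    have "ngon n v (l * cnj (d * turn n)) = ngon n v d"
      using fP simil_ngon[OF n, of b l c v d] fv c unfolding fs Pn by simp
    then have "l * cnj (d * turn n) = d"
      using ngon_unique(2)[OF n n, of "l * cnj (d * turn n)" d v] d \<open>l \<noteq> 0\<close> by auto
    then show False using p(3)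
    proof (elim disjE)
      assume 1: "l * cnj (d * turn n) = d" and "u = d"
      then have "l * cnj d = d" using lu c by simp
      moreover have "cnj (turn n) * (l * cnj d) = l * cnj (d * turn n)" by (simp add: mult_ac)
      ultimately have "cnj (turn n) * d = 1 * d" using 1 by (simp only: mult_1)
      then have "cnj (turn n) = 1" using d by simp
      then show False using \<open>turn n \<noteq> 1\<close> by (metis complex_cnj_cancel_iff complex_cnj_one)
    next
      assume 1: "l * cnj (d * turn n) = d" and "u = d * turn n"
      then have "d * turn n = d" using lu c by simp
      then show False using \<open>turn n \<noteq> 1\<close> d by simp
    qed
  qed
  then have "l = 1" using lu u0 by simp
  then have "b = 0" using fv \<open>\<not> c\<close> unfolding fs by (simp add: simil_def)
  then show ?thesis using \<open>l = 1\<close> \<open>\<not> c\<close> unfolding fs by (auto simp: simil_def)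
qed


section \<open>Almost regular maps\<close>

lemma mem_normalizer_iff:
  assumes G: "G \<subseteq> carrier (Aut \<tau>)"
  shows "n \<in> normalizer (Aut \<tau>) G \<longleftrightarrow>
    n \<in> carrier (Aut \<tau>) \<and> (\<lambda>g. n \<circ> g \<circ> inv_into UNIV n) ` G = G"
proof -
  have "n <#\<^bsub>Aut \<tau>\<^esub> G #>\<^bsub>Aut \<tau>\<^esub> m = (\<lambda>g. n \<circ> g \<circ> m) ` G" for m
    unfolding l_coset_def r_coset_def by auto
  then show ?thesis
    using G inv_Aut[of n \<tau>] by (auto simp: normalizer_def stabilizer_def)
qed

lemma orbits_eq_image: "orbits M E \<phi> = orbit M \<phi> ` E"
  by (auto simp: orbits_def)

text \<open>An orbit of the quotient group consists of the \<open>G\<close>-orbits contained in one orbit of the normalizer;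
forming the union recovers that orbit.\<close>

lemma card_quotient_flag_orbits:
  assumes G: "subgroup G (Aut \<tau>)"
  shows "card (orbits (quotient_Aut \<tau> G) (quotient_flags \<tau> G) quotient_flag_act) =
    card ((\<lambda>x. {flag_act n x |n. n \<in> normalizer (Aut \<tau>) G}) ` flags \<tau>)"
proof -
  interpret A: group "Aut \<tau>" by (rule group_Aut)
  define N where "N = normalizer (Aut \<tau>) G"
  have GA: "G \<subseteq> carrier (Aut \<tau>)" using G by (rule subgroup.subset)
  have NA: "subgroup N (Aut \<tau>)" unfolding N_def by (rule A.normalizer_imp_subgroup[OF GA])
  have NG: "(\<lambda>g. n \<circ> g \<circ> inv_into UNIV n) ` G = G" "n \<in> carrier (Aut \<tau>)" if "n \<in> N" for n
    using that mem_normalizer_iff[OF GA] unfolding N_def by blast+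
  define O1 where "O1 = (\<lambda>x. (\<lambda>g. flag_act g x) ` G)"
  define r where "r = (\<lambda>x. (\<lambda>n. flag_act n x) ` N)"
  have GN: "g \<in> N" if "g \<in> G" for g
  proof -
    have g: "g \<in> carrier (Aut \<tau>)" using that GA by blast
    have inv: "inv_into UNIV g \<in> G" using subgroup.m_inv_closed[OF G that] inv_Aut[OF g] by simp
    have mul: "x \<circ> y \<in> G" if "x \<in> G" "y \<in> G" for x y using subgroup.m_closed[OF G that] by simp
    have "(\<lambda>h. g \<circ> h \<circ> inv_into UNIV g) ` G = G"
    proof (intro equalityI subsetI)
      fix h assume h: "h \<in> G"
      have "h = g \<circ> (inv_into UNIV g \<circ> h \<circ> g) \<circ> inv_into UNIV g"
        using Aut_bij[OF g] by (auto simp: fun_eq_iff bij_is_surj surj_f_inv_f)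
      moreover have "inv_into UNIV g \<circ> h \<circ> g \<in> G" using mul inv h that by blast
      ultimately show "h \<in> (\<lambda>h. g \<circ> h \<circ> inv_into UNIV g) ` G" by blast
    qed (use mul that inv in blast)
    then show ?thesis using mem_normalizer_iff[OF GA] g unfolding N_def by blast
  qed
  have act: "quotient_flag_act (G #>\<^bsub>Aut \<tau>\<^esub> n) (O1 x) = O1 (flag_act n x)" if n: "n \<in> N" for n x
  proof -
    have bij: "bij n" using Aut_bij NG(2)[OF n] by blast
    have mul: "x \<circ> y \<in> G" if "x \<in> G" "y \<in> G" for x y using subgroup.m_closed[OF G that] by simp
    have "id \<in> G" using subgroup.one_closed[OF G] by simp
    have "quotient_flag_act (G #>\<^bsub>Aut \<tau>\<^esub> n) (O1 x) = (\<Union>g\<in>G. \<Union>h\<in>G. {flag_act (g \<circ> n \<circ> h) x})"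
      unfolding quotient_flag_act_def r_coset_def O1_def by (simp add: flag_act_comp image_UN image_image) blast
    also have "\<dots> = (\<lambda>g. flag_act (g \<circ> n) x) ` G"
    proof (intro equalityI subsetI)
      fix y assume "y \<in> (\<Union>g\<in>G. \<Union>h\<in>G. {flag_act (g \<circ> n \<circ> h) x})"
      then obtain g h where gh: "g \<in> G" "h \<in> G" "y = flag_act (g \<circ> n \<circ> h) x" by blast
      have "n \<circ> h \<circ> inv_into UNIV n \<in> G" using NG(1)[OF n] gh(2) by blast
      then have "g \<circ> (n \<circ> h \<circ> inv_into UNIV n) \<in> G" using mul gh(1) by blast
      moreover have "g \<circ> n \<circ> h = g \<circ> (n \<circ> h \<circ> inv_into UNIV n) \<circ> n"
        using bij by (auto simp: fun_eq_iff bij_is_inj)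
      ultimately show "y \<in> (\<lambda>g. flag_act (g \<circ> n) x) ` G" unfolding gh(3) by (intro image_eqI) simp_all
    next
      fix y assume "y \<in> (\<lambda>g. flag_act (g \<circ> n) x) ` G"
      then obtain g where g: "y = flag_act (g \<circ> n) x" "g \<in> G" by (rule imageE)
      show "y \<in> (\<Union>g\<in>G. \<Union>h\<in>G. {flag_act (g \<circ> n \<circ> h) x})"
        by (rule UN_I[OF g(2)], rule UN_I[OF \<open>id \<in> G\<close>]) (simp add: g(1))
    qed
    also have "\<dots> = O1 (flag_act n x)" unfolding O1_def by (simp add: flag_act_comp)
    finally show ?thesis .
  qed
  have "orbits (quotient_Aut \<tau> G) (quotient_flags \<tau> G) quotient_flag_act
      = (\<lambda>x. orbit (quotient_Aut \<tau> G) quotient_flag_act (O1 x)) ` flags \<tau>"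
  proof -
    have "quotient_flags \<tau> G = O1 ` flags \<tau>"
      unfolding quotient_flags_def orbits_eq_image by (simp add: orbit_def O1_def Setcompr_eq_image)
    then show ?thesis unfolding orbits_eq_image by (simp only: image_image)
  qed
  also have "\<dots> = (\<lambda>x. O1 ` r x) ` flags \<tau>"
  proof (rule image_cong[OF refl])
    fix x
    have "carrier (quotient_Aut \<tau> G) = {G #>\<^bsub>Aut \<tau>\<^esub> n |n. n \<in> N}"
      unfolding quotient_Aut_def FactGroup_def RCOSETS_def N_def by auto
    then have "orbit (quotient_Aut \<tau> G) quotient_flag_act (O1 x)
        = (\<lambda>n. quotient_flag_act (G #>\<^bsub>Aut \<tau>\<^esub> n) (O1 x)) ` N"
      unfolding orbit_def by (simp add: Setcompr_eq_image image_image)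
    also have "\<dots> = (\<lambda>n. O1 (flag_act n x)) ` N" using act by (rule image_cong[OF refl])
    also have "\<dots> = O1 ` r x" unfolding r_def image_image ..
    finally show "orbit (quotient_Aut \<tau> G) quotient_flag_act (O1 x) = O1 ` r x" .
  qed
  finally have eq: "orbits (quotient_Aut \<tau> G) (quotient_flags \<tau> G) quotient_flag_act = (image O1) ` (r ` flags \<tau>)"
    by (simp only: image_image)
  have Un: "\<Union>(O1 ` r x) = r x" for x
  proof (intro equalityI subsetI)
    fix y assume "y \<in> \<Union>(O1 ` r x)"
    then obtain n g where "n \<in> N" "g \<in> G" "y = flag_act g (flag_act n x)" unfolding O1_def r_def by blast
    moreover from this have "g \<circ> n \<in> N" using subgroup.m_closed[OF NA GN] by simp
    ultimately show "y \<in> r x" unfolding r_def flag_act_comp[symmetric] by blast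
  next
    fix y assume y: "y \<in> r x"
    have "id \<in> G" using subgroup.one_closed[OF G] by simp
    then have "y \<in> O1 y" unfolding O1_def by (rule flag_in_orbit)
    then show "y \<in> \<Union>(O1 ` r x)" using y by blast
  qed
  have "inj_on (image O1) (r ` flags \<tau>)"
  proof (rule inj_onI)
    fix S S' assume S: "S \<in> r ` flags \<tau>" "S' \<in> r ` flags \<tau>" and e: "O1 ` S = O1 ` S'"
    obtain x x' where x: "S = r x" "S' = r x'" using S by blast
    have "\<Union>(O1 ` S) = S" "\<Union>(O1 ` S') = S'" unfolding x by (rule Un)+
    then show "S = S'" using e by metis
  qed
  then show ?thesis unfolding eq r_def N_def Setcompr_eq_image by (rule card_image)
qed

lemma orbit_flag_act:
  assumes f: "f \<in> carrier (Aut \<tau>)"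
  shows "orbit (Aut \<tau>) flag_act (flag_act f x) = orbit (Aut \<tau>) flag_act x"
proof -
  interpret A: group "Aut \<tau>" by (rule group_Aut)
  have img: "orbit (Aut \<tau>) flag_act z = (\<lambda>g. flag_act g z) ` carrier (Aut \<tau>)" for z
    by (auto simp: orbit_def)
  have "(\<lambda>g. g \<circ> f) ` carrier (Aut \<tau>) = carrier (Aut \<tau>)"
  proof (intro equalityI subsetI)
    fix g assume g: "g \<in> carrier (Aut \<tau>)"
    have gi: "g \<circ> inv_into UNIV f \<in> carrier (Aut \<tau>)"
      using A.m_closed[OF g A.inv_closed[OF f]] inv_Aut[OF f] by simp
    have "g = (g \<circ> inv_into UNIV f) \<circ> f" using Aut_bij[OF f]
      by (auto simp: fun_eq_iff bij_is_inj)
    from image_eqI[of g "\<lambda>g. g \<circ> f", OF this gi]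
    show "g \<in> (\<lambda>g. g \<circ> f) ` carrier (Aut \<tau>)" .
  qed (use A.m_closed[OF _ f] in auto)
  then have "(\<lambda>g. flag_act g x) ` carrier (Aut \<tau>) = (\<lambda>g. flag_act g x) ` (\<lambda>g. g \<circ> f) ` carrier (Aut \<tau>)"
    by (rule arg_cong[OF sym])
  then show ?thesis unfolding img image_image flag_act_comp by (rule sym)
qed

text \<open>By vertex-transitivity each orbit contains a flag at \<open>v\<close>. The edge of such a flag is a face of some
polygon through \<open>v\<close>, and there are finitely many of those.\<close>

lemma finite_flag_orbits:
  assumes arch: "archimedean \<tau>" and v: "v \<in> vertices \<tau>"
  shows "finite (orbits (Aut \<tau>) (flags \<tau>) flag_act)"
proof -
  interpret A: group "Aut \<tau>" by (rule group_Aut)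
  have T: "tessellation \<tau>" using arch by (simp add: archimedean_def)
  have Ps: "finite {P\<in>\<tau>. P \<inter> {v} \<noteq> {}}" by (rule tessellationD(4)[OF T]) simp
  define E where "E = (\<Union>P\<in>{P\<in>\<tau>. P \<inter> {v} \<noteq> {}}. {e. e face_of P})"
  have "finite {e. e face_of P}" if "P \<in> \<tau>" for P
    using face_properties(4)[OF T that] by (rule finite_polytope_faces)
  then have finE: "finite E" unfolding E_def using Ps by blast
  define F where "F = {v} \<times> E \<times> {P\<in>\<tau>. P \<inter> {v} \<noteq> {}}"
  have "finite F" unfolding F_def using Ps finE by blast
  have "orbits (Aut \<tau>) (flags \<tau>) flag_act \<subseteq> orbit (Aut \<tau>) flag_act ` F"
  proof
    fix S assume "S \<in> orbits (Aut \<tau>) (flags \<tau>) flag_act"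
    then obtain x where x: "x \<in> flags \<tau>" "S = orbit (Aut \<tau>) flag_act x" unfolding orbits_eq_image by blast
    obtain w e P where xw: "x = (w, e, P)" by (cases x)
    have "w \<in> vertices \<tau>" using x(1) xw by (simp add: flags_def)
    then obtain f where f: "f \<in> carrier (Aut \<tau>)" "f w = v" using arch v unfolding archimedean_def by blast
    have y: "flag_act f x \<in> flags \<tau>" by (rule flag_act_in_flags[OF f(1) x(1)])
    have "flag_act f x = (v, f ` e, f ` P)" using f(2) xw by (simp add: flag_act_def)
    then have "v \<in> f ` e" "f ` e \<in> edges \<tau>" "f ` P \<in> \<tau>" "f ` e \<subseteq> f ` P" using y by (simp_all add: flags_def)
    note fl = this
    obtain Q where Q: "Q \<in> \<tau>" "f ` e face_of Q" using fl(2) unfolding edges_def edge_of_def by blast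
    then have "v \<in> Q" using fl(1) face_of_imp_subset by blast
    then have "f ` e \<in> E" unfolding E_def using Q by blast
    moreover have "f ` P \<in> {P\<in>\<tau>. P \<inter> {v} \<noteq> {}}" using fl by blast
    ultimately have "flag_act f x \<in> F" unfolding \<open>flag_act f x = (v, f ` e, f ` P)\<close> F_def by blast
    moreover have "S = orbit (Aut \<tau>) flag_act (flag_act f x)"
      unfolding orbit_flag_act[OF f(1)] by (rule x(2))
    ultimately show "S \<in> orbit (Aut \<tau>) flag_act ` F" by blast
  qed
  then show ?thesis using \<open>finite F\<close> by (meson finite_imageI finite_subset)
qed

text \<open>Orbits of the normalizer lie in orbits of the whole group, and a surjection between finite sets of equal
size is injective. Hence both groups have the same orbit on the flag with trivial stabilizer, which forces
them to be equal.\<close>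

lemma almost_regular_iff_normal:
  assumes arch: "archimedean \<tau>" and v: "v \<in> vertices \<tau>" and P: "P \<in> \<tau>" and e: "e edge_of P" "v \<in> e"
    and G: "subgroup G (Aut \<tau>)"
  shows "almost_regular \<tau> G \<longleftrightarrow> normalizer (Aut \<tau>) G = carrier (Aut \<tau>)"
proof
  interpret A: group "Aut \<tau>" by (rule group_Aut)
  have T: "tessellation \<tau>" using arch by (simp add: archimedean_def)
  have GA: "G \<subseteq> carrier (Aut \<tau>)" using G by (rule subgroup.subset)
  define N where "N = normalizer (Aut \<tau>) G"
  have NA: "subgroup N (Aut \<tau>)" unfolding N_def by (rule A.normalizer_imp_subgroup[OF GA])
  have NC: "N \<subseteq> carrier (Aut \<tau>)" using NA by (rule subgroup.subset)
  define r where "r = (\<lambda>x. (\<lambda>n. flag_act n x) ` N)"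
  define x0 where "x0 = (v, e, P)"
  have x0: "x0 \<in> flags \<tau>" unfolding x0_def flags_def edges_def using v P e edge_of_imp_subset by blast
  have orb: "orbit (Aut \<tau>) flag_act x = (\<Union>z\<in>r x. orbit (Aut \<tau>) flag_act z)" for x
  proof (intro equalityI subsetI)
    fix y assume y: "y \<in> orbit (Aut \<tau>) flag_act x"
    have "id \<in> N" using subgroup.one_closed[OF NA] by simp
    then have "x \<in> r x" unfolding r_def by (rule flag_in_orbit)
    then show "y \<in> (\<Union>z\<in>r x. orbit (Aut \<tau>) flag_act z)" using y by blast
  next
    fix y assume "y \<in> (\<Union>z\<in>r x. orbit (Aut \<tau>) flag_act z)"
    then obtain n g where ng: "n \<in> N" "g \<in> carrier (Aut \<tau>)" "y = flag_act g (flag_act n x)"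
      unfolding r_def orbit_def by blast
    then have "g \<circ> n \<in> carrier (Aut \<tau>)" using A.m_closed[of g n] NC by auto
    then show "y \<in> orbit (Aut \<tau>) flag_act x" using ng(3) unfolding orbit_def flag_act_comp[symmetric] by blast
  qed
  {
    assume "almost_regular \<tau> G"
    then have card: "card (r ` flags \<tau>) = card (orbits (Aut \<tau>) (flags \<tau>) flag_act)"
      unfolding almost_regular_def card_quotient_flag_orbits[OF G] r_def N_def Setcompr_eq_image .
    define s where "s = (\<lambda>S. \<Union>z\<in>S. orbit (Aut \<tau>) flag_act z)"
    have im: "orbits (Aut \<tau>) (flags \<tau>) flag_act = s ` r ` flags \<tau>"
      unfolding orbits_eq_image image_image s_def orb[symmetric] by simp
    have "finite (orbits (Aut \<tau>) (flags \<tau>) flag_act)" by (rule finite_flag_orbits[OF arch v])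
    moreover have "orbits (Aut \<tau>) (flags \<tau>) flag_act \<noteq> {}" using x0 unfolding orbits_eq_image by blast
    ultimately have "card (orbits (Aut \<tau>) (flags \<tau>) flag_act) \<noteq> 0" by simp
    then have "finite (r ` flags \<tau>)" using card by (metis card.infinite)
    then have inj: "inj_on s (r ` flags \<tau>)" using card im by (intro eq_card_imp_inj_on) simp_all
    have "f \<in> N" if f: "f \<in> carrier (Aut \<tau>)" for f
    proof -
      define y where "y = flag_act f x0"
      have y: "y \<in> flags \<tau>" unfolding y_def by (rule flag_act_in_flags[OF f x0])
      have "orbit (Aut \<tau>) flag_act y = orbit (Aut \<tau>) flag_act x0"
        unfolding y_def by (rule orbit_flag_act[OF f])
      then have "s (r y) = s (r x0)" unfolding s_def orb[symmetric] .
      then have "r y = r x0" using inj x0 y by (meson imageI inj_onD)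
      moreover have "y \<in> r y"
      proof -
        have "id \<in> N" using subgroup.one_closed[OF NA] by simp
        then show ?thesis unfolding r_def by (rule flag_in_orbit)
      qed
      ultimately have "flag_act f x0 \<in> (\<lambda>n. flag_act n x0) ` N" unfolding r_def y_def by simp
      then obtain n where n: "flag_act f x0 = flag_act n x0" "n \<in> N" by (rule imageE)
      have nA: "n \<in> carrier (Aut \<tau>)" using n(2) NC by blast
      have niA: "inv_into UNIV n \<circ> f \<in> carrier (Aut \<tau>)"
        using A.m_closed[OF A.inv_closed[OF nA] f] inv_Aut[OF nA] by simp
      have "flag_act (inv_into UNIV n \<circ> f) x0 = flag_act (inv_into UNIV n \<circ> n) x0"
        unfolding flag_act_comp n(1) ..
      also have "\<dots> = x0" using Aut_bij[OF nA] by (simp add: bij_is_inj flag_act_id)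
      finally have "inv_into UNIV n \<circ> f = id"
        using flag_with_trivial_stabilizer[OF T v P e niA] unfolding x0_def by blast
      moreover have "n \<circ> (inv_into UNIV n \<circ> f) = f"
        using Aut_bij[OF nA] by (auto simp: fun_eq_iff bij_is_surj surj_f_inv_f)
      ultimately show "f \<in> N" using n(2) by simp
    qed
    then show "normalizer (Aut \<tau>) G = carrier (Aut \<tau>)" using NC unfolding N_def by blast
  }
  {
    assume "normalizer (Aut \<tau>) G = carrier (Aut \<tau>)"
    moreover have "orbit (Aut \<tau>) flag_act = (\<lambda>x. {flag_act g x |g. g \<in> carrier (Aut \<tau>)})"
      by (rule ext) (simp add: orbit_def)
    ultimately show "almost_regular \<tau> G"
      unfolding almost_regular_def card_quotient_flag_orbits[OF G]
      unfolding orbits_eq_image by simp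
  }
qed

section \<open>Translation groups\<close>

lemma plus_inj: "(+) x = (+) y \<longleftrightarrow> x = (y :: complex)"
  by (metis add.right_neutral)

lemma plus_image_eq_iff: "(+) ` L = (+) ` M \<longleftrightarrow> L = (M :: complex set)"
  by (rule inj_image_eq_iff) (auto simp: inj_def plus_inj)

lemma plus_comp: "(+) x \<circ> (+) y = (+) (x + y :: complex)"
  by (auto simp: fun_eq_iff add.assoc)

lemma conjugate_translation:
  assumes l: "norm l = 1"
  shows "simil b l c \<circ> (+) z \<circ> inv_into UNIV (simil b l c) = (+) (simil 0 l c z)"
proof -
  have "simil b l c \<circ> (+) z = (+) (simil 0 l c z) \<circ> simil b l c"
    by (auto simp: fun_eq_iff simil_def algebra_simps)
  moreover have "simil b l c \<circ> inv_into UNIV (simil b l c) = id"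
    using surj_iff[THEN iffD1, OF bij_is_surj[OF plane_isometry_bij[OF plane_isometry_simil[OF l]]]] .
  ultimately show ?thesis by (simp only: comp_assoc comp_id)
qed

lemma normalizer_translations_iff:
  assumes L: "(+) ` L \<subseteq> carrier (Aut \<tau>)"
  shows "normalizer (Aut \<tau>) ((+) ` L) = carrier (Aut \<tau>) \<longleftrightarrow>
    (\<forall>b l c. norm l = 1 \<longrightarrow> simil b l c \<in> carrier (Aut \<tau>) \<longrightarrow> simil 0 l c ` L = L)"
proof -
  have conj: "(\<lambda>g. simil b l c \<circ> g \<circ> inv_into UNIV (simil b l c)) ` (+) ` L = (+) ` L \<longleftrightarrow> simil 0 l c ` L = L"
    if "norm l = 1" for b l c
    unfolding image_image conjugate_translation[OF that]
    using plus_image_eq_iff[of "simil 0 l c ` L" L] by (simp add: image_image)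
  show ?thesis
  proof
    assume N: "normalizer (Aut \<tau>) ((+) ` L) = carrier (Aut \<tau>)"
    show "\<forall>b l c. norm l = 1 \<longrightarrow> simil b l c \<in> carrier (Aut \<tau>) \<longrightarrow> simil 0 l c ` L = L"
    proof (intro allI impI)
      fix b l c assume l: "norm (l::complex) = 1" and f: "simil b l c \<in> carrier (Aut \<tau>)"
      show "simil 0 l c ` L = L" using f conj[OF l] mem_normalizer_iff[OF L, of "simil b l c"] N by simp
    qed
  next
    assume R: "\<forall>b l c. norm l = 1 \<longrightarrow> simil b l c \<in> carrier (Aut \<tau>) \<longrightarrow> simil 0 l c ` L = L"
    have "f \<in> normalizer (Aut \<tau>) ((+) ` L)" if f: "f \<in> carrier (Aut \<tau>)" for f
    proof -
      obtain b l c where l: "norm l = 1" and fs: "f = simil b l c" using Aut_simil[OF f] .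
      have "simil 0 l c ` L = L" using R l f fs by blast
      then show ?thesis using f conj[OF l] mem_normalizer_iff[OF L, of f] unfolding fs by simp
    qed
    moreover have "f \<in> carrier (Aut \<tau>)" if "f \<in> normalizer (Aut \<tau>) ((+) ` L)" for f
      using that mem_normalizer_iff[OF L] by simp
    ultimately show "normalizer (Aut \<tau>) ((+) ` L) = carrier (Aut \<tau>)" by blast
  qed
qed

definition lattice_of :: "complex \<Rightarrow> complex \<Rightarrow> complex set" where
  "lattice_of \<alpha> \<beta> = {of_int p * \<alpha> + of_int q * \<beta> |p q. True}"

lemma lattice_ofI: "of_int p * \<alpha> + of_int q * \<beta> \<in> lattice_of \<alpha> \<beta>"
  unfolding lattice_of_def by blast

lemma lattice_of_gens: "\<alpha> \<in> lattice_of \<alpha> \<beta>" "\<beta> \<in> lattice_of \<alpha> \<beta>" "0 \<in> lattice_of \<alpha> \<beta>"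
  using lattice_ofI[of 1 \<alpha> 0 \<beta>] lattice_ofI[of 0 \<alpha> 1 \<beta>] lattice_ofI[of 0 \<alpha> 0 \<beta>] by simp_all

lemma lattice_of_add:
  assumes "x \<in> lattice_of \<alpha> \<beta>" "y \<in> lattice_of \<alpha> \<beta>" shows "x + y \<in> lattice_of \<alpha> \<beta>"
proof -
  obtain p q p' q' where "x = of_int p * \<alpha> + of_int q * \<beta>" "y = of_int p' * \<alpha> + of_int q' * \<beta>"
    using assms unfolding lattice_of_def by blast
  then have "x + y = of_int (p + p') * \<alpha> + of_int (q + q') * \<beta>" by (simp add: algebra_simps)
  then show ?thesis using lattice_ofI by metis
qed

lemma lattice_of_minus:
  assumes "x \<in> lattice_of \<alpha> \<beta>" shows "- x \<in> lattice_of \<alpha> \<beta>"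
proof -
  obtain p q where "x = of_int p * \<alpha> + of_int q * \<beta>" using assms unfolding lattice_of_def by blast
  then have "- x = of_int (- p) * \<alpha> + of_int (- q) * \<beta>" by (simp add: algebra_simps)
  then show ?thesis using lattice_ofI by metis
qed

lemma lattice_of_diff:
  "x \<in> lattice_of \<alpha> \<beta> \<Longrightarrow> y \<in> lattice_of \<alpha> \<beta> \<Longrightarrow> x - y \<in> lattice_of \<alpha> \<beta>"
  using lattice_of_add[of x \<alpha> \<beta> "- y"] lattice_of_minus[of y] by simp

lemma inv_Aut_translation:
  assumes "(+) x \<in> carrier (Aut \<tau>)" shows "inv\<^bsub>Aut \<tau>\<^esub> ((+) x) = (+) (- x)"
proof -
  have "inv_into UNIV ((+) x) = (+) (- x)" by (rule inv_unique_comp) (simp_all add: plus_comp fun_eq_iff)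
  then show ?thesis using inv_Aut[OF assms] by simp
qed

lemma torus_group_eq:
  assumes \<alpha>: "(+) \<alpha> \<in> carrier (Aut \<tau>)" and \<beta>: "(+) \<beta> \<in> carrier (Aut \<tau>)"
  shows "torus_group \<tau> \<alpha> \<beta> = (+) ` lattice_of \<alpha> \<beta>" "subgroup (torus_group \<tau> \<alpha> \<beta>) (Aut \<tau>)"
proof -
  interpret A: group "Aut \<tau>" by (rule group_Aut)
  show sg: "subgroup (torus_group \<tau> \<alpha> \<beta>) (Aut \<tau>)"
    unfolding torus_group_def by (rule A.generate_is_subgroup) (use \<alpha> \<beta> in auto)
  have mul: "(+) (x + y) \<in> torus_group \<tau> \<alpha> \<beta>" if "(+) x \<in> torus_group \<tau> \<alpha> \<beta>" "(+) y \<in> torus_group \<tau> \<alpha> \<beta>" for x y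
    using subgroup.m_closed[OF sg that] by (simp add: plus_comp)
  have zero: "(+) 0 \<in> torus_group \<tau> \<alpha> \<beta>"
  proof -
    have "id = (+) (0::complex)" by (auto simp: fun_eq_iff)
    then show ?thesis using subgroup.one_closed[OF sg] by simp
  qed
  have mult: "(+) (of_int p * x) \<in> torus_group \<tau> \<alpha> \<beta>" if x: "x \<in> {\<alpha>, \<beta>}" for p x
  proof -
    have g: "(+) x \<in> torus_group \<tau> \<alpha> \<beta>"
      unfolding torus_group_def using x by (intro generate.incl) auto
    have "(+) x \<in> carrier (Aut \<tau>)" using x \<alpha> \<beta> by auto
    then have m: "(+) (- x) \<in> torus_group \<tau> \<alpha> \<beta>"
      using subgroup.m_inv_closed[OF sg g] by (simp add: inv_Aut_translation)
    show ?thesis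
    proof (induction p rule: int_induct[of _ 0])
      case base
      then show ?case using zero by (simp only: of_int_0 mult_zero_left)
    next
      case (step1 i)
      have "of_int (i + 1) * x = of_int i * x + x" by (simp add: algebra_simps)
      then show ?case using mul[OF step1(2) g] by (simp only:)
    next
      case (step2 i)
      have "of_int (i - 1) * x = of_int i * x + - x" by (simp add: algebra_simps)
      then show ?case using mul[OF step2(2) m] by (simp only:)
    qed
  qed
  show "torus_group \<tau> \<alpha> \<beta> = (+) ` lattice_of \<alpha> \<beta>"
  proof (intro equalityI subsetI)
    fix f assume "f \<in> torus_group \<tau> \<alpha> \<beta>"
    then show "f \<in> (+) ` lattice_of \<alpha> \<beta>" unfolding torus_group_def
    proof (induction f rule: generate.induct)
      case one
      have "\<one>\<^bsub>Aut \<tau>\<^esub> = (+) (0::complex)" by (simp add: fun_eq_iff)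
      then show ?case using lattice_of_gens(3) by (rule image_eqI)
    next
      case (incl h)
      then show ?case using lattice_of_gens by auto
    next
      case (inv h)
      then obtain x where x: "h = (+) x" "x \<in> {\<alpha>, \<beta>}" by blast
      then have "inv\<^bsub>Aut \<tau>\<^esub> h = (+) (- x)" using \<alpha> \<beta> inv_Aut_translation by auto
      moreover have "- x \<in> lattice_of \<alpha> \<beta>" using x(2) lattice_of_gens lattice_of_minus by blast
      ultimately show ?case by (rule image_eqI)
    next
      case (eng h1 h2)
      then obtain x y where xy: "h1 = (+) x" "h2 = (+) y" "x \<in> lattice_of \<alpha> \<beta>" "y \<in> lattice_of \<alpha> \<beta>" by blast
      then have "h1 \<otimes>\<^bsub>Aut \<tau>\<^esub> h2 = (+) (x + y)" by (simp only: Aut_simps plus_comp)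
      then show ?case using lattice_of_add[OF xy(3,4)] by (rule image_eqI)
    qed
  next
    fix f assume "f \<in> (+) ` lattice_of \<alpha> \<beta>"
    then obtain p q where "f = (+) (of_int p * \<alpha> + of_int q * \<beta>)" unfolding lattice_of_def by blast
    then show "f \<in> torus_group \<tau> \<alpha> \<beta>" using mul mult by simp
  qed
qed

text \<open>Used to count cosets by counting the values of an invariant.\<close>

lemma card_range_same_kernel:
  assumes "\<And>x y. f x = f y \<longleftrightarrow> g x = g y"
  shows "card (range f) = card (range g)"
proof -
  define h where "h = (\<lambda>u. g (inv_into UNIV f u))"
  have hf: "h (f x) = g x" for x
    using assms f_inv_into_f[of "f x" f UNIV] unfolding h_def by blast
  have "inj_on h (range f)" by (rule inj_onI) (use hf assms in auto)
  moreover have "h ` range f = range g" using hf by (simp add: image_image)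
  ultimately show ?thesis by (metis card_image)
qed

lemma lattice_of_scale:
  assumes "x \<in> lattice_of \<alpha> \<beta>" shows "of_int k * x \<in> lattice_of \<alpha> \<beta>"
proof -
  obtain p q where "x = of_int p * \<alpha> + of_int q * \<beta>" using assms unfolding lattice_of_def by blast
  then have "of_int k * x = of_int (k * p) * \<alpha> + of_int (k * q) * \<beta>" by (simp add: algebra_simps)
  then show ?thesis using lattice_ofI by metis
qed

lemma lattice_translate_eq_iff:
  "(\<lambda>z. z + x) ` lattice_of \<alpha> \<beta> = (\<lambda>z. z + y) ` lattice_of \<alpha> \<beta> \<longleftrightarrow> x - y \<in> lattice_of \<alpha> \<beta>"
proof
  assume "(\<lambda>z. z + x) ` lattice_of \<alpha> \<beta> = (\<lambda>z. z + y) ` lattice_of \<alpha> \<beta>"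
  then have "0 + x \<in> (\<lambda>z. z + y) ` lattice_of \<alpha> \<beta>" using lattice_of_gens(3) by blast
  then show "x - y \<in> lattice_of \<alpha> \<beta>" by auto
next
  assume xy: "x - y \<in> lattice_of \<alpha> \<beta>"
  show "(\<lambda>z. z + x) ` lattice_of \<alpha> \<beta> = (\<lambda>z. z + y) ` lattice_of \<alpha> \<beta>"
  proof (intro equalityI subsetI)
    fix w assume "w \<in> (\<lambda>z. z + x) ` lattice_of \<alpha> \<beta>"
    then obtain z where z: "w = z + x" "z \<in> lattice_of \<alpha> \<beta>" by blast
    have "w = (z + (x - y)) + y" using z(1) by simp
    then show "w \<in> (\<lambda>z. z + y) ` lattice_of \<alpha> \<beta>" using lattice_of_add[OF z(2) xy] by (rule image_eqI)
  next
    fix w assume "w \<in> (\<lambda>z. z + y) ` lattice_of \<alpha> \<beta>"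
    then obtain z where z: "w = z + y" "z \<in> lattice_of \<alpha> \<beta>" by blast
    have "w = (z - (x - y)) + x" using z(1) by simp
    then show "w \<in> (\<lambda>z. z + x) ` lattice_of \<alpha> \<beta>" using lattice_of_diff[OF z(2) xy] by (rule image_eqI)
  qed
qed

section \<open>The order spanned by 1 and sigma\<close>

text \<open>The Gaussian integers for \<open>t = 0\<close> and the Eisenstein integers for \<open>t = 1\<close>, where \<open>\<sigma>\<close> is a primitive fourth
or sixth root of unity with trace \<open>t\<close>.\<close>

locale quadratic_order =
  fixes \<sigma> :: complex and t :: int
  assumes t01: "t = 0 \<or> t = 1" and sq: "\<sigma> * \<sigma> = of_int t * \<sigma> - 1"
    and cnj_\<sigma>: "cnj \<sigma> = of_int t - \<sigma>" and Im_\<sigma>: "Im \<sigma> > 0"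
begin

definition pt :: "int \<Rightarrow> int \<Rightarrow> complex" where "pt a b = of_int a + of_int b * \<sigma>"

lemma pt_eq_iff: "pt a b = pt a' b' \<longleftrightarrow> a = a' \<and> b = b'"
proof
  assume e: "pt a b = pt a' b'"
  have "b = b'" using arg_cong[OF e, of Im] Im_\<sigma> by (simp add: pt_def)
  then show "a = a' \<and> b = b'" using e by (simp add: pt_def)
qed simp

lemma int_lattice_eq: "int_lattice \<sigma> = {pt a b |a b. True}"
  by (simp add: int_lattice_def pt_def)

lemma int_latticeD: "z \<in> int_lattice \<sigma> \<Longrightarrow> \<exists>a b. z = pt a b"
  unfolding int_lattice_eq by simp

lemma re_coord_pt: "re_coord \<sigma> (pt a b) = a" and im_coord_pt: "im_coord \<sigma> (pt a b) = b"
  unfolding re_coord_def im_coord_def pt_def[symmetric] by (simp_all add: pt_eq_iff)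

lemma pt_diff: "pt a b - pt a' b' = pt (a - a') (b - b')"
  and pt_add: "pt a b + pt a' b' = pt (a + a') (b + b')"
  and pt_scale: "of_int k * pt a b = pt (k * a) (k * b)"
  by (simp_all add: pt_def algebra_simps)

lemma pt_mult: "pt a b * pt a' b' = pt (a * a' - b * b') (a * b' + b * a' + t * (b * b'))"
proof -
  have "pt a b * pt a' b' = of_int (a * a') + of_int (a * b' + b * a') * \<sigma> + of_int (b * b') * (\<sigma> * \<sigma>)"
    by (simp add: pt_def algebra_simps)
  then show ?thesis unfolding sq by (simp add: pt_def algebra_simps)
qed

lemma one_sigma_pt: "1 + \<sigma> = pt 1 1"
  by (simp add: pt_def)

lemma rotate_pt: "\<sigma> * pt a b = pt (- b) (a + t * b)"
proof -
  have "\<sigma> * pt a b = pt 0 1 * pt a b" by (simp add: pt_def)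
  then show ?thesis unfolding pt_mult by simp
qed

lemma cnj_pt: "cnj (pt a b) = pt (a + t * b) (- b)"
  by (simp add: pt_def cnj_\<sigma> algebra_simps)

lemma int_norm_1_sigma: "int_norm (1 + \<sigma>) = 2 + t"
proof -
  have e: "(1 + \<sigma>) * cnj (1 + \<sigma>) = of_int (2 + t)"
    unfolding one_sigma_pt cnj_pt pt_mult by (simp add: pt_def)
  show ?thesis unfolding int_norm_def e by (rule the_equality) (auto simp only: of_int_eq_iff)
qed

lemma im_coord_det: "im_coord \<sigma> (cnj (pt a1 a2) * pt b1 b2) = a1 * b2 - a2 * b1"
  unfolding cnj_pt pt_mult im_coord_pt by (simp add: algebra_simps)

lemma lattice_of_pt:
  "lattice_of (pt a1 a2) (pt b1 b2) = {pt (p * a1 + q * b1) (p * a2 + q * b2) |p q. True}"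
  unfolding lattice_of_def pt_scale pt_add ..

lemma principal_lattice: "lattice_of \<eta> (\<sigma> * \<eta>) = {\<eta> * pt p q |p q. True}"
proof -
  have "of_int p * \<eta> + of_int q * (\<sigma> * \<eta>) = \<eta> * pt p q" for p q
    by (simp add: pt_def algebra_simps)
  then show ?thesis unfolding lattice_of_def by simp
qed

section \<open>The largest invariant sublattice\<close>

text \<open>The generators of the torus group are \<open>c * (a1 + a2 * \<sigma>)\<close> and \<open>c * (b1 + b2 * \<sigma>)\<close>, where \<open>c\<close> is the gcd of all
four coordinates; \<open>core_gen\<close> will generate the largest invariant sublattice. The condition \<open>ramified\<close>
says that \<open>1 + \<sigma>\<close>, the prime above \<open>2 + t\<close>, divides both generators after the division by \<open>c\<close>.\<close>

context
  fixes a1 a2 b1 b2 c :: int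
  assumes prim: "Gcd {a1, a2, b1, b2} = 1" and c: "c \<noteq> 0" and D0: "a1 * b2 - a2 * b1 \<noteq> 0"
begin

definition "lattice_det = a1 * b2 - a2 * b1"
definition "ramified \<longleftrightarrow> (2 + t) dvd (a1 - a2) \<and> (2 + t) dvd (b1 - b2)"
definition "core_scale = (if ramified then lattice_det div (2 + t) else lattice_det)"
definition "core_gen = of_int (c * core_scale) * (if ramified then 1 + \<sigma> else 1)"

lemma ramification_pos: "2 + t > 0"
  using t01 by auto

lemma ramified_det: "ramified \<Longrightarrow> lattice_det = (2 + t) * core_scale"
proof -
  assume d: "ramified"
  have "lattice_det = (a1 - a2) * b1 - a1 * (b1 - b2)" unfolding lattice_det_def by algebra
  then have "(2 + t) dvd lattice_det" using d unfolding ramified_def by (metis dvd_diff dvd_mult dvd_mult2)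
  then show ?thesis using d by (simp add: core_scale_def)
qed

lemma core_scale_nonzero: "core_scale \<noteq> 0"
  using ramified_det D0 by (cases "ramified") (auto simp: core_scale_def lattice_det_def)

lemma scaled_in_lattice_iff:
  "of_int c * pt y1 y2 \<in> lattice_of (of_int c * pt a1 a2) (of_int c * pt b1 b2) \<longleftrightarrow>
    lattice_det dvd (y1 * b2 - y2 * b1) \<and> lattice_det dvd (a1 * y2 - a2 * y1)"
proof -
  have "of_int c * pt y1 y2 \<in> lattice_of (of_int c * pt a1 a2) (of_int c * pt b1 b2) \<longleftrightarrow>
     (\<exists>p q. pt (c * y1) (c * y2) = pt (p * (c * a1) + q * (c * b1)) (p * (c * a2) + q * (c * b2)))"
    unfolding pt_scale lattice_of_pt by blast
  also have "\<dots> \<longleftrightarrow> (\<exists>p q. y1 = p * a1 + q * b1 \<and> y2 = p * a2 + q * b2)"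
  proof -
    have "pt (c * y1) (c * y2) = pt (p * (c * a1) + q * (c * b1)) (p * (c * a2) + q * (c * b2)) \<longleftrightarrow>
      y1 = p * a1 + q * b1 \<and> y2 = p * a2 + q * b2" for p q
    proof -
      have "p * (c * a1) + q * (c * b1) = c * (p * a1 + q * b1)" "p * (c * a2) + q * (c * b2) = c * (p * a2 + q * b2)"
        by algebra+
      then show ?thesis unfolding pt_eq_iff using c by simp
    qed
    then show ?thesis by simp
  qed
  finally show ?thesis unfolding lattice_det_def using in_lattice_iff[OF D0] by simp
qed

text \<open>The multiples of \<open>1 + \<sigma>\<close> are the elements whose two coordinates are congruent modulo \<open>2 + t\<close>.\<close>

lemma core_gen_multiples:
  "{core_gen * pt p q |p q. True} = {of_int c * pt (core_scale * z1) (core_scale * z2) |z1 z2. ramified \<longrightarrow> (2 + t) dvd (z1 - z2)}"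
proof (cases "ramified")
  case True
  have "core_gen * pt p q = of_int c * pt (core_scale * (p - q)) (core_scale * (p + q + t * q))" for p q
  proof -
    have "core_gen * pt p q = of_int (c * core_scale) * (pt 1 1 * pt p q)"
      unfolding core_gen_def one_sigma_pt using True by (simp only: if_True mult.assoc)
    also have "\<dots> = of_int c * pt (core_scale * (p - q)) (core_scale * (p + q + t * q))"
      unfolding pt_mult pt_scale pt_eq_iff by (simp add: algebra_simps)
    finally show ?thesis .
  qed
  moreover have "\<exists>p q. z1 = p - q \<and> z2 = p + q + t * q" if z: "(2 + t) dvd (z1 - z2)" for z1 z2
  proof -
    obtain k where "z1 - z2 = (2 + t) * k" using z unfolding dvd_def by blast
    then have "z1 = (z1 - k) - (- k) \<and> z2 = (z1 - k) + (- k) + t * (- k)" by (simp add: algebra_simps)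
    then show ?thesis by blast
  qed
  moreover have "(2 + t) dvd ((p - q) - (p + q + t * q))" for p q
    by (rule dvdI[of _ _ "- q"]) (simp add: algebra_simps)
  ultimately show ?thesis using True by (auto; metis)
next
  case False
  then have "core_gen * pt p q = of_int c * pt (core_scale * p) (core_scale * q)" for p q
    unfolding core_gen_def by (simp add: pt_scale mult.assoc)
  then show ?thesis using False by simp
qed

lemma core_gen_lattice_subset:
  "lattice_of core_gen (\<sigma> * core_gen) \<subseteq> lattice_of (of_int c * pt a1 a2) (of_int c * pt b1 b2)"
  unfolding principal_lattice core_gen_multiples
proof clarify
  fix z1 z2 assume z: "ramified \<longrightarrow> (2 + t) dvd (z1 - z2)"
  have "lattice_det dvd (core_scale * z1 * b2 - core_scale * z2 * b1) \<and> lattice_det dvd (a1 * (core_scale * z2) - a2 * (core_scale * z1))"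
  proof (cases "ramified")
    case True
    then obtain i j k where ijk: "z1 - z2 = (2 + t) * i" "a1 - a2 = (2 + t) * j" "b1 - b2 = (2 + t) * k"
      using z unfolding ramified_def by (auto elim!: dvdE)
    have "core_scale * z1 * b2 - core_scale * z2 * b1 = ((2 + t) * core_scale) * (b1 * i - z1 * k)"
      "a1 * (core_scale * z2) - a2 * (core_scale * z1) = ((2 + t) * core_scale) * (z1 * j - a1 * i)"
      using ijk by algebra+
    then show ?thesis using ramified_det[OF True] by simp
  next
    case False
    have "core_scale * z1 * b2 - core_scale * z2 * b1 = core_scale * (z1 * b2 - z2 * b1)" "a1 * (core_scale * z2) - a2 * (core_scale * z1) = core_scale * (a1 * z2 - a2 * z1)"
      by algebra+
    then show ?thesis using False by (simp add: core_scale_def)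
  qed
  then show "of_int c * pt (core_scale * z1) (core_scale * z2) \<in> lattice_of (of_int c * pt a1 a2) (of_int c * pt b1 b2)"
    unfolding scaled_in_lattice_iff .
qed

text \<open>Every element of the lattice is divisible by \<open>c\<close>; dividing by it leads to the primitive situation of
\<open>invariant_sublattice_bound\<close>.\<close>

lemma invariant_subset_core_gen:
  assumes diff: "\<And>x y. x \<in> L \<Longrightarrow> y \<in> L \<Longrightarrow> x - y \<in> L" and rot: "\<And>x. x \<in> L \<Longrightarrow> \<sigma> * x \<in> L"
    and con: "\<And>x. x \<in> L \<Longrightarrow> cnj x \<in> L"
    and sub: "L \<subseteq> lattice_of (of_int c * pt a1 a2) (of_int c * pt b1 b2)"
  shows "L \<subseteq> lattice_of core_gen (\<sigma> * core_gen)"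
proof
  fix x assume x: "x \<in> L"
  define K where "K = {(y1, y2). of_int c * pt y1 y2 \<in> L}"
  have K: "(y1, y2) \<in> K \<longleftrightarrow> of_int c * pt y1 y2 \<in> L" for y1 y2 by (simp add: K_def)
  obtain p q where "x = of_int p * (of_int c * pt a1 a2) + of_int q * (of_int c * pt b1 b2)"
    using x sub unfolding lattice_of_def by blast
  then have "x = of_int c * (of_int p * pt a1 a2 + of_int q * pt b1 b2)" by (simp add: algebra_simps)
  then obtain y1 y2 where xy: "x = of_int c * pt y1 y2" unfolding pt_scale pt_add by blast
  have y: "(y1, y2) \<in> K" using x xy K by simp
  have diffK: "(x1 - y1, x2 - y2) \<in> K" if "(x1, x2) \<in> K" "(y1, y2) \<in> K" for x1 x2 y1 y2
    using diff[OF that[unfolded K]] unfolding K pt_diff[symmetric] right_diff_distrib .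
  have rotK: "(- x2, x1 + t * x2) \<in> K" if "(x1, x2) \<in> K" for x1 x2
    using rot[OF that[unfolded K]] unfolding K rotate_pt[symmetric] by (simp add: mult.left_commute)
  have conK: "(x1 + t * x2, - x2) \<in> K" if "(x1, x2) \<in> K" for x1 x2
    using con[OF that[unfolded K]] unfolding K cnj_pt[symmetric] by simp
  have subK: "lattice_det dvd (x1 * b2 - x2 * b1) \<and> lattice_det dvd (a1 * x2 - a2 * x1)" if "(x1, x2) \<in> K" for x1 x2
    using that sub unfolding K scaled_in_lattice_iff[symmetric] by blast
  note bound = invariant_sublattice_bound[OF t01 prim, of K, folded lattice_det_def, OF diffK rotK conK subK y]
  show "x \<in> lattice_of core_gen (\<sigma> * core_gen)"
  proof (cases "ramified")
    case True
    then have b: "lattice_det dvd (2 + t) * y1 \<and> lattice_det dvd (2 + t) * y2 \<and> lattice_det dvd (y1 - y2)"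
      using bound(1) unfolding ramified_def by blast
    then have "core_scale dvd y1" "core_scale dvd y2" unfolding ramified_det[OF True] using ramification_pos by auto
    then obtain z1 z2 where z: "y1 = core_scale * z1" "y2 = core_scale * z2" by (auto elim!: dvdE)
    have "(2 + t) * core_scale dvd (z1 - z2) * core_scale" using b unfolding ramified_det[OF True] z by (simp add: algebra_simps)
    then have "(2 + t) dvd (z1 - z2)" using core_scale_nonzero by simp
    then show ?thesis unfolding principal_lattice core_gen_multiples xy z by blast
  next
    case False
    then have "core_scale dvd y1" "core_scale dvd y2" using bound(2) unfolding ramified_def core_scale_def by auto
    then obtain z1 z2 where z: "y1 = core_scale * z1" "y2 = core_scale * z2" by (auto elim!: dvdE)
    then show ?thesis unfolding principal_lattice core_gen_multiples xy using False by blast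
  qed
qed

lemma core_gen_nonzero: "core_gen \<noteq> 0"
proof -
  have "1 + \<sigma> \<noteq> 0" using Im_\<sigma> by (auto simp: complex_eq_iff)
  then show ?thesis using core_scale_nonzero c by (simp add: core_gen_def)
qed

lemma cnj_core_gen: "\<exists>p q. cnj core_gen = core_gen * pt p q"
proof (cases "ramified")
  case True
  have "(1 + \<sigma>) * pt t (-1) = cnj (1 + \<sigma>)"
    unfolding one_sigma_pt cnj_pt pt_mult by (simp add: pt_eq_iff)
  then have "cnj core_gen = core_gen * pt t (-1)" using True by (simp add: core_gen_def mult.assoc)
  then show ?thesis by blast
next
  case False
  then have "cnj core_gen = core_gen * pt 1 0" by (simp add: core_gen_def pt_def)
  then show ?thesis by blast
qed

lemma core_gen_eq_pt: "core_gen = pt (c * core_scale) (if ramified then c * core_scale else 0)"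
proof (cases "ramified")
  case True
  then have "core_gen = of_int (c * core_scale) * pt 1 1" by (simp only: core_gen_def if_True one_sigma_pt)
  then show ?thesis using True unfolding pt_scale by simp
next
  case False
  then show ?thesis by (simp add: core_gen_def pt_def)
qed

text \<open>In coordinates with respect to the two generators, the sublattice has a determinant that is the quotient of
the norm of \<open>core_gen\<close> by the determinant of the generators, and this quotient is \<open>core_scale\<close> up to sign.\<close>

lemma core_gen_index:
  "\<exists>F :: int \<times> int \<Rightarrow> int \<times> int.
     (\<forall>p q p' q'. F (p, q) = F (p', q') \<longleftrightarrow>
        (of_int p * (of_int c * pt a1 a2) + of_int q * (of_int c * pt b1 b2)) -
        (of_int p' * (of_int c * pt a1 a2) + of_int q' * (of_int c * pt b1 b2)) \<in> lattice_of core_gen (\<sigma> * core_gen)) \<and>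
     card (range F) = nat \<bar>core_scale\<bar>"
proof -
  let ?\<alpha> = "of_int c * pt a1 a2" and ?\<beta> = "of_int c * pt b1 b2"
  have indep: "of_int p * ?\<alpha> + of_int q * ?\<beta> = of_int p' * ?\<alpha> + of_int q' * ?\<beta> \<longleftrightarrow> p = p' \<and> q = q'" for p q p' q'
  proof
    assume "of_int p * ?\<alpha> + of_int q * ?\<beta> = of_int p' * ?\<alpha> + of_int q' * ?\<beta>"
    then have "c * (p * a1 + q * b1) = c * (p' * a1 + q' * b1)" "c * (p * a2 + q * b2) = c * (p' * a2 + q' * b2)"
      unfolding pt_scale pt_add pt_eq_iff by (simp_all add: algebra_simps)
    then have e: "p * a1 + q * b1 = p' * a1 + q' * b1" "p * a2 + q * b2 = p' * a2 + q' * b2" using c by simp_all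
    have "(a1 * b2 - a2 * b1) * p = (a1 * b2 - a2 * b1) * p'" "(a1 * b2 - a2 * b1) * q = (a1 * b2 - a2 * b1) * q'"
      using e by algebra+
    then show "p = p' \<and> q = q'" using D0 by simp
  qed simp
  obtain p1 q1 where g1: "core_gen = of_int p1 * ?\<alpha> + of_int q1 * ?\<beta>"
    using core_gen_lattice_subset lattice_of_gens(1) unfolding lattice_of_def[of ?\<alpha> ?\<beta>] by blast
  obtain p2 q2 where g2: "\<sigma> * core_gen = of_int p2 * ?\<alpha> + of_int q2 * ?\<beta>"
    using core_gen_lattice_subset lattice_of_gens(2) unfolding lattice_of_def[of ?\<alpha> ?\<beta>] by blast
  obtain e1 e2 where ge: "core_gen = pt e1 e2" using core_gen_eq_pt by blast
  have E: "e1 = c * (p1 * a1 + q1 * b1)" "e2 = c * (p1 * a2 + q1 * b2)"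
    using g1 unfolding ge pt_scale pt_add pt_eq_iff by (simp_all add: algebra_simps)
  have E': "- e2 = c * (p2 * a1 + q2 * b1)" "e1 + t * e2 = c * (p2 * a2 + q2 * b2)"
    using g2 unfolding ge rotate_pt unfolding pt_scale pt_add pt_eq_iff by (simp_all add: algebra_simps)
  have det: "e1 * (e1 + t * e2) + e2 * e2 = c * c * lattice_det * (p1 * q2 - q1 * p2)"
  proof -
    have "e1 * (e1 + t * e2) - e2 * (- e2) = c * c * lattice_det * (p1 * q2 - q1 * p2)"
      unfolding E' unfolding E lattice_det_def by algebra
    then show ?thesis by simp
  qed
  have "p1 * q2 - q1 * p2 = core_scale \<or> p1 * q2 - q1 * p2 = - core_scale"
  proof (cases "ramified")
    case True
    then have "pt e1 e2 = pt (c * core_scale) (c * core_scale)" using ge core_gen_eq_pt by simp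
    then have "e1 = c * core_scale" "e2 = c * core_scale" unfolding pt_eq_iff by simp_all
    then have "(c * c * lattice_det) * core_scale = c * c * lattice_det * (p1 * q2 - q1 * p2)"
      using det unfolding ramified_det[OF True] by (simp add: algebra_simps)
    then show ?thesis using c D0 by (simp add: lattice_det_def)
  next
    case False
    then have "pt e1 e2 = pt (c * core_scale) 0" using ge core_gen_eq_pt by simp
    then have "e1 = c * core_scale" "e2 = 0" unfolding pt_eq_iff by simp_all
    moreover have "lattice_det = core_scale" using False by (simp add: core_scale_def)
    ultimately have "(c * c * lattice_det) * core_scale = c * c * lattice_det * (p1 * q2 - q1 * p2)"
      using det by (simp add: algebra_simps)
    then show ?thesis using c D0 by (simp add: lattice_det_def)
  qed
  then have abs: "\<bar>p1 * q2 - q1 * p2\<bar> = \<bar>core_scale\<bar>" by auto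
  then have "p1 * q2 - q1 * p2 \<noteq> 0" using core_scale_nonzero by auto
  from lattice_index[OF this] obtain F :: "int \<times> int \<Rightarrow> int \<times> int"
    where F: "\<And>x1 x2 y1 y2. F (x1, x2) = F (y1, y2) \<longleftrightarrow>
        (\<exists>p q. x1 - y1 = p * p1 + q * p2 \<and> x2 - y2 = p * q1 + q * q2)"
      and card: "card (range F) = nat \<bar>p1 * q2 - q1 * p2\<bar>" by blast
  have "(of_int p * ?\<alpha> + of_int q * ?\<beta>) - (of_int p' * ?\<alpha> + of_int q' * ?\<beta>) \<in> lattice_of core_gen (\<sigma> * core_gen) \<longleftrightarrow>
     (\<exists>i j. p - p' = i * p1 + j * p2 \<and> q - q' = i * q1 + j * q2)" for p q p' q'
  proof -
    have "(of_int p * ?\<alpha> + of_int q * ?\<beta>) - (of_int p' * ?\<alpha> + of_int q' * ?\<beta>)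
        = of_int (p - p') * ?\<alpha> + of_int (q - q') * ?\<beta>" by (simp add: algebra_simps)
    moreover have "of_int i * core_gen + of_int j * (\<sigma> * core_gen) = of_int (i * p1 + j * p2) * ?\<alpha> + of_int (i * q1 + j * q2) * ?\<beta>" for i j
      unfolding g2 unfolding g1 by (simp add: algebra_simps)
    ultimately show ?thesis unfolding lattice_of_def mem_Collect_eq by (simp only: indep simp_thms)
  qed
  then show ?thesis using F card abs by (intro exI[of _ F]) simp
qed

end

end


section \<open>The minimal almost regular cover\<close>

lemma independent_if_Im_nonzero:
  assumes "Im (cnj x * y) \<noteq> 0" shows "x \<noteq> y" "independent {x, y}"
proof -
  show ne: "x \<noteq> y" using assms by auto
  have "x \<notin> span {y}"
  proof
    assume "x \<in> span {y}"
    then obtain k where "x = k *\<^sub>R y" by (auto simp: span_singleton)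
    then show False using assms by (simp add: algebra_simps)
  qed
  moreover have "y \<noteq> 0" using assms by auto
  ultimately show "independent {x, y}" using ne by (simp add: independent_insert)
qed

lemma e24_in_coordinates: "e24 6 = \<i>" "e24 4 = omega" "e24 8 = omega - 1"
  "omega * omega = omega - 1" "cnj omega = 1 - omega" "Im omega > 0"
proof -
  show "e24 6 = \<i>" by (simp add: e24_def complex_eq_iff)
  show e4: "e24 4 = omega" by (simp add: e24_def omega_def complex_eq_iff cos_60 sin_60)
  show oo: "omega * omega = omega - 1" by (simp add: omega_def complex_eq_iff)
  have "e24 8 = e24 4 * e24 4" by (simp flip: e24_add)
  then show "e24 8 = omega - 1" unfolding e4 oo .
  show "cnj omega = 1 - omega" "Im omega > 0" by (simp_all add: omega_def complex_eq_iff)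
qed

lemma vertex_type_flag:
  assumes "v \<in> vertices \<tau>" "vertex_type \<tau> v ps" "length ps > 0"
  obtains P e where "P \<in> \<tau>" "e edge_of P" "v \<in> e"
proof -
  obtain Ps where Ps: "length Ps = length ps \<and> distinct Ps \<and> set Ps = {P \<in> \<tau>. v \<in> P} \<and>
       (\<forall>j<length ps. regular_polygon (ps ! j) (Ps ! j)) \<and>
       (\<forall>j<length ps. \<exists>e. v \<in> e \<and> e edge_of (Ps ! j) \<and> e edge_of (Ps ! (Suc j mod length ps)))"
    using assms(2) unfolding vertex_type_def by (rule exE)
  then have "\<forall>j<length ps. \<exists>e. v \<in> e \<and> e edge_of (Ps ! j) \<and> e edge_of (Ps ! (Suc j mod length ps))"
    by (elim conjE)
  from this[rule_format, OF assms(3)] obtain e where "v \<in> e" "e edge_of (Ps ! 0)" by (elim exE conjE)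
  moreover have "Ps ! 0 \<in> \<tau>" using Ps assms(3) nth_mem[of 0 Ps] by auto
  ultimately show ?thesis using that[of "Ps ! 0" e] by simp
qed

context quadratic_order
begin

lemma order_multiple_closed:
  assumes "\<And>x. x \<in> lattice_of \<alpha> \<beta> \<Longrightarrow> \<sigma> * x \<in> lattice_of \<alpha> \<beta>" and "x \<in> lattice_of \<alpha> \<beta>"
  shows "pt p q * x \<in> lattice_of \<alpha> \<beta>"
proof -
  have "pt p q * x = of_int p * x + of_int q * (\<sigma> * x)" by (simp add: pt_def algebra_simps)
  then show ?thesis using assms lattice_of_add lattice_of_scale by metis
qed

text \<open>The rotation differs from \<open>\<sigma>\<close> by an integer and a sign only, so invariance under it gives invariance under \<open>\<sigma>\<close>.
The lattice is then an ideal, and the unit in the linear part of the reflection can be cancelled.\<close>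

lemma invariant_if_point_symmetries:
  assumes inv: "\<And>b l c. norm l = 1 \<Longrightarrow> simil b l c \<in> carrier (Aut \<tau>) \<Longrightarrow> simil 0 l c ` lattice_of \<alpha> \<beta> = lattice_of \<alpha> \<beta>"
    and rot: "\<exists>b l. norm l = 1 \<and> (l = \<sigma> - of_int t \<or> l = - \<sigma>) \<and> simil b l False \<in> carrier (Aut \<tau>)"
    and ref: "\<exists>b l. norm l = 1 \<and> simil b l True \<in> carrier (Aut \<tau>)"
    and unit: "\<And>b l c. norm l = 1 \<Longrightarrow> simil b l c \<in> carrier (Aut \<tau>) \<Longrightarrow> l \<in> int_lattice \<sigma>"
    and x: "x \<in> lattice_of \<alpha> \<beta>"
  shows "\<sigma> * x \<in> lattice_of \<alpha> \<beta>" "cnj x \<in> lattice_of \<alpha> \<beta>"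
proof -
  have image: "simil 0 l c x \<in> lattice_of \<alpha> \<beta>"
    if "norm l = 1" "simil b l c \<in> carrier (Aut \<tau>)" "x \<in> lattice_of \<alpha> \<beta>" for b l c x
    using inv[OF that(1,2)] that(3) by blast
  have \<sigma>: "\<sigma> * x \<in> lattice_of \<alpha> \<beta>" if x: "x \<in> lattice_of \<alpha> \<beta>" for x
  proof -
    obtain b l where l: "norm l = 1" "l = \<sigma> - of_int t \<or> l = - \<sigma>" "simil b l False \<in> carrier (Aut \<tau>)"
      using rot by blast
    have lx: "l * x \<in> lattice_of \<alpha> \<beta>" using image[OF l(1,3) x] by (simp add: simil_def)
    from l(2) show ?thesis
    proof
      assume "l = \<sigma> - of_int t"
      then have "\<sigma> * x = l * x + of_int t * x" by (simp add: left_diff_distrib)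
      then show ?thesis using lattice_of_add[OF lx lattice_of_scale[OF x]] by metis
    next
      assume "l = - \<sigma>"
      then have "\<sigma> * x = - (l * x)" by simp
      then show ?thesis using lattice_of_minus[OF lx] by metis
    qed
  qed
  show "\<sigma> * x \<in> lattice_of \<alpha> \<beta>" by (rule \<sigma>[OF x])
  obtain b l where l: "norm l = 1" "simil b l True \<in> carrier (Aut \<tau>)" using ref by blast
  obtain p q where "l = pt p q" using unit[OF l] unfolding int_lattice_eq by blast
  then have cl: "cnj l = pt (p + t * q) (- q)" by (simp add: cnj_pt)
  have lx: "l * cnj x \<in> lattice_of \<alpha> \<beta>" using image[OF l x] by (simp add: simil_def)
  have "l * cnj l = 1" using l(1) complex_norm_square[of l] by simp
  moreover have "cnj l * (l * cnj x) = (l * cnj l) * cnj x" by (simp add: mult_ac)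
  ultimately have e: "cnj l * (l * cnj x) = cnj x" by (simp only: mult_1)
  have "cnj l * (l * cnj x) \<in> lattice_of \<alpha> \<beta>" unfolding cl by (rule order_multiple_closed[OF \<sigma> lx])
  then show "cnj x \<in> lattice_of \<alpha> \<beta>" unfolding e .
qed

lemma principal_invariant:
  assumes cnj_\<eta>: "\<exists>p q. cnj \<eta> = \<eta> * pt p q" and l: "norm l = 1" "l \<in> int_lattice \<sigma>"
  shows "simil 0 l c ` lattice_of \<eta> (\<sigma> * \<eta>) = lattice_of \<eta> (\<sigma> * \<eta>)"
proof -
  let ?L = "lattice_of \<eta> (\<sigma> * \<eta>)"
  have mult: "pt p q * x \<in> ?L" if x: "x \<in> ?L" for p q x
  proof -
    obtain i j where "x = \<eta> * pt i j" using x unfolding principal_lattice by blast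
    then have "pt p q * x = \<eta> * (pt p q * pt i j)" by (simp add: mult_ac)
    then show ?thesis unfolding principal_lattice pt_mult by blast
  qed
  have con: "cnj x \<in> ?L" if x: "x \<in> ?L" for x
  proof -
    obtain i j where "x = \<eta> * pt i j" using x unfolding principal_lattice by blast
    moreover obtain p q where "cnj \<eta> = \<eta> * pt p q" using cnj_\<eta> by blast
    ultimately have "cnj x = \<eta> * (pt p q * pt (i + t * j) (- j))" by (simp add: cnj_pt mult.assoc)
    then show ?thesis unfolding principal_lattice pt_mult by blast
  qed
  obtain p q where lp: "l = pt p q" using l(2) unfolding int_lattice_eq by blast
  have ll: "l * cnj l = 1" using l(1) complex_norm_square[of l] by simp
  have into: "simil 0 l c x \<in> ?L" if "x \<in> ?L" for x
    using mult con that unfolding simil_def lp by simp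
  have onto: "x \<in> simil 0 l c ` ?L" if x: "x \<in> ?L" for x
  proof (cases c)
    case True
    have "x = simil 0 l c (l * cnj x)" using True ll by (simp add: simil_def mult.assoc[symmetric])
    moreover have "l * cnj x \<in> ?L" unfolding lp by (rule mult[OF con[OF x]])
    ultimately show ?thesis by (rule image_eqI)
  next
    case False
    have "x = simil 0 l c (cnj l * x)" using False ll by (simp add: simil_def mult.assoc[symmetric])
    moreover have "cnj l * x \<in> ?L" unfolding lp cnj_pt by (rule mult[OF x])
    ultimately show ?thesis by (rule image_eqI)
  qed
  show ?thesis using into onto by blast
qed

lemma det_nonzero:
  assumes "pt x1 x2 / pt y1 y2 \<notin> \<rat>" and "pt y1 y2 \<noteq> 0"
  shows "x1 * y2 - x2 * y1 \<noteq> 0"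
proof
  assume d: "x1 * y2 - x2 * y1 = 0"
  have "\<exists>m n. n \<noteq> 0 \<and> of_int n * pt x1 x2 = of_int m * pt y1 y2"
  proof (cases "y2 = 0")
    case False
    have "of_int y2 * pt x1 x2 = of_int x2 * pt y1 y2"
      unfolding pt_scale pt_eq_iff using d by (simp add: algebra_simps)
    then show ?thesis using False by blast
  next
    case True
    then have y1: "y1 \<noteq> 0" using assms(2) by (auto simp: pt_def)
    have "of_int y1 * pt x1 x2 = of_int x1 * pt y1 y2"
      unfolding pt_scale pt_eq_iff using d True by (simp add: algebra_simps)
    then show ?thesis using y1 by blast
  qed
  then obtain m n where mn: "n \<noteq> 0" "of_int n * pt x1 x2 = of_int m * pt y1 y2" by blast
  then have "pt x1 x2 / pt y1 y2 = of_int m / of_int n"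
    using assms(2) by (simp add: divide_eq_eq eq_divide_eq mult.commute)
  then show False using assms(1) by simp
qed

end

theorem theorem4p2:
  fixes \<tau> :: "complex set set" and ps :: "nat list"
    and \<sigma> \<alpha> \<beta> \<eta> :: complex and c N :: int and divisible :: bool
  assumes "archimedean \<tau>"
    and "ps \<in> {[4,8,8], [3,6,3,6], [3,12,12], [4,6,12], [3,4,6,4], [3,3,4,3,4]}"
    and "has_type \<tau> ps"
    and "\<sigma> = (if ps = [4,8,8] \<or> ps = [3,3,4,3,4] then \<i> else omega)"
    and "0 \<in> vertices \<tau>"
    and "translation_group \<tau> = (+) ` int_lattice \<sigma>"
    and "\<alpha> \<in> int_lattice \<sigma> - {0}" and "\<beta> \<in> int_lattice \<sigma> - {0}"
    and "\<alpha> / \<beta> \<notin> \<rat>"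
    and "c = Gcd {re_coord \<sigma> \<alpha>, im_coord \<sigma> \<alpha>, re_coord \<sigma> \<beta>, im_coord \<sigma> \<beta>}"
    and "N = int_norm (1 + \<sigma>)"
    and "divisible \<longleftrightarrow>
           N dvd (re_coord \<sigma> \<alpha> div c - im_coord \<sigma> \<alpha> div c) \<and>
           N dvd (re_coord \<sigma> \<beta> div c - im_coord \<sigma> \<beta> div c)"
    and "\<eta> = (if divisible
                then of_int (im_coord \<sigma> (cnj \<alpha> * \<beta>)) / (of_int N * of_int c) * (1 + \<sigma>)
                else of_int (im_coord \<sigma> (cnj \<alpha> * \<beta>)) / of_int c)"
  shows "(\<forall>H. minimal_almost_regular_cover \<tau> (torus_group \<tau> \<alpha> \<beta>) H
                \<longleftrightarrow> H = torus_group \<tau> \<eta> (\<sigma> * \<eta>)) \<and>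
         real (glued_regions \<tau> (torus_group \<tau> \<alpha> \<beta>) (torus_group \<tau> \<eta> (\<sigma> * \<eta>))) =
           (if divisible
            then \<bar>of_int (im_coord \<sigma> (cnj \<alpha> * \<beta>))\<bar> / (of_int N * (of_int c)\<^sup>2)
            else \<bar>of_int (im_coord \<sigma> (cnj \<alpha> * \<beta>))\<bar> / (of_int c)\<^sup>2)"
proof -
  have T: "tessellation \<tau>" using assms(1) by (simp add: archimedean_def)
  define t :: int where "t = (if ps = [4,8,8] \<or> ps = [3,3,4,3,4] then 0 else 1)"
  define r :: int where "r = (if ps = [4,8,8] \<or> ps = [3,3,4,3,4] then 6 else 8)"
  interpret quadratic_order \<sigma> t
    using e24_in_coordinates(4-6) by unfold_locales (auto simp: t_def assms(4))
  have vt: "vertex_type \<tau> 0 ps" using assms(3,5) by (simp add: has_type_def)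
  have "length ps > 0" using assms(2) by auto
  from vertex_type_flag[OF assms(5) vt this] obtain P e where P: "P \<in> \<tau>" and e: "e edge_of P" "0 \<in> e" .
  have V: "vertices \<tau> \<noteq> {}" using assms(5) by blast
  note syms = symmetries_of_type[OF T V assms(3,2) r_def]
  have er: "e24 r = \<sigma> - of_int t"
    using e24_in_coordinates(1,3) by (simp add: r_def t_def assms(4))
  then have "cnj (e24 r) = cnj (\<sigma> - of_int t)" by (rule arg_cong)
  then have er': "e24 (- r) = - \<sigma>" using cnj_\<sigma> by simp
  have rot: "\<exists>b l. norm l = 1 \<and> (l = \<sigma> - of_int t \<or> l = - \<sigma>) \<and> simil b l False \<in> carrier (Aut \<tau>)"
    using syms(1) er er' norm_e24 by metis
  have trans: "(+) z \<in> carrier (Aut \<tau>) \<longleftrightarrow> z \<in> int_lattice \<sigma>" for z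
  proof -
    have "(+) z \<in> carrier (Aut \<tau>) \<longleftrightarrow> (+) z \<in> translation_group \<tau>" unfolding translation_group_def by blast
    also have "\<dots> \<longleftrightarrow> z \<in> int_lattice \<sigma>" unfolding assms(6) by (auto simp: plus_inj)
    finally show ?thesis .
  qed
  have unit: "l \<in> int_lattice \<sigma>" if l: "norm l = 1" and f: "simil b l c \<in> carrier (Aut \<tau>)" for b l c
  proof -
    interpret A: group "Aut \<tau>" by (rule group_Aut)
    have "1 = pt 1 0" by (simp add: pt_def)
    then have "(+) 1 \<in> carrier (Aut \<tau>)" unfolding trans int_lattice_eq by blast
    from A.m_closed[OF A.m_closed[OF f this] A.inv_closed[OF f]]
    have "simil b l c \<circ> (+) 1 \<circ> inv_into UNIV (simil b l c) \<in> carrier (Aut \<tau>)"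
      unfolding inv_Aut[OF f] Aut_simps .
    then show ?thesis unfolding conjugate_translation[OF l] trans by (simp add: simil_def split: if_splits)
  qed
  have regular_iff: "almost_regular \<tau> (torus_group \<tau> x y) \<longleftrightarrow>
     (\<forall>b l c. norm l = 1 \<longrightarrow> simil b l c \<in> carrier (Aut \<tau>) \<longrightarrow> simil 0 l c ` lattice_of x y = lattice_of x y)"
    if "x \<in> int_lattice \<sigma>" "y \<in> int_lattice \<sigma>" for x y
  proof -
    have xy: "(+) x \<in> carrier (Aut \<tau>)" "(+) y \<in> carrier (Aut \<tau>)" using that trans by simp_all
    have "(+) ` lattice_of x y \<subseteq> carrier (Aut \<tau>)"
      using subgroup.subset[OF torus_group_eq(2)[OF xy]] torus_group_eq(1)[OF xy] by simp
    from normalizer_translations_iff[OF this] show ?thesis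
      using almost_regular_iff_normal[OF assms(1,5) P e torus_group_eq(2)[OF xy]] torus_group_eq(1)[OF xy] by simp
  qed
  have in_order: "\<alpha> \<in> int_lattice \<sigma>" "\<beta> \<in> int_lattice \<sigma>" and nonzero: "\<beta> \<noteq> 0"
    using assms(7,8) by simp_all
  obtain x1 x2 where \<alpha>: "\<alpha> = pt x1 x2" using int_latticeD[OF in_order(1)] by (elim exE)
  obtain y1 y2 where \<beta>: "\<beta> = pt y1 y2" using int_latticeD[OF in_order(2)] by (elim exE)
  have cG: "c = Gcd {x1, x2, y1, y2}" using assms(10) unfolding \<alpha> \<beta> re_coord_pt im_coord_pt .
  have det0: "x1 * y2 - x2 * y1 \<noteq> 0" using det_nonzero[of x1 x2 y1 y2] nonzero assms(9) unfolding \<alpha> \<beta> by simp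
  have cdvd: "c dvd x1" "c dvd x2" "c dvd y1" "c dvd y2" unfolding cG by (rule Gcd_dvd; simp)+
  have c0: "c \<noteq> 0" using cdvd det0 by auto
  obtain a1 a2 b1 b2 where xc: "x1 = c * a1" "x2 = c * a2" and yc: "y1 = c * b1" "y2 = c * b2"
    using cdvd by (auto elim!: dvdE)
  have prim: "Gcd {a1, a2, b1, b2} = 1"
  proof -
    define g where "g = Gcd {a1, a2, b1, b2}"
    have "c = Gcd ((*) c ` {a1, a2, b1, b2})" using cG unfolding xc yc by simp
    also have "\<dots> = normalize (c * g)" unfolding g_def by (rule Gcd_mult)
    finally have "c = \<bar>c * g\<bar>" by simp
    moreover from this have "c \<ge> 0" by (metis abs_ge_zero)
    moreover have "g \<ge> 0" unfolding g_def by simp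
    ultimately have "c = c * g" by simp
    then show ?thesis using c0 unfolding g_def by simp
  qed
  have D0: "a1 * b2 - a2 * b1 \<noteq> 0"
  proof
    assume "a1 * b2 - a2 * b1 = 0"
    moreover have "x1 * y2 - x2 * y1 = c * c * (a1 * b2 - a2 * b1)" unfolding xc yc by algebra
    ultimately show False using det0 by simp
  qed
  note ctx = prim c0 D0
  let ?M = "core_scale a1 a2 b1 b2" and ?g = "core_gen a1 a2 b1 b2 c"
  have N: "N = 2 + t" using assms(11) int_norm_1_sigma by simp
  have div_iff: "divisible \<longleftrightarrow> ramified a1 a2 b1 b2"
    unfolding assms(12) \<alpha> \<beta> re_coord_pt im_coord_pt ramified_def[OF ctx] N xc yc using c0 by simp
  have im: "im_coord \<sigma> (cnj \<alpha> * \<beta>) = c * c * (a1 * b2 - a2 * b1)"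
    unfolding \<alpha> \<beta> im_coord_det xc yc by algebra
  have ram: "a1 * b2 - a2 * b1 = (if divisible then N * ?M else ?M)"
    using ramified_det[OF ctx] lattice_det_def[OF ctx] core_scale_def[OF ctx] div_iff N by auto
  have N0: "N > 0" using N t01 by auto
  have \<eta>: "\<eta> = ?g"
    unfolding assms(13) im core_gen_def[OF ctx] div_iff[symmetric] using c0 N0 ram
    by (simp add: field_simps)
  have \<alpha>c: "\<alpha> = of_int c * pt a1 a2" and \<beta>c: "\<beta> = of_int c * pt b1 b2"
    unfolding \<alpha> \<beta> xc yc pt_scale by simp_all
  obtain e1 e2 where \<eta>pt: "\<eta> = pt e1 e2" using core_gen_eq_pt[OF ctx] unfolding \<eta> by blast
  have g_order: "\<eta> \<in> int_lattice \<sigma>" "\<sigma> * \<eta> \<in> int_lattice \<sigma>"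
    unfolding \<eta>pt rotate_pt int_lattice_eq by blast+
  have \<eta>0: "\<eta> \<noteq> 0" unfolding \<eta> by (rule core_gen_nonzero[OF ctx])
  let ?G = "torus_group \<tau> \<alpha> \<beta>" and ?H = "torus_group \<tau> \<eta> (\<sigma> * \<eta>)"
  have torus_eq: "torus_group \<tau> x y = (+) ` lattice_of x y" if "x \<in> int_lattice \<sigma>" "y \<in> int_lattice \<sigma>" for x y
    using torus_group_eq(1) trans that by blast
  have sub: "lattice_of \<eta> (\<sigma> * \<eta>) \<subseteq> lattice_of \<alpha> \<beta>"
    unfolding \<eta> \<alpha>c \<beta>c by (rule core_gen_lattice_subset[OF ctx])
  have cover: "almost_regular_cover \<tau> ?G ?H"
    unfolding almost_regular_cover_def
  proof (intro conjI)
    have "Im (cnj \<eta> * (\<sigma> * \<eta>)) = (norm \<eta>)\<^sup>2 * Im \<sigma>"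
    proof -
      have "cnj \<eta> * (\<sigma> * \<eta>) = of_real ((norm \<eta>)\<^sup>2) * \<sigma>" unfolding complex_norm_square by (simp only: mult_ac)
      then have "Im (cnj \<eta> * (\<sigma> * \<eta>)) = Im (of_real ((norm \<eta>)\<^sup>2) * \<sigma>)" by (rule arg_cong)
      also have "\<dots> = (norm \<eta>)\<^sup>2 * Im \<sigma>" by (simp del: of_real_power)
      finally show ?thesis .
    qed
    then have "Im (cnj \<eta> * (\<sigma> * \<eta>)) \<noteq> 0" using \<eta>0 Im_\<sigma> by simp
    from independent_if_Im_nonzero[OF this]
    show "toroidal \<tau> ?H" unfolding toroidal_def assms(6) using g_order by blast
    show "almost_regular \<tau> ?H" unfolding regular_iff[OF g_order]
    proof (intro allI impI)
      fix b l c' assume l: "norm (l::complex) = 1" and f: "simil b l c' \<in> carrier (Aut \<tau>)"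
      show "simil 0 l c' ` lattice_of \<eta> (\<sigma> * \<eta>) = lattice_of \<eta> (\<sigma> * \<eta>)"
        using principal_invariant[OF _ l unit[OF l f]] cnj_core_gen[OF ctx] unfolding \<eta> by blast
    qed
    show "covers ?H ?G" unfolding covers_def torus_eq[OF g_order] torus_eq[OF in_order]
      by (rule image_mono[OF sub])
  qed
  have largest: "K \<subseteq> ?H" if K: "almost_regular_cover \<tau> ?G K" for K
  proof -
    have K': "toroidal \<tau> K" "almost_regular \<tau> K" "K \<subseteq> ?G"
      using K unfolding almost_regular_cover_def covers_def by blast+
    obtain x y where xy: "(+) x \<in> translation_group \<tau>" "(+) y \<in> translation_group \<tau>" and Kxy: "K = torus_group \<tau> x y"
      using K'(1) unfolding toroidal_def by blast
    have xyo: "x \<in> int_lattice \<sigma>" "y \<in> int_lattice \<sigma>" using xy unfolding assms(6) by (auto simp: plus_inj)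
    have inv: "simil 0 l c' ` lattice_of x y = lattice_of x y" if "norm l = 1" "simil b l c' \<in> carrier (Aut \<tau>)" for b l c'
      using K'(2) that unfolding Kxy regular_iff[OF xyo] by blast
    note closed = invariant_if_point_symmetries[OF inv rot syms(2) unit]
    have "inj ((+) :: complex \<Rightarrow> complex \<Rightarrow> complex)" by (auto simp: inj_def plus_inj)
    note inj = inj_image_subset_iff[OF this]
    have L_sub: "lattice_of x y \<subseteq> lattice_of \<alpha> \<beta>"
      using K'(3) unfolding Kxy torus_eq[OF xyo] torus_eq[OF in_order] inj .
    have "lattice_of x y \<subseteq> lattice_of \<eta> (\<sigma> * \<eta>)"
      unfolding \<eta>
      by (rule invariant_subset_core_gen[OF ctx lattice_of_diff closed L_sub[unfolded \<alpha>c \<beta>c]])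
    then show ?thesis unfolding Kxy torus_eq[OF xyo] torus_eq[OF g_order] by (rule image_mono)
  qed
  have minimal: "minimal_almost_regular_cover \<tau> ?G H \<longleftrightarrow> H = ?H" for H
  proof
    assume "minimal_almost_regular_cover \<tau> ?G H"
    then have H: "almost_regular_cover \<tau> ?G H" "\<And>K. almost_regular_cover \<tau> ?G K \<Longrightarrow> covers H K \<Longrightarrow> K = H"
      unfolding minimal_almost_regular_cover_def by blast+
    have "covers H ?H" unfolding covers_def by (rule largest[OF H(1)])
    from H(2)[OF cover this] show "H = ?H" by simp
  next
    assume "H = ?H"
    moreover have "K = ?H" if "almost_regular_cover \<tau> ?G K" "covers ?H K" for K
      using largest[OF that(1)] that(2) unfolding covers_def by blast
    ultimately show "minimal_almost_regular_cover \<tau> ?G H"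
      unfolding minimal_almost_regular_cover_def using cover by blast
  qed
  have index: "glued_regions \<tau> ?G ?H = nat \<bar>?M\<bar>"
  proof -
    let ?L = "lattice_of \<eta> (\<sigma> * \<eta>)"
    define x where "x = (\<lambda>(p::int, q::int). of_int p * \<alpha> + of_int q * \<beta>)"
    obtain F :: "int \<times> int \<Rightarrow> int \<times> int"
      where F: "\<And>p q p' q'. F (p, q) = F (p', q') \<longleftrightarrow> x (p, q) - x (p', q') \<in> ?L"
        and card: "card (range F) = nat \<bar>?M\<bar>"
      using core_gen_index[OF ctx] unfolding \<eta>[symmetric] \<alpha>c[symmetric] \<beta>c[symmetric] x_def by auto
    have coset: "((+) ` ?L) #>\<^bsub>Aut \<tau>\<^esub> (+) y = (+) ` (\<lambda>z. z + y) ` ?L" for y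
      unfolding r_coset_def by (simp add: plus_comp image_image UNION_singleton_eq_range)
    have "lattice_of \<alpha> \<beta> = range x" unfolding lattice_of_def x_def by auto
    then have "rcosets\<^bsub>Aut \<tau>\<lparr>carrier := ?G\<rparr>\<^esub> ?H = range (\<lambda>u. (+) ` (\<lambda>z. z + x u) ` ?L)"
      unfolding RCOSETS_def torus_eq[OF g_order] torus_eq[OF in_order]
      by (simp add: coset image_image UNION_singleton_eq_range)
    moreover have "card (range (\<lambda>u. (+) ` (\<lambda>z. z + x u) ` ?L)) = card (range F)"
    proof (rule card_range_same_kernel)
      fix u w :: "int \<times> int"
      show "(+) ` (\<lambda>z. z + x u) ` ?L = (+) ` (\<lambda>z. z + x w) ` ?L \<longleftrightarrow> F u = F w"
        unfolding plus_image_eq_iff lattice_translate_eq_iff using F[of "fst u" "snd u" "fst w" "snd w"] by simp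
    qed
    ultimately show ?thesis using card unfolding glued_regions_def by simp
  qed
  have "real (nat \<bar>?M\<bar>) =
      (if divisible then \<bar>of_int (im_coord \<sigma> (cnj \<alpha> * \<beta>))\<bar> / (of_int N * (of_int c)\<^sup>2)
       else \<bar>of_int (im_coord \<sigma> (cnj \<alpha> * \<beta>))\<bar> / (of_int c)\<^sup>2)"
    unfolding im ram using c0 N0 by (simp add: abs_mult power2_eq_square field_simps)
  then show ?thesis using minimal index by simp
qed

end
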